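(* For every integer $n\ge 1$ the following two formal linear combinations of isomorphism classes of bicolored graphs are equal: $$\sum_{M_1=(G_1,S_1)} G_1=\sum_{M_2=(G_2,S_2)}\operatorname{mon}^{\mathrm{top}}_{M_2}\,G_2,$$ where the sum on the left runs over all oriented, unlabeled, rooted, connected maps $M_1$ with $n$ edges (with arbitrary number and sizes of faces), and the sum on the right runs over all non-oriented, unlabeled, rooted maps $M_2$ with $n$ edges and exactly one face. Equivalently: for every bicolored graph $G$, the number of oriented rooted connected unlabeled maps with $n$ edges whose underlying graph is isomorphic to $G$ equals $\sum \operatorname{mon}^{\mathrm{top}}_{M_2}$ over non-oriented rooted unlabeled one-face maps $M_2$ with $n$ edges whose underlying graph is isomorphic to $G$.
   Context: A bicolored graph has vertices colored black and white, every edge joins a black and a white vertex, multiple edges allowed, no isolated vertices. A map $M=(G,S)$ is a bicolored graph $G$ drawn on a (possibly disconnected) compact surface $S$ without boundary so that each connected component of $S\setminus G$ (a face) is homeomorphic to an open disc. An oriented map is a map on an orientable surface with a prescribed orientation; a non-oriented map is a map on an arbitrary surface with no extra structure. Each edge has two edge-sides. A rooted oriented map has one distinguished edge; a rooted non-oriented map has one distinguished edge-side. "Unlabeled" means maps are counted up to isomorphism (preserving colors, the embedding, the root, and for oriented maps the orientation). A non-oriented map can be viewed as a ribbon graph (vertices are discs, edges are thin ribbons attached to the discs; faces are the boundary components of the union). For a non-oriented map $M$ with $n$ edges, $\operatorname{mon}^{\mathrm{top}}_M$ is defined as follows: remove the edges (ribbons) of $M$ one by one in a uniformly random order (whenever a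 vertex becomes isolated it is removed too); $\operatorname{mon}^{\mathrm{top}}_M$ is the probability that at every stage (starting from $M$ itself and after each removal) the number of faces of the current ribbon graph equals the number of its connected components. *)

theory Defs
  imports
    "HOL-Library.Disjoint_Sets"
    "HOL-Library.Poly_Mapping"
    "HOL-Combinatorics.Multiset_Permutations"
    "HOL-Probability.Probability"
begin

section \<open>Bicolored graphs\<close>

text \<open>
  Multigraphs; the two colors are kept apart by using two separate vertex sets, so a black and a
  white vertex are never identified, whatever their representations are.
\<close>

record ('b, 'w, 'e) bigraph =
  black_verts :: "'b set"
  white_verts :: "'w set"
  graph_edges :: "'e set"
  black_end :: "'e \<Rightarrow> 'b"
  white_end :: "'e \<Rightarrow> 'w"

text \<open>The two image equations also say that there are no isolated vertices.\<close>

definition bicolored_graph :: "('b, 'w, 'e) bigraph \<Rightarrow> bool" where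
  "bicolored_graph G \<longleftrightarrow>
     finite (graph_edges G) \<and>
     black_end G ` graph_edges G = black_verts G \<and>
     white_end G ` graph_edges G = white_verts G"

definition bigraph_iso ::
    "('b, 'w, 'e) bigraph \<Rightarrow> ('b2, 'w2, 'e2) bigraph \<Rightarrow> bool" where
  "bigraph_iso G H \<longleftrightarrow> (\<exists>f g h.
     bij_betw f (black_verts G) (black_verts H) \<and>
     bij_betw g (white_verts G) (white_verts H) \<and>
     bij_betw h (graph_edges G) (graph_edges H) \<and>
     (\<forall>e \<in> graph_edges G. black_end H (h e) = f (black_end G e) \<and>
                           white_end H (h e) = g (white_end G e)))"

definition bigraph_class :: "('b, 'w, 'e) bigraph \<Rightarrow> ('b, 'w, 'e) bigraph set" where
  "bigraph_class G = {H. bicolored_graph H \<and> bigraph_iso G H}"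


section \<open>Bicolored maps as ribbon graphs\<close>

text \<open>
  A bicolored map is given by the gluing data of its ribbon graph. An edge (a ribbon) is the pair
  of its two edge-sides. The boundary circle of the disc of a vertex alternates between the
  segments where ribbons are attached and free arcs (the corners of the vertex); each corner joins
  one edge-side to the next one around the vertex. Every edge-side has one black and one white end,
  so the corners at black vertices form a pair-partition of the edge-sides, and so do the corners
  at white vertices. A corner may coincide, as a pair, with an edge: this is a vertex of degree one.
  Conversely every triple of pair-partitions is the gluing data of a ribbon graph, and the map
  is recovered by gluing a disc to each boundary component. Homeomorphic maps are those
  whose gluing data are carried to each other by a bijection between the edge-sides.
\<close>

record 'd bimap =
  sides :: "'d set"
  edges :: "'d set set"
  black_corners :: "'d set set"
  white_corners :: "'d set set"

definition pair_partition :: "'d set \<Rightarrow> 'd set set \<Rightarrow> bool" where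
  "pair_partition D P \<longleftrightarrow> partition_on D P \<and> (\<forall>p \<in> P. card p = 2)"

definition bicolored_map :: "'d bimap \<Rightarrow> bool" where
  "bicolored_map M \<longleftrightarrow>
     finite (sides M) \<and>
     pair_partition (sides M) (edges M) \<and>
     pair_partition (sides M) (black_corners M) \<and>
     pair_partition (sides M) (white_corners M)"

text \<open>The classes of edge-sides generated by the gluings in a family of pairs.\<close>

definition glued :: "'d set set \<Rightarrow> ('d \<times> 'd) set" where
  "glued P = {(x, y). \<exists>p \<in> P. x \<in> p \<and> y \<in> p}\<^sup>*"

text \<open>
  Following the boundary of a vertex one meets alternately edges (across their ends) and corners;
  following a boundary component of the ribbon graph one meets edge-sides, joined alternately by
  black and white corners.
\<close>

definition black_vertices :: "'d bimap \<Rightarrow> 'd set set" where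
  "black_vertices M = sides M // glued (edges M \<union> black_corners M)"

definition white_vertices :: "'d bimap \<Rightarrow> 'd set set" where
  "white_vertices M = sides M // glued (edges M \<union> white_corners M)"

definition faces :: "'d bimap \<Rightarrow> 'd set set" where
  "faces M = sides M // glued (black_corners M \<union> white_corners M)"

definition components :: "'d bimap \<Rightarrow> 'd set set" where
  "components M = sides M // glued (edges M \<union> black_corners M \<union> white_corners M)"

text \<open>The black (white) end of an edge is the black (white) vertex containing its two sides.\<close>

definition underlying_graph :: "'d bimap \<Rightarrow> ('d set, 'd set, 'd set) bigraph" where
  "underlying_graph M =
     \<lparr>black_verts = black_vertices M, white_verts = white_vertices M, graph_edges = edges M,
      black_end = (\<lambda>e. glued (edges M \<union> black_corners M) `` e),
      white_end = (\<lambda>e. glued (edges M \<union> white_corners M) `` e)\<rparr>"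

text \<open>
  An orientation of the surface is encoded by the set of those edge-sides that are traversed from
  the black to the white end when the boundary of the adjacent face is followed in the positive
  direction. The direction alternates at each corner, and the orientations of the faces
  are compatible along an edge iff its two sides are traversed in opposite directions. Thus
  an orientation exists iff the surface is orientable, and a connected orientable surface has
  exactly two of them.
\<close>

definition orientation :: "'d bimap \<Rightarrow> 'd set \<Rightarrow> bool" where
  "orientation M B \<longleftrightarrow>
     B \<subseteq> sides M \<and>
     (\<forall>p \<in> edges M \<union> black_corners M \<union> white_corners M. card (p \<inter> B) = 1)"

definition bimap_iso :: "('d \<Rightarrow> 'c) \<Rightarrow> 'd bimap \<Rightarrow> 'c bimap \<Rightarrow> bool" where
  "bimap_iso \<phi> M N \<longleftrightarrow>
     bij_betw \<phi> (sides M) (sides N) \<and>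
     (`) \<phi> ` edges M = edges N \<and>
     (`) \<phi> ` black_corners M = black_corners N \<and>
     (`) \<phi> ` white_corners M = white_corners N"


section \<open>Unlabeled rooted maps\<close>

text \<open>
  Every map is finite, hence isomorphic to one with edge-sides in \<^typ>\<open>nat\<close>; unlabeled maps
  are isomorphism classes of the latter. A rooted oriented map is a triple of a map, an orientation
  and an edge; a rooted non-oriented map is a pair of a map and an edge-side.
\<close>

definition oriented_rooted_connected :: "nat \<Rightarrow> (nat bimap \<times> nat set \<times> nat set) set" where
  "oriented_rooted_connected n =
     {(M, B, e). bicolored_map M \<and> card (edges M) = n \<and> card (components M) = 1 \<and>
                 orientation M B \<and> e \<in> edges M}"

definition oriented_iso ::
    "nat \<Rightarrow> ((nat bimap \<times> nat set \<times> nat set) \<times> (nat bimap \<times> nat set \<times> nat set)) set" where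
  "oriented_iso n =
     {((M, B, e), (M', B', e')).
        (M, B, e) \<in> oriented_rooted_connected n \<and> (M', B', e') \<in> oriented_rooted_connected n \<and>
        (\<exists>\<phi>. bimap_iso \<phi> M M' \<and> \<phi> ` B = B' \<and> \<phi> ` e = e')}"

definition unlabeled_oriented_rooted_connected ::
    "nat \<Rightarrow> (nat bimap \<times> nat set \<times> nat set) set set" where
  "unlabeled_oriented_rooted_connected n = oriented_rooted_connected n // oriented_iso n"

definition nonoriented_rooted_one_face :: "nat \<Rightarrow> (nat bimap \<times> nat) set" where
  "nonoriented_rooted_one_face n =
     {(M, r). bicolored_map M \<and> card (edges M) = n \<and> card (faces M) = 1 \<and> r \<in> sides M}"

definition nonoriented_iso :: "nat \<Rightarrow> ((nat bimap \<times> nat) \<times> (nat bimap \<times> nat)) set" where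
  "nonoriented_iso n =
     {((M, r), (M', r')).
        (M, r) \<in> nonoriented_rooted_one_face n \<and> (M', r') \<in> nonoriented_rooted_one_face n \<and>
        (\<exists>\<phi>. bimap_iso \<phi> M M' \<and> \<phi> r = r')}"

definition unlabeled_nonoriented_rooted_one_face :: "nat \<Rightarrow> (nat bimap \<times> nat) set set" where
  "unlabeled_nonoriented_rooted_one_face n = nonoriented_rooted_one_face n // nonoriented_iso n"

text \<open>The map (without its root and orientation) of an arbitrary representative of a class.\<close>

definition repr_map :: "(nat bimap \<times> 'r) set \<Rightarrow> nat bimap" where
  "repr_map C = fst (SOME X. X \<in> C)"


section \<open>The measure of non-orientability\<close>

text \<open>
  When the ribbon \<open>e = {x, y}\<close> is removed, the segment of the vertex boundary where it was attached
  merges the corners \<open>{u, x}\<close> and \<open>{y, v}\<close> on both sides of it into one corner \<open>{u, v}\<close>. If instead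
  \<open>e\<close> itself is a corner, then the vertex becomes isolated and disappears, with no new corner.
\<close>

definition merge_corners :: "'d set \<Rightarrow> 'd set set \<Rightarrow> 'd set set" where
  "merge_corners e P =
     {p \<in> P. p \<inter> e = {}} \<union> ({\<Union>{p \<in> P. p \<inter> e \<noteq> {}} - e} - {{}})"

definition remove_edge :: "'d set \<Rightarrow> 'd bimap \<Rightarrow> 'd bimap" where
  "remove_edge e M =
     \<lparr>sides = sides M - e, edges = edges M - {e},
      black_corners = merge_corners e (black_corners M),
      white_corners = merge_corners e (white_corners M)\<rparr>"

definition mon_top :: "'d bimap \<Rightarrow> real" where
  "mon_top M =
     measure_pmf.prob (pmf_of_set (permutations_of_set (edges M)))
       {es. \<forall>k \<le> length es.
          let N = fold remove_edge (take k es) M in card (faces N) = card (components N)}"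


section \<open>The sums over unlabeled maps are finite\<close>

lemma pair_partition_image:
  assumes "inj_on \<phi> D" "pair_partition D P"
  shows "pair_partition (\<phi> ` D) ((`) \<phi> ` P)"
proof -
  have sub: "p \<subseteq> D" if "p \<in> P" for p
    using assms that by (auto simp: pair_partition_def partition_on_def)
  have "partition_on (\<phi> ` D) ((`) \<phi> ` P)"
  proof (rule partition_onI)
    show "\<Union>((`) \<phi> ` P) = \<phi> ` D"
      using assms(2) by (auto simp: pair_partition_def partition_on_def)
    fix p q assume pq: "p \<in> (`) \<phi> ` P" "q \<in> (`) \<phi> ` P" "p \<noteq> q"
    then obtain p' q' where *: "p' \<in> P" "q' \<in> P" "p = \<phi> ` p'" "q = \<phi> ` q'" "p' \<noteq> q'" by auto
    then have "p' \<inter> q' = {}"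
      using assms(2) by (auto simp: pair_partition_def partition_on_def disjoint_def)
    then show "disjnt p q"
      using * sub assms(1) inj_on_image_Int[of \<phi> D p' q'] by (auto simp: disjnt_def)
  next
    show "{} \<notin> (`) \<phi> ` P"
      using assms(2) by (auto simp: pair_partition_def partition_on_def)
  qed
  moreover have "card (\<phi> ` p) = 2" if "p \<in> P" for p
    using assms that sub[OF that] by (auto simp: pair_partition_def card_image inj_on_subset)
  ultimately show ?thesis by (auto simp: pair_partition_def)
qed

lemma pair_partition_Pow: "pair_partition D P \<Longrightarrow> P \<subseteq> Pow D"
  by (auto simp: pair_partition_def partition_on_def)

lemma bimap_iso_refl: "bimap_iso id M M"
  by (simp add: bimap_iso_def)

lemma bimap_iso_sym:
  assumes "bicolored_map M" "bimap_iso \<phi> M N"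
  shows "bimap_iso (inv_into (sides M) \<phi>) N M"
proof -
  let ?i = "inv_into (sides M) \<phi>"
  have inj: "inj_on \<phi> (sides M)" using assms by (auto simp: bimap_iso_def bij_betw_def)
  have inv_image: "(`) ?i ` (`) \<phi> ` P = P" if "P \<subseteq> Pow (sides M)" for P
  proof -
    have "?i ` \<phi> ` p = p" if "p \<in> P" for p
      using that \<open>P \<subseteq> Pow (sides M)\<close> by (intro inv_into_image_cancel[OF inj]) auto
    then show ?thesis by (auto simp: image_image)
  qed
  have "P \<subseteq> Pow (sides M)" if "P \<in> {edges M, black_corners M, white_corners M}" for P
    using assms(1) that pair_partition_Pow by (auto simp: bicolored_map_def)
  then show ?thesis
    using assms(2) inv_image unfolding bimap_iso_def
    by (metis bij_betw_inv_into insertCI)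
qed

lemma bimap_iso_trans:
  assumes "bimap_iso \<phi> L M" "bimap_iso \<psi> M N"
  shows "bimap_iso (\<psi> \<circ> \<phi>) L N"
proof -
  have "(`) (\<psi> \<circ> \<phi>) ` P = (`) \<psi> ` (`) \<phi> ` P" for P
    by (auto simp: image_comp image_image comp_def)
  then show ?thesis
    using assms by (auto simp: bimap_iso_def bij_betw_trans)
qed

lemma equiv_oriented_iso: "equiv (oriented_rooted_connected n) (oriented_iso n)"
proof (rule equivI)
  show "oriented_iso n \<subseteq> oriented_rooted_connected n \<times> oriented_rooted_connected n"
    by (auto simp: oriented_iso_def)
  show "refl_on (oriented_rooted_connected n) (oriented_iso n)"
    by (auto simp: refl_on_def oriented_iso_def intro!: exI[of _ id] bimap_iso_refl)
  show "sym (oriented_iso n)"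
  proof (rule symI)
    fix x y assume xy: "(x, y) \<in> oriented_iso n"
    obtain M B e M' B' e' \<phi> where [simp]: "x = (M, B, e)" "y = (M', B', e')"
      and xy': "x \<in> oriented_rooted_connected n" "y \<in> oriented_rooted_connected n"
        "bimap_iso \<phi> M M'" "\<phi> ` B = B'" "\<phi> ` e = e'"
      using xy by (auto simp: oriented_iso_def)
    have inj: "inj_on \<phi> (sides M)" using xy' by (auto simp: bimap_iso_def bij_betw_def)
    have M: "bicolored_map M" and "B \<subseteq> sides M" "e \<subseteq> sides M"
      using xy'(1) pair_partition_Pow
      by (auto simp: oriented_rooted_connected_def orientation_def bicolored_map_def)
    then have "inv_into (sides M) \<phi> ` B' = B" "inv_into (sides M) \<phi> ` e' = e"
      using xy'(4,5) inv_into_image_cancel[OF inj] by blast+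
    then show "(y, x) \<in> oriented_iso n"
      using xy'(1,2) bimap_iso_sym[OF M xy'(3)]
      unfolding oriented_iso_def \<open>x = (M, B, e)\<close> \<open>y = (M', B', e')\<close> by blast
  qed
  show "trans (oriented_iso n)"
  proof (rule transI)
    fix x y z assume xy: "(x, y) \<in> oriented_iso n" and yz: "(y, z) \<in> oriented_iso n"
    obtain L B e M B' e' \<phi> where 1: "x = (L, B, e)" "y = (M, B', e')" "bimap_iso \<phi> L M"
      "\<phi> ` B = B'" "\<phi> ` e = e'"
      using xy by (auto simp: oriented_iso_def)
    obtain N B'' e'' \<psi> where 2: "z = (N, B'', e'')" "bimap_iso \<psi> M N" "\<psi> ` B' = B''" "\<psi> ` e' = e''"
      using yz 1 by (auto simp: oriented_iso_def)
    have "bimap_iso (\<psi> \<circ> \<phi>) L N" "(\<psi> \<circ> \<phi>) ` B = B''" "(\<psi> \<circ> \<phi>) ` e = e''"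
      using 1 2 bimap_iso_trans by (auto simp: image_comp[symmetric])
    moreover have "x \<in> oriented_rooted_connected n" "z \<in> oriented_rooted_connected n"
      using xy yz by (auto simp: oriented_iso_def)
    ultimately show "(x, z) \<in> oriented_iso n"
      unfolding 1(1) 2(1) oriented_iso_def by blast
  qed
qed

lemma equiv_nonoriented_iso: "equiv (nonoriented_rooted_one_face n) (nonoriented_iso n)"
proof (rule equivI)
  show "nonoriented_iso n \<subseteq> nonoriented_rooted_one_face n \<times> nonoriented_rooted_one_face n"
    by (auto simp: nonoriented_iso_def)
  show "refl_on (nonoriented_rooted_one_face n) (nonoriented_iso n)"
    by (auto simp: refl_on_def nonoriented_iso_def intro!: exI[of _ id] bimap_iso_refl)
  show "sym (nonoriented_iso n)"
  proof (rule symI)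
    fix x y assume xy: "(x, y) \<in> nonoriented_iso n"
    obtain M r M' r' \<phi> where [simp]: "x = (M, r)" "y = (M', r')"
      and xy': "x \<in> nonoriented_rooted_one_face n" "y \<in> nonoriented_rooted_one_face n"
        "bimap_iso \<phi> M M'" "\<phi> r = r'"
      using xy by (auto simp: nonoriented_iso_def)
    have inj: "inj_on \<phi> (sides M)" using xy' by (auto simp: bimap_iso_def bij_betw_def)
    have M: "bicolored_map M" and "r \<in> sides M"
      using xy'(1) by (auto simp: nonoriented_rooted_one_face_def)
    then have "inv_into (sides M) \<phi> r' = r"
      using xy' inj by auto
    then show "(y, x) \<in> nonoriented_iso n"
      using xy' bimap_iso_sym[OF M] by (auto simp: nonoriented_iso_def)
  qed
  show "trans (nonoriented_iso n)"
  proof (rule transI)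
    fix x y z assume xy: "(x, y) \<in> nonoriented_iso n" and yz: "(y, z) \<in> nonoriented_iso n"
    obtain L r M r' \<phi> where 1: "x = (L, r)" "y = (M, r')" "bimap_iso \<phi> L M" "\<phi> r = r'"
      using xy by (auto simp: nonoriented_iso_def)
    obtain N r'' \<psi> where 2: "z = (N, r'')" "bimap_iso \<psi> M N" "\<psi> r' = r''"
      using yz 1 by (auto simp: nonoriented_iso_def)
    have "bimap_iso (\<psi> \<circ> \<phi>) L N" "(\<psi> \<circ> \<phi>) r = r''"
      using 1 2 bimap_iso_trans by auto
    moreover have "x \<in> nonoriented_rooted_one_face n" "z \<in> nonoriented_rooted_one_face n"
      using xy yz by (auto simp: nonoriented_iso_def)
    ultimately show "(x, z) \<in> nonoriented_iso n"
      unfolding 1(1) 2(1) nonoriented_iso_def by blast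
  qed
qed

lemma glued_image:
  assumes inj: "inj_on \<phi> D" and P: "P \<subseteq> Pow D" and x: "x \<in> D"
  shows "glued ((`) \<phi> ` P) `` {\<phi> x} = \<phi> ` (glued P `` {x})"
proof (intro equalityI subsetI)
  fix z assume "z \<in> glued ((`) \<phi> ` P) `` {\<phi> x}"
  then have "(\<phi> x, z) \<in> {(x, y). \<exists>p \<in> (`) \<phi> ` P. x \<in> p \<and> y \<in> p}\<^sup>*" by (simp add: glued_def)
  then have "\<exists>y \<in> D. z = \<phi> y \<and> (x, y) \<in> glued P"
  proof (induction rule: rtrancl_induct)
    case base
    then show ?case using x by (auto simp: glued_def)
  next
    case (step z w)
    then obtain y p where y: "y \<in> D" "z = \<phi> y" "(x, y) \<in> glued P"
      and p: "p \<in> P" "z \<in> \<phi> ` p" "w \<in> \<phi> ` p" by blast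
    then obtain v where v: "v \<in> p" "w = \<phi> v" by auto
    have "p \<subseteq> D" using p P by auto
    then have "y \<in> p" using y p inj by (auto dest: inj_onD)
    then have "(x, v) \<in> glued P"
      using y v p unfolding glued_def by (auto intro: rtrancl_into_rtrancl)
    then show ?case using v \<open>p \<subseteq> D\<close> by auto
  qed
  then show "z \<in> \<phi> ` (glued P `` {x})" by auto
next
  fix z assume "z \<in> \<phi> ` (glued P `` {x})"
  then obtain y where "z = \<phi> y" "(x, y) \<in> {(x, y). \<exists>p \<in> P. x \<in> p \<and> y \<in> p}\<^sup>*"
    by (auto simp: glued_def)
  from this(2) have "(\<phi> x, \<phi> y) \<in> glued ((`) \<phi> ` P)"
    unfolding glued_def
    by (induction rule: rtrancl_induct) (auto intro: rtrancl_into_rtrancl)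
  then show "z \<in> glued ((`) \<phi> ` P) `` {\<phi> x}" using \<open>z = \<phi> y\<close> by auto
qed

lemma glued_subset:
  assumes "P \<subseteq> Pow D" "x \<in> D"
  shows "glued P `` {x} \<subseteq> D"
proof
  fix y assume "y \<in> glued P `` {x}"
  then have "(x, y) \<in> {(x, y). \<exists>p \<in> P. x \<in> p \<and> y \<in> p}\<^sup>*" by (simp add: glued_def)
  then show "y \<in> D" by (induction rule: rtrancl_induct) (use assms in auto)
qed

lemma card_glued_image:
  assumes inj: "inj_on \<phi> D" and P: "P \<subseteq> Pow D"
  shows "card ((\<phi> ` D) // glued ((`) \<phi> ` P)) = card (D // glued P)"
proof -
  have "(\<phi> ` D) // glued ((`) \<phi> ` P) = (`) \<phi> ` (D // glued P)"
    using glued_image[OF inj P] by (auto simp: quotient_def)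
  moreover have "D // glued P \<subseteq> Pow D"
    using glued_subset[OF P] by (auto simp: quotient_def)
  then have "inj_on ((`) \<phi>) (D // glued P)"
    using inj by (meson inj_on_image_Pow inj_on_subset)
  ultimately show ?thesis by (simp add: card_image)
qed

definition image_map :: "('d \<Rightarrow> 'c) \<Rightarrow> 'd bimap \<Rightarrow> 'c bimap" where
  "image_map \<phi> M =
     \<lparr>sides = \<phi> ` sides M, edges = (`) \<phi> ` edges M,
      black_corners = (`) \<phi> ` black_corners M, white_corners = (`) \<phi> ` white_corners M\<rparr>"

lemma image_map_transfer:
  assumes M: "bicolored_map M" and inj: "inj_on \<phi> (sides M)"
  shows "bimap_iso \<phi> M (image_map \<phi> M)"
    and "bicolored_map (image_map \<phi> M)"
    and "card (edges (image_map \<phi> M)) = card (edges M)"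
    and "card (components (image_map \<phi> M)) = card (components M)"
    and "card (faces (image_map \<phi> M)) = card (faces M)"
    and "orientation M B \<Longrightarrow> orientation (image_map \<phi> M) (\<phi> ` B)"
proof -
  have sub: "edges M \<subseteq> Pow (sides M)" "black_corners M \<subseteq> Pow (sides M)"
    "white_corners M \<subseteq> Pow (sides M)"
    using M by (auto simp: bicolored_map_def dest!: pair_partition_Pow)
  show "bimap_iso \<phi> M (image_map \<phi> M)"
    using inj by (auto simp: bimap_iso_def image_map_def bij_betw_def)
  show "bicolored_map (image_map \<phi> M)"
    using M inj by (auto simp: bicolored_map_def image_map_def intro: pair_partition_image)
  show "card (edges (image_map \<phi> M)) = card (edges M)"
    using card_image[OF inj_on_subset[OF inj_on_image_Pow[OF inj] sub(1)]]
    by (simp add: image_map_def)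
  show "card (components (image_map \<phi> M)) = card (components M)"
    using card_glued_image[OF inj, of "edges M \<union> black_corners M \<union> white_corners M"] sub
    by (simp add: components_def image_map_def image_Un)
  show "card (faces (image_map \<phi> M)) = card (faces M)"
    using card_glued_image[OF inj, of "black_corners M \<union> white_corners M"] sub
    by (simp add: faces_def image_map_def image_Un)
  assume B: "orientation M B"
  have "card (\<phi> ` p \<inter> \<phi> ` B) = 1"
    if p: "p \<in> edges M \<union> black_corners M \<union> white_corners M" for p
  proof -
    have pB: "p \<subseteq> sides M" "B \<subseteq> sides M" using p sub B unfolding orientation_def by blast+
    have "\<phi> ` p \<inter> \<phi> ` B = \<phi> ` (p \<inter> B)"
      using inj_on_image_Int[OF inj pB] by simp
    moreover have "inj_on \<phi> (p \<inter> B)"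
      using inj pB by (meson inj_on_subset le_infI1)
    ultimately show ?thesis using B p by (simp add: card_image orientation_def)
  qed
  then show "orientation (image_map \<phi> M) (\<phi> ` B)"
    using B by (auto simp: orientation_def image_map_def)
qed

lemma card_sides:
  assumes "bicolored_map M"
  shows "card (sides M) = 2 * card (edges M)"
proof -
  have E: "pair_partition (sides M) (edges M)" "finite (sides M)"
    using assms by (auto simp: bicolored_map_def)
  have "card (\<Union>(edges M)) = (\<Sum>p \<in> edges M. card p)"
  proof (rule card_Union_disjoint)
    show "pairwise disjnt (edges M)"
      using E by (auto simp: pair_partition_def partition_on_def disjoint_def pairwise_def disjnt_def)
    show "finite p" if "p \<in> edges M" for p
      using E that pair_partition_Pow[OF E(1)] rev_finite_subset by blast
  qed
  moreover have "\<Union>(edges M) = sides M"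
    using E by (simp add: pair_partition_def partition_on_def)
  ultimately show ?thesis using E by (simp add: pair_partition_def)
qed

lemma obtain_standard_labels:
  assumes "bicolored_map M" "card (edges M) = n"
  obtains \<phi> where "inj_on \<phi> (sides M)" "\<phi> ` sides M = {..<2 * n}"
proof -
  have "finite (sides M)" "card (sides M) = 2 * n"
    using assms card_sides by (auto simp: bicolored_map_def)
  then obtain \<phi> where "bij_betw \<phi> (sides M) {..<2 * n}"
    using finite_same_card_bij[of "sides M" "{..<2 * n}"] by auto
  then show thesis using that by (auto simp: bij_betw_def)
qed

lemma finite_quotient_of_reps:
  assumes eq: "equiv A r" and "finite F" and F: "\<And>x. x \<in> A \<Longrightarrow> \<exists>y \<in> F. (x, y) \<in> r"
  shows "finite (A // r)"
proof (rule finite_subset)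
  show "A // r \<subseteq> (\<lambda>y. r `` {y}) ` F"
  proof
    fix C assume "C \<in> A // r"
    then obtain x where x: "x \<in> A" "C = r `` {x}" by (auto elim: quotientE)
    then obtain y where "y \<in> F" "(x, y) \<in> r" using F by blast
    then show "C \<in> (\<lambda>y. r `` {y}) ` F" using x equiv_class_eq[OF eq] by blast
  qed
qed (use \<open>finite F\<close> in auto)

lemma finite_maps_on:
  assumes "finite D"
  shows "finite {M. bicolored_map M \<and> sides M = D}"
proof (rule finite_subset)
  show "{M. bicolored_map M \<and> sides M = D} \<subseteq>
    (\<lambda>(E, B, W). \<lparr>sides = D, edges = E, black_corners = B, white_corners = W\<rparr>) `
      (Pow (Pow D) \<times> Pow (Pow D) \<times> Pow (Pow D))"
  proof
    fix M assume "M \<in> {M. bicolored_map M \<and> sides M = D}"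
    then have "(edges M, black_corners M, white_corners M) \<in>
        Pow (Pow D) \<times> Pow (Pow D) \<times> Pow (Pow D)" "sides M = D"
      by (auto simp: bicolored_map_def dest!: pair_partition_Pow)
    then show "M \<in> (\<lambda>(E, B, W). \<lparr>sides = D, edges = E, black_corners = B, white_corners = W\<rparr>) `
        (Pow (Pow D) \<times> Pow (Pow D) \<times> Pow (Pow D))"
      by (intro image_eqI[of _ _ "(edges M, black_corners M, white_corners M)"]) auto
  qed
qed (use assms in auto)

lemma finite_unlabeled_oriented_rooted_connected:
  "finite (unlabeled_oriented_rooted_connected n)"
  unfolding unlabeled_oriented_rooted_connected_def
proof (rule finite_quotient_of_reps[OF equiv_oriented_iso])
  let ?D = "{..<2 * n}"
  let ?F = "{M. bicolored_map M \<and> sides M = ?D} \<times> Pow ?D \<times> Pow ?D"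
  show "finite ?F" using finite_maps_on[of ?D] by auto
  fix x assume x: "x \<in> oriented_rooted_connected n"
  then obtain M B e where xe: "x = (M, B, e)" and M: "bicolored_map M" "card (edges M) = n"
    and B: "orientation M B" and e: "e \<in> edges M" and c: "card (components M) = 1"
    by (auto simp: oriented_rooted_connected_def)
  obtain \<phi> where inj: "inj_on \<phi> (sides M)" and im: "\<phi> ` sides M = ?D"
    using obtain_standard_labels[OF M] by blast
  note t = image_map_transfer[OF M(1) inj]
  let ?y = "(image_map \<phi> M, \<phi> ` B, \<phi> ` e)"
  have "?y \<in> oriented_rooted_connected n"
    using t(2-4) t(6)[OF B] M c e by (auto simp: oriented_rooted_connected_def)
      (auto simp: image_map_def)
  then have "(x, ?y) \<in> oriented_iso n"
    using x t(1) by (auto simp: oriented_iso_def xe)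
  moreover have "B \<subseteq> sides M" "e \<subseteq> sides M"
    using B M(1) e by (auto simp: orientation_def bicolored_map_def dest!: pair_partition_Pow)
  then have "\<phi> ` B \<subseteq> ?D" "\<phi> ` e \<subseteq> ?D" using im by blast+
  moreover have "sides (image_map \<phi> M) = ?D" using im by (simp add: image_map_def)
  ultimately show "\<exists>y \<in> ?F. (x, y) \<in> oriented_iso n"
    using t(2) by (intro bexI[of _ ?y]) auto
qed

lemma finite_unlabeled_nonoriented_rooted_one_face:
  "finite (unlabeled_nonoriented_rooted_one_face n)"
  unfolding unlabeled_nonoriented_rooted_one_face_def
proof (rule finite_quotient_of_reps[OF equiv_nonoriented_iso])
  let ?D = "{..<2 * n}"
  let ?F = "{M. bicolored_map M \<and> sides M = ?D} \<times> ?D"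
  show "finite ?F" using finite_maps_on[of ?D] by auto
  fix x assume x: "x \<in> nonoriented_rooted_one_face n"
  then obtain M r where xe: "x = (M, r)" and M: "bicolored_map M" "card (edges M) = n"
    and r: "r \<in> sides M" and c: "card (faces M) = 1"
    by (auto simp: nonoriented_rooted_one_face_def)
  obtain \<phi> where inj: "inj_on \<phi> (sides M)" and im: "\<phi> ` sides M = ?D"
    using obtain_standard_labels[OF M] by blast
  note t = image_map_transfer[OF M(1) inj]
  let ?y = "(image_map \<phi> M, \<phi> r)"
  have "?y \<in> nonoriented_rooted_one_face n"
    using t(2,3,5) M c r by (auto simp: nonoriented_rooted_one_face_def)
      (auto simp: image_map_def)
  then have "(x, ?y) \<in> nonoriented_iso n"
    using x t(1) by (auto simp: nonoriented_iso_def xe)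
  moreover have "\<phi> r \<in> ?D" using im r by blast
  moreover have "sides (image_map \<phi> M) = ?D" using im by (simp add: image_map_def)
  ultimately show "\<exists>y \<in> ?F. (x, y) \<in> nonoriented_iso n"
    using t(2) by (intro bexI[of _ ?y]) auto
qed

end

theory Submission
  imports Defs
begin

text \<open>
  Label the edge-sides and fix the underlying graph. If the edges are inserted one by one in the
  order opposite to a fixed removal order, the condition on faces says that the two sides of every
  edge always lie on a common face. When both ends of a new edge go to existing vertices in
  different components, all ways of gluing it are good; when they are in the same component, exactly
  half are. Hence the number of good maps times \<open>2 ^ c\<close>, with \<open>c\<close> the number of components of the
  graph, satisfies the same recursion as the number of maps with an orientation. In the connected
  case the latter is twice the number of good maps, whatever the removal order, and averaging over
  the orders gives the sum of the weights. Rooted connected maps have no automorphisms, so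
  each unlabeled one corresponds to \<open>(2 n)!\<close> labeled ones; the \<open>n\<close> root edges against
  \<open>2 n\<close> root edge-sides account for the factor two.
\<close>

section \<open>Pair-partitions and gluings\<close>

text \<open>The graph is recorded by labels \<open>b\<close> and \<open>w\<close> on the edge-sides,
  because restricting the labels to fewer sides describes the smaller graph, including the
  disappearance of isolated vertices. The obstacle is that the number of good ways to attach an edge
  between two old vertices depends on whether the rest of the map connects them, which the oriented
  count does not see. If these vertices have old degrees i and j, there are 2 i j good ways when
  they are connected and 4 i j otherwise; but in the second case the edge also halves the number of
  unions of components. The product therefore gains the factor 2 i j either way. On the oriented
  side the same number arises from two choices of the positive side of the edge and one admissible
  twist in each of the i and j corners. The half in the connected case is a parity fact: reversing
  the twist at the white end changes whether the two new sides lie on one face.\<close>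

lemma pair_partition_unique:
  "pair_partition D P \<Longrightarrow> p \<in> P \<Longrightarrow> q \<in> P \<Longrightarrow> s \<in> p \<Longrightarrow> s \<in> q \<Longrightarrow> p = q"
  unfolding pair_partition_def partition_on_def disjoint_def by blast

lemma pair_partition_mem: "pair_partition D P \<Longrightarrow> p \<in> P \<Longrightarrow> s \<in> p \<Longrightarrow> s \<in> D"
  by (auto simp: pair_partition_def partition_on_def)

lemma pair_partition_pair_neq: "pair_partition D P \<Longrightarrow> {s, t} \<in> P \<Longrightarrow> s \<noteq> t"
  by (auto simp: pair_partition_def)

lemma pair_partition_pairE:
  assumes "pair_partition D P" "p \<in> P" "s \<in> p"
  obtains t where "p = {s, t}" "t \<noteq> s" "s \<in> D" "t \<in> D"
proof -
  have "card p = 2" using assms by (auto simp: pair_partition_def)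
  then obtain a b where "p = {a, b}" "a \<noteq> b" by (auto simp: card_2_iff)
  then show thesis using assms that[of "if s = a then b else a"] pair_partition_mem[OF assms(1,2)]
    by (auto split: if_splits simp: insert_commute)
qed

lemma pair_partition_empty [simp]: "pair_partition {} P \<longleftrightarrow> P = {}"
  by (auto simp: pair_partition_def partition_on_def)

lemma pair_partition_empty_right [simp]: "pair_partition D {} \<longleftrightarrow> D = {}"
  by (auto simp: pair_partition_def partition_on_def)

lemma pair_partition_insert:
  assumes "pair_partition D P" "x \<notin> D" "y \<notin> D" "x \<noteq> y"
  shows "pair_partition (insert x (insert y D)) (insert {x, y} P)"
proof -
  have U: "\<Union>P = D" using assms(1) by (auto simp: pair_partition_def partition_on_def)
  have "insert x (insert y D) - {x, y} = D" using assms by auto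
  then have "partition_on (insert x (insert y D)) (insert {x, y} P)"
    using assms U partition_on_insert[of "{x, y}" P "insert x (insert y D)"]
    by (auto simp: pair_partition_def disjnt_def)
  then show ?thesis using assms by (auto simp: pair_partition_def)
qed

lemma pair_partition_remove:
  assumes "pair_partition D P" "p \<in> P"
  shows "pair_partition (D - p) (P - {p})"
proof -
  have disj: "p' \<inter> q = {}" if "p' \<in> P" "q \<in> P" "p' \<noteq> q" for p' q
    using pair_partition_unique[OF assms(1) that(1,2)] that(3) by blast
  have "\<Union>P = D" using assms(1) by (auto simp: pair_partition_def partition_on_def)
  then have "\<Union>(P - {p}) = D - p" using disj[OF _ assms(2)] by blast
  moreover have "disjoint (P - {p})" using disj by (auto simp: disjoint_def)
  ultimately show ?thesis
    using assms(1) by (auto simp: pair_partition_def partition_on_def)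
qed

lemma finite_pair_partition: "finite D \<Longrightarrow> pair_partition D P \<Longrightarrow> finite P"
  by (meson finite_Pow_iff pair_partition_Pow rev_finite_subset)

lemma finite_pair_partitions: "finite D \<Longrightarrow> finite {P. pair_partition D P}"
  by (rule finite_subset[of _ "Pow (Pow D)"]) (auto dest: pair_partition_Pow)

lemma card_pair_partition:
  assumes "finite D" "pair_partition D P"
  shows "card D = 2 * card P"
  using card_sides[of "\<lparr>sides = D, edges = P, black_corners = P, white_corners = P\<rparr>"] assms
  by (simp add: bicolored_map_def)

section \<open>Partners within a pair-partition\<close>

definition mate :: "'d set set \<Rightarrow> 'd \<Rightarrow> 'd" where
  "mate P s = (THE t. {s, t} \<in> P)"

lemma mate_eq:
  assumes "pair_partition D P" "{s, t} \<in> P"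
  shows "mate P s = t"
  unfolding mate_def
proof (rule the_equality)
  show "{s, t} \<in> P" using assms(2) .
  fix t' assume "{s, t'} \<in> P"
  then have "{s, t'} = {s, t}"
    by (rule pair_partition_unique[OF assms(1) _ assms(2), where s = s]) simp_all
  then show "t' = t" by (auto simp: doubleton_eq_iff)
qed

lemma mate_pair:
  assumes "pair_partition D P" "s \<in> D"
  shows "{s, mate P s} \<in> P"
proof -
  obtain p where "p \<in> P" "s \<in> p" using assms by (auto simp: pair_partition_def partition_on_def)
  then obtain t where "{s, t} \<in> P" using assms(1) pair_partition_pairE by metis
  then show ?thesis using mate_eq assms(1) by metis
qed

lemma mate_props:
  assumes "pair_partition D P" "s \<in> D"
  shows "mate P s \<in> D" "mate P s \<noteq> s" "mate P (mate P s) = s"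
proof -
  have *: "{s, mate P s} \<in> P" using mate_pair[OF assms] .
  show "mate P s \<in> D" using pair_partition_mem[OF assms(1) *] by simp
  show "mate P s \<noteq> s" using pair_partition_pair_neq[OF assms(1) *] by simp
  have "{mate P s, s} \<in> P" using * by (simp add: insert_commute)
  then show "mate P (mate P s) = s" using mate_eq[OF assms(1)] by metis
qed

section \<open>The equivalence relation generated by gluings\<close>

lemma glued_refl [simp]: "(s, s) \<in> glued P"
  by (simp add: glued_def)

lemma glued_trans: "(s, t) \<in> glued P \<Longrightarrow> (t, v) \<in> glued P \<Longrightarrow> (s, v) \<in> glued P"
  by (auto simp: glued_def)

lemma glued_sym: "(s, t) \<in> glued P \<Longrightarrow> (t, s) \<in> glued P"
proof -
  have "sym {(x, y). \<exists>p \<in> P. x \<in> p \<and> y \<in> p}" by (auto intro: symI)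
  then show "(s, t) \<in> glued P \<Longrightarrow> (t, s) \<in> glued P"
    unfolding glued_def by (meson sym_rtrancl symD)
qed

lemma glued_pair: "p \<in> P \<Longrightarrow> s \<in> p \<Longrightarrow> t \<in> p \<Longrightarrow> (s, t) \<in> glued P"
  by (auto simp: glued_def)

text \<open>Induction for an arbitrary preorder \<open>R\<close>: the reverse of each generating
  step is again a generating step, since pairs are unordered. With an implication between
  memberships as \<open>R\<close> it yields saturated sets, with another gluing relation as
  \<open>R\<close> it compares the two.\<close>

lemma glued_least:
  assumes "(s, t) \<in> glued P" "\<And>a. R a a" "\<And>a b c. R a b \<Longrightarrow> R b c \<Longrightarrow> R a c"
    and "\<And>p a b. p \<in> P \<Longrightarrow> a \<in> p \<Longrightarrow> b \<in> p \<Longrightarrow> R a b"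
  shows "R s t"
proof -
  have "(s, t) \<in> {(x, y). \<exists>p \<in> P. x \<in> p \<and> y \<in> p}\<^sup>*" using assms(1) by (simp add: glued_def)
  then show ?thesis
    by (induction rule: rtrancl_induct) (use assms(2,3,4) in blast)+
qed

lemma glued_closed:
  assumes "(s, t) \<in> glued P" "s \<in> S" "\<And>p a b. p \<in> P \<Longrightarrow> a \<in> p \<Longrightarrow> b \<in> p \<Longrightarrow> a \<in> S \<Longrightarrow> b \<in> S"
  shows "t \<in> S"
proof -
  have "s \<in> S \<longrightarrow> t \<in> S"
  proof (rule glued_least[where R = "\<lambda>a b. a \<in> S \<longrightarrow> b \<in> S", OF assms(1)])
    show "a \<in> S \<longrightarrow> b \<in> S" if "p \<in> P" "a \<in> p" "b \<in> p" for p a b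
      using assms(3)[OF that] by (rule impI)
  qed simp_all
  then show ?thesis using assms(2) by simp
qed

lemma glued_subI:
  assumes "\<And>p a b. p \<in> P \<Longrightarrow> a \<in> p \<Longrightarrow> b \<in> p \<Longrightarrow> (a, b) \<in> glued Q"
  shows "glued P \<subseteq> glued Q"
proof (rule subrelI)
  fix a b assume "(a, b) \<in> glued P"
  then show "(a, b) \<in> glued Q"
  proof (rule glued_least)
    show "(a, c) \<in> glued Q" if "(a, b) \<in> glued Q" "(b, c) \<in> glued Q" for a b c
      using glued_trans that .
  qed (use assms in simp_all)
qed

lemma glued_mono: "P \<subseteq> Q \<Longrightarrow> glued P \<subseteq> glued Q"
  by (rule glued_subI) (auto intro: glued_pair)

text \<open>The closure is reflexive on the whole type, so off the edge-sides every gluing is the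
  identity. This lets gluings of the same sides be compared by plain equality of relations.\<close>

lemma glued_outside:
  assumes "(s, t) \<in> glued P" "s \<notin> \<Union>P" shows "t = s"
proof -
  have "t \<in> {s}" by (rule glued_closed[OF assms(1)]) (use assms(2) in auto)
  then show ?thesis by simp
qed

section \<open>Attaching and removing one end of a ribbon\<close>

text \<open>
  \<open>None\<close> makes a vertex of degree one; \<open>Some u\<close> attaches the ribbon in the corner of \<open>u\<close>, with the
  side \<open>x\<close> next to \<open>u\<close>. Thus \<open>u\<close> and \<open>mate P u\<close> stand for the same corner but opposite twists.
\<close>

definition add_ribbon :: "'d \<Rightarrow> 'd \<Rightarrow> 'd set set \<Rightarrow> 'd option \<Rightarrow> 'd set set" where
  "add_ribbon x y P c =
     (case c of
        None \<Rightarrow> insert {x, y} P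
      | Some u \<Rightarrow> insert {u, x} (insert {mate P u, y} (P - {{u, mate P u}})))"

lemma pair_partition_add_ribbon:
  assumes P: "pair_partition D P" and xy: "x \<notin> D" "y \<notin> D" "x \<noteq> y" and c: "set_option c \<subseteq> D"
  shows "pair_partition (insert x (insert y D)) (add_ribbon x y P c)"
proof (cases c)
  case None
  then show ?thesis using pair_partition_insert[OF P xy] by (simp add: add_ribbon_def)
next
  case (Some u)
  let ?v = "mate P u"
  have u: "u \<in> D" using c Some by auto
  note v = mate_props[OF P u]
  have "pair_partition (D - {u, ?v}) (P - {{u, ?v}})"
    using pair_partition_remove[OF P] mate_pair[OF P u] by blast
  then have "pair_partition (insert ?v (insert y (D - {u, ?v}))) (insert {?v, y} (P - {{u, ?v}}))"
    using pair_partition_insert v xy by (metis Diff_iff insertCI)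
  then have "pair_partition (insert u (insert x (insert ?v (insert y (D - {u, ?v})))))
      (insert {u, x} (insert {?v, y} (P - {{u, ?v}})))"
    using pair_partition_insert v xy u by (smt (verit, ccfv_threshold) Diff_iff insertCI insertE)
  moreover have "insert u (insert x (insert ?v (insert y (D - {u, ?v})))) = insert x (insert y D)"
    using u v by auto
  ultimately show ?thesis using Some by (simp add: add_ribbon_def)
qed

text \<open>The only corner meeting the edge is the edge itself, so the merged corner would be empty
  and is discarded: the vertex vanishes.\<close>

lemma merge_corners_pair:
  assumes "pair_partition D P" "{x, y} \<in> P"
  shows "merge_corners {x, y} P = P - {{x, y}}"
proof -
  have "p \<inter> {x, y} = {} \<longleftrightarrow> p \<noteq> {x, y}" if "p \<in> P" for p
    using pair_partition_unique[OF assms(1) that assms(2)] by blast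
  then have "{p \<in> P. p \<inter> {x, y} = {}} = P - {{x, y}}" "{p \<in> P. p \<inter> {x, y} \<noteq> {}} = {{x, y}}"
    using assms(2) by auto
  then show ?thesis by (simp add: merge_corners_def)
qed

text \<open>The condition \<open>u \<noteq> y\<close> says that the edge is not itself a corner;
  then exactly two corners meet it.\<close>

lemma merge_corners_two:
  assumes P: "pair_partition D P" and p: "{u, x} \<in> P" "{v, y} \<in> P" "u \<noteq> y" "x \<noteq> y"
  shows "merge_corners {x, y} P = insert {u, v} (P - {{u, x}, {v, y}})"
proof -
  have "p \<inter> {x, y} = {} \<longleftrightarrow> p \<noteq> {u, x} \<and> p \<noteq> {v, y}" if "p \<in> P" for p
    using pair_partition_unique[OF P that p(1)] pair_partition_unique[OF P that p(2)] by blast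
  then have *: "{p \<in> P. p \<inter> {x, y} = {}} = P - {{u, x}, {v, y}}"
    "{p \<in> P. p \<inter> {x, y} \<noteq> {}} = {{u, x}, {v, y}}"
    using p(1,2) by auto
  have "v \<noteq> x" using mate_eq[OF P p(2)] mate_eq[OF P, of x u] p by (auto simp: insert_commute)
  then have "\<Union>{{u, x}, {v, y}} - {x, y} = {u, v}"
    using p pair_partition_pair_neq[OF P p(1)] pair_partition_pair_neq[OF P p(2)] by auto
  then show ?thesis unfolding merge_corners_def * by simp
qed

text \<open>Together with \<open>add_ribbon_inj\<close> and \<open>add_ribbon_surj\<close> this
  makes attachment the inverse of removal: the preimages of \<open>P\<close> under
  \<open>merge_corners\<close> are parametrised by \<open>None\<close> and the elements of
  \<open>D\<close>.\<close>

lemma merge_corners_add_ribbon: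
  assumes P: "pair_partition D P" and xy: "x \<notin> D" "y \<notin> D" "x \<noteq> y" and c: "set_option c \<subseteq> D"
  shows "merge_corners {x, y} (add_ribbon x y P c) = P"
proof (cases c)
  case None
  then show ?thesis
    using merge_corners_pair[OF pair_partition_add_ribbon[OF assms]] pair_partition_mem[OF P] xy
    by (auto simp: add_ribbon_def)
next
  case (Some u)
  let ?v = "mate P u" and ?Q = "add_ribbon x y P c"
  have u: "u \<in> D" using c Some by auto
  note v = mate_props[OF P u] mate_pair[OF P u]
  have "{u, x} \<in> ?Q" "{?v, y} \<in> ?Q" by (auto simp: Some add_ribbon_def)
  then have "merge_corners {x, y} ?Q = insert {u, ?v} (?Q - {{u, x}, {?v, y}})"
    using merge_corners_two[OF pair_partition_add_ribbon[OF assms]] xy u by metis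
  moreover have "{u, x} \<notin> P" "{?v, y} \<notin> P" using pair_partition_mem[OF P] xy by auto
  ultimately show ?thesis using v by (auto simp: Some add_ribbon_def)
qed

lemma add_ribbon_inj:
  assumes P: "pair_partition D P" and xy: "x \<notin> D" "y \<notin> D" "x \<noteq> y"
    and c: "set_option c \<subseteq> D" "set_option d \<subseteq> D" and eq: "add_ribbon x y P c = add_ribbon x y P d"
  shows "c = d"
proof -
  \<comment> \<open>The partner of \<open>x\<close> reveals the place of attachment:
    \<open>y\<close> for \<open>None\<close>, otherwise the old side \<open>u\<close>, and
    \<open>y\<close> lies outside \<open>D\<close>.\<close>
  have "mate (add_ribbon x y P c) x = (case c of None \<Rightarrow> y | Some u \<Rightarrow> u)"
    if "set_option c \<subseteq> D" for c
    using mate_eq[OF pair_partition_add_ribbon[OF P xy that], of x]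
    by (cases c) (auto simp: add_ribbon_def insert_commute)
  from this[OF c(1)] this[OF c(2)]
  have "(case c of None \<Rightarrow> y | Some u \<Rightarrow> u) = (case d of None \<Rightarrow> y | Some u \<Rightarrow> u)"
    unfolding eq by (rule trans[OF sym])
  then show ?thesis using c xy by (cases c; cases d) auto
qed

lemma add_ribbon_surj:
  assumes P: "pair_partition (insert x (insert y D)) P" and xy: "x \<notin> D" "y \<notin> D" "x \<noteq> y"
  obtains c where "set_option c \<subseteq> D" "pair_partition D (merge_corners {x, y} P)"
    "P = add_ribbon x y (merge_corners {x, y} P) c"
proof (cases "{x, y} \<in> P")
  case True
  have D: "insert x (insert y D) - {x, y} = D" using xy by auto
  show ?thesis
    using that[of None] True pair_partition_remove[OF P True]
    unfolding merge_corners_pair[OF P True] D by (auto simp: add_ribbon_def)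
next
  case False
  define u v where "u = mate P x" and "v = mate P y"
  have ux: "{u, x} \<in> P" and vy: "{v, y} \<in> P"
    using mate_pair[OF P] by (auto simp: u_def v_def insert_commute)
  have ne: "u \<noteq> x" "v \<noteq> y" "u \<noteq> y" "v \<noteq> x"
  proof -
    show "u \<noteq> x" "v \<noteq> y" using pair_partition_pair_neq[OF P ux] pair_partition_pair_neq[OF P vy] .
    show "u \<noteq> y" using ux False by (metis insert_commute)
    show "v \<noteq> x" using vy False by metis
  qed
  have D: "u \<in> D" "v \<in> D"
    using ne pair_partition_mem[OF P ux, of u] pair_partition_mem[OF P vy, of v] by auto
  have uv: "u \<noteq> v"
  proof
    assume "u = v"
    then have "mate P u = x" "mate P u = y" using mate_eq[OF P] ux vy by auto
    then show False using xy(3) by simp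
  qed
  let ?P0 = "P - {{u, x}, {v, y}}"
  have "{v, y} \<in> P - {{u, x}}" using vy ne uv by (auto simp: doubleton_eq_iff)
  then have "pair_partition (insert x (insert y D) - {u, x} - {v, y}) (P - {{u, x}} - {{v, y}})"
    using pair_partition_remove P ux by metis
  moreover have "insert x (insert y D) - {u, x} - {v, y} = D - {u, v}" using xy ne uv by auto
  moreover have "P - {{u, x}} - {{v, y}} = ?P0" by auto
  ultimately have "pair_partition (D - {u, v}) ?P0" by simp
  then have *: "pair_partition (insert u (insert v (D - {u, v}))) (insert {u, v} ?P0)"
    using pair_partition_insert uv by (metis Diff_iff insertCI)
  have m: "merge_corners {x, y} P = insert {u, v} ?P0" using merge_corners_two[OF P ux vy ne(3) xy(3)] .
  have "insert u (insert v (D - {u, v})) = D" using D by auto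
  then have pp: "pair_partition D (merge_corners {x, y} P)" using * m by simp
  moreover have "mate (merge_corners {x, y} P) u = v" using mate_eq[OF pp] m by auto
  moreover have "{u, v} \<notin> P"
    using pair_partition_unique[OF P _ ux, of "{u, v}" u] ne by (auto simp: doubleton_eq_iff)
  ultimately have "P = add_ribbon x y (merge_corners {x, y} P) (Some u)"
    using ux vy by (auto simp: add_ribbon_def m)
  then show ?thesis using that[of "Some u"] D pp by auto
qed

lemma glued_class_eq: "(i, j) \<in> glued E \<Longrightarrow> glued E `` {i} = glued E `` {j}"
  by (auto intro: glued_trans[of i j] glued_trans[OF glued_sym])

text \<open>A corner cut by the ribbon is bridged by the path from \<open>u\<close> over
  \<open>x\<close> and \<open>y\<close> to \<open>mate P u\<close>, as soon as the two new sides are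
  glued.\<close>

lemma glued_add_ribbon:
  assumes P: "pair_partition D P" and c: "set_option c \<subseteq> D"
    and sub: "add_ribbon x y P c \<subseteq> Q" and xy: "(x, y) \<in> glued Q"
    and p: "p \<in> P" "a \<in> p" "b \<in> p"
  shows "(a, b) \<in> glued Q"
proof (cases "p \<in> Q")
  case True
  then show ?thesis using glued_pair p by metis
next
  case False
  then obtain u where u: "c = Some u" "p = {u, mate P u}"
    using p sub by (cases c) (auto simp: add_ribbon_def)
  then have "{u, x} \<in> Q" "{mate P u, y} \<in> Q" using sub by (auto simp: add_ribbon_def)
  then have "(u, x) \<in> glued Q" "(y, mate P u) \<in> glued Q" by (auto intro: glued_pair)
  then have "(u, mate P u) \<in> glued Q" using xy glued_trans by metis
  then show ?thesis using p u glued_sym by auto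
qed

text \<open>The labeling \<open>b\<close> of the edge-sides prescribes which of them belong to the same vertex.\<close>

definition corners_at :: "'d set \<Rightarrow> 'd set set \<Rightarrow> ('d \<Rightarrow> 'v) \<Rightarrow> 'd set set \<Rightarrow> bool" where
  "corners_at D E b P \<longleftrightarrow>
     pair_partition D P \<and> (\<forall>s \<in> D. \<forall>t \<in> D. (s, t) \<in> glued (E \<union> P) \<longleftrightarrow> b s = b t)"

text \<open>A degree-one vertex is admissible exactly when no old side carries the label of
  \<open>x\<close>; otherwise \<open>None\<close> would split a prescribed vertex in two.\<close>

definition attach :: "'d set \<Rightarrow> ('d \<Rightarrow> 'v) \<Rightarrow> 'd \<Rightarrow> 'd option set" where
  "attach D b x =
     (if \<exists>t \<in> D. b t = b x then Some ` {t \<in> D. b t = b x} else {None})"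

lemma attach_subset: "c \<in> attach D b x \<Longrightarrow> set_option c \<subseteq> D"
  by (auto simp: attach_def split: if_splits)

text \<open>Around a vertex the new edge bridges the corner that it cuts, so the old sides stay
  glued as before. The labels of old sides therefore constrain \<open>P\<close> as in the smaller
  map, and the label of \<open>x\<close> constrains only \<open>c\<close>.\<close>

lemma corners_at_add_ribbon:
  assumes E: "pair_partition D E" and P: "pair_partition D P"
    and xy: "x \<notin> D" "y \<notin> D" "x \<noteq> y" and b: "b x = b y" and c: "set_option c \<subseteq> D"
  shows "corners_at (insert x (insert y D)) (insert {x, y} E) b (add_ribbon x y P c) \<longleftrightarrow>
         corners_at D E b P \<and> c \<in> attach D b x"
proof -
  let ?Q = "insert {x, y} E \<union> add_ribbon x y P c"
  have Q: "pair_partition (insert x (insert y D)) (add_ribbon x y P c)"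
    using pair_partition_add_ribbon P xy c by metis
  have xy_glued: "(x, y) \<in> glued ?Q" by (rule glued_pair[of "{x, y}"]) auto
  have sub: "glued (E \<union> P) \<subseteq> glued ?Q"
  proof (rule glued_subI)
    fix p s t assume p: "p \<in> E \<union> P" "s \<in> p" "t \<in> p"
    show "(s, t) \<in> glued ?Q"
    proof (cases "p \<in> E")
      case True
      then show ?thesis using p by (intro glued_pair[of p]) auto
    next
      case False
      then show ?thesis using glued_add_ribbon[OF P c _ xy_glued, of p] p by blast
    qed
  qed
  have EP: "s \<in> D" if "p \<in> E \<union> P" "s \<in> p" for p s
    using that pair_partition_mem[OF E] pair_partition_mem[OF P] by auto
  show ?thesis
  proof (cases c)
    case None
    \<comment> \<open>The second alternative relates all points outside \<open>D\<close>, which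
      makes the relation reflexive on the whole type, as \<open>glued_least\<close> demands.\<close>
    have sep: "(s \<in> D \<and> t \<in> D \<and> (s, t) \<in> glued (E \<union> P)) \<or> (s \<notin> D \<and> t \<notin> D)"
      if "(s, t) \<in> glued ?Q" for s t
      using that
    proof (rule glued_least)
      fix p s t assume p: "p \<in> ?Q" "s \<in> p" "t \<in> p"
      show "(s \<in> D \<and> t \<in> D \<and> (s, t) \<in> glued (E \<union> P)) \<or> (s \<notin> D \<and> t \<notin> D)"
      proof (cases "p = {x, y}")
        case True
        then show ?thesis using p xy by auto
      next
        case False
        then have "p \<in> E \<union> P" using p by (auto simp: None add_ribbon_def)
        then show ?thesis using p EP glued_pair[of p "E \<union> P"] by auto
      qed
    qed (auto intro: glued_trans)
    have D: "(s, t) \<in> glued ?Q \<longleftrightarrow> (s, t) \<in> glued (E \<union> P)" if "s \<in> D" "t \<in> D" for s t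
      using sep[of s t] sub that by auto
    have x: "(x, t) \<notin> glued ?Q" "(y, t) \<notin> glued ?Q" "(t, x) \<notin> glued ?Q" "(t, y) \<notin> glued ?Q"
      if "t \<in> D" for t
      using sep[of x t] sep[of y t] sep[of t x] sep[of t y] that xy by auto
    have "(y, x) \<in> glued ?Q" using xy_glued by (rule glued_sym)
    then show ?thesis
      using P Q D x xy_glued None b unfolding corners_at_def attach_def by auto
  next
    case (Some u)
    let ?v = "mate P u"
    have u: "u \<in> D" using c Some by auto
    note v = mate_props[OF P u] mate_pair[OF P u]
    \<comment> \<open>Retraction of the new sides onto the side \<open>u\<close> next to them; it
      carries the new vertex relation to the old one.\<close>
    define r where "r z = (if z = x \<or> z = y then u else z)" for z
    have r [simp]: "r x = u" "r y = u" "s \<in> D \<Longrightarrow> r s = s" for s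
      using xy by (auto simp: r_def)
    have ux: "(u, x) \<in> glued ?Q"
      by (rule glued_pair[of "{u, x}"]) (auto simp: Some add_ribbon_def)
    have rs: "(s, r s) \<in> glued ?Q" for s
      using glued_sym[OF ux] glued_trans[OF glued_sym[OF xy_glued] glued_sym[OF ux]]
      by (auto simp: r_def)
    have G: "(s, t) \<in> glued ?Q \<longleftrightarrow> (r s, r t) \<in> glued (E \<union> P)" for s t
    proof
      assume "(r s, r t) \<in> glued (E \<union> P)"
      with sub have "(r s, r t) \<in> glued ?Q" by (rule subsetD)
      then show "(s, t) \<in> glued ?Q"
        by (rule glued_trans[OF rs glued_trans[OF _ glued_sym[OF rs]]])
    next
      assume "(s, t) \<in> glued ?Q"
      then show "(r s, r t) \<in> glued (E \<union> P)"
      proof (rule glued_least)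
        fix p s t assume p: "p \<in> ?Q" "s \<in> p" "t \<in> p"
        have uv: "(u, ?v) \<in> glued (E \<union> P)" by (rule glued_pair[of "{u, ?v}"]) (use v in auto)
        consider "p \<in> E \<union> P" | "p = {x, y}" | "p = {u, x}" | "p = {?v, y}"
          using p by (auto simp: Some add_ribbon_def)
        then show "(r s, r t) \<in> glued (E \<union> P)"
        proof cases
          case 1
          then show ?thesis using p EP[of p] glued_pair[of p "E \<union> P" s t] by simp
        qed (use p uv glued_sym[OF uv] u v(1) in auto)
      qed (auto intro: glued_trans)
    qed
    show ?thesis
    proof
      assume L: "corners_at (insert x (insert y D)) (insert {x, y} E) b (add_ribbon x y P c)"
      then have "b x = b u" using G[of x u] u unfolding corners_at_def by auto
      moreover have "corners_at D E b P"
        unfolding corners_at_def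
      proof (intro conjI ballI P)
        fix s t assume "s \<in> D" "t \<in> D"
        then show "((s, t) \<in> glued (E \<union> P)) = (b s = b t)"
          using L G[of s t] unfolding corners_at_def by auto
      qed
      ultimately show "corners_at D E b P \<and> c \<in> attach D b x"
        using u Some unfolding attach_def by auto
    next
      assume R: "corners_at D E b P \<and> c \<in> attach D b x"
      then have "b u = b x" using Some by (auto simp: attach_def split: if_splits)
      then have br: "b (r s) = b s" for s using b by (auto simp: r_def)
      show "corners_at (insert x (insert y D)) (insert {x, y} E) b (add_ribbon x y P c)"
        unfolding corners_at_def
      proof (intro conjI ballI Q)
        fix s t assume "s \<in> insert x (insert y D)" "t \<in> insert x (insert y D)"
        then have "r s \<in> D" "r t \<in> D" using u by auto
        then show "((s, t) \<in> glued ?Q) = (b s = b t)"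
          using R G[of s t] br unfolding corners_at_def by metis
      qed
    qed
  qed
qed

section \<open>Faces after the insertion of a ribbon\<close>

text \<open>One pair can merge no classes other than those of \<open>a\<close> and
  \<open>b\<close>.\<close>

lemma card_quotient_glued_insert:
  assumes D: "finite D" and p: "p = {a, b}"
  shows "card (D // glued E) \<le> card (D // glued (insert p E)) + 1"
proof -
  define Q where "Q = D // glued E"
  let ?G = "glued (insert p E)"
  have G: "(s, t) \<in> glued E \<or> ((s, a) \<in> glued E \<or> (s, b) \<in> glued E) \<and> ((t, a) \<in> glued E \<or> (t, b) \<in> glued E)"
    if "(s, t) \<in> ?G" for s t
    using that
  proof (rule glued_least)
    fix q s t assume q: "q \<in> insert p E" "s \<in> q" "t \<in> q"
    show "(s, t) \<in> glued E \<or> ((s, a) \<in> glued E \<or> (s, b) \<in> glued E) \<and> ((t, a) \<in> glued E \<or> (t, b) \<in> glued E)"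
      using q glued_pair[of q E s t] by (cases "q \<in> E") (auto simp: p)
  next
    fix i j k
    assume "(i, j) \<in> glued E \<or> ((i, a) \<in> glued E \<or> (i, b) \<in> glued E) \<and> ((j, a) \<in> glued E \<or> (j, b) \<in> glued E)"
      "(j, k) \<in> glued E \<or> ((j, a) \<in> glued E \<or> (j, b) \<in> glued E) \<and> ((k, a) \<in> glued E \<or> (k, b) \<in> glued E)"
    then show "(i, k) \<in> glued E \<or> ((i, a) \<in> glued E \<or> (i, b) \<in> glued E) \<and> ((k, a) \<in> glued E \<or> (k, b) \<in> glued E)"
      using glued_trans[of _ _ E] glued_sym[of _ _ E] by metis
  qed auto
  have mono: "glued E \<subseteq> ?G" by (rule glued_mono) auto
  have h: "?G `` (glued E `` {s}) = ?G `` {s}" for s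
    using mono glued_trans[of _ _ "insert p E"] by (auto intro: glued_refl)
  \<comment> \<open>With the class of \<open>b\<close> left out, no two of the remaining classes
    become equal, so coarsening is injective on them.\<close>
  let ?B = "glued E `` {b}"
  have inj: "inj_on ((``) ?G) (Q - {?B})"
  proof (rule inj_onI)
    fix X Y assume XY: "X \<in> Q - {?B}" "Y \<in> Q - {?B}" "?G `` X = ?G `` Y"
    then obtain s t where st: "X = glued E `` {s}" "Y = glued E `` {t}"
      by (auto simp: Q_def quotient_def)
    have nb: "(s, b) \<notin> glued E" "(t, b) \<notin> glued E"
      using XY st glued_class_eq by (metis DiffE singletonI)+
    have "(s, t) \<in> ?G" using XY(3) st h by (metis Image_singleton_iff glued_refl)
    then have "(s, t) \<in> glued E" using G[of s t] nb glued_trans glued_sym by metis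
    then show "X = Y" using st glued_class_eq by metis
  qed
  have im: "(``) ?G ` (Q - {?B}) \<subseteq> D // ?G"
    using h by (auto simp: Q_def quotient_def)
  have "finite (D // ?G)" using D by (simp add: quotient_def)
  then have "card (Q - {?B}) \<le> card (D // ?G)" using card_inj_on_le[OF inj im] by simp
  moreover have "card Q \<le> card (Q - {?B}) + 1"
    using card_Diff_singleton_if[of Q ?B] by (cases "?B \<in> Q") auto
  ultimately show ?thesis by (simp add: Q_def)
qed

text \<open>Starting from singletons, each pair lowers the number of classes by at most one: a graph
  has at least as many components as vertices minus edges.\<close>

lemma card_le_card_quotient_glued:
  assumes "finite E" "finite D" "\<And>p. p \<in> E \<Longrightarrow> card p = 2"
  shows "card D \<le> card (D // glued E) + card E"
  using assms(1,3)
proof (induction E rule: finite_induct)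
  case empty
  have "glued {} `` {s} = {s}" for s :: 'a
    using glued_outside[of s _ "{}"] by auto
  then have "D // glued {} = (\<lambda>s. {s}) ` D" by (auto simp: quotient_def)
  then show ?case by (simp add: card_image)
next
  case (insert p E)
  obtain a b where "p = {a, b}" using insert.prems[of p] by (auto simp: card_2_iff)
  then have "card (D // glued E) \<le> card (D // glued (insert p E)) + 1"
    using card_quotient_glued_insert[OF assms(2)] by metis
  moreover have "card D \<le> card (D // glued E) + card E"
    using insert.IH insert.prems by blast
  ultimately show ?case using insert.hyps by simp
qed

lemma card_connected_le:
  assumes "finite E" "finite S" "\<And>p. p \<in> E \<Longrightarrow> card p = 2" "\<And>s. s \<in> S \<Longrightarrow> (u, s) \<in> glued E"
  shows "card S \<le> card E + 1"
proof -
  have "glued E `` {s} = glued E `` {u}" if "s \<in> S" for s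
    using glued_class_eq[OF assms(4)[OF that]] by simp
  then have "S // glued E \<subseteq> {glued E `` {u}}" by (auto simp: quotient_def)
  then have "card (S // glued E) \<le> 1"
    by (metis card.empty card_mono finite.emptyI finite.insertI is_singletonI is_singleton_altdef)
  then show ?thesis using card_le_card_quotient_glued[of E S] assms by simp
qed

lemma pair_partition_restrict:
  assumes P: "pair_partition D P" and S: "S \<subseteq> D" "\<And>s. s \<in> S \<Longrightarrow> mate P s \<in> S"
  shows "pair_partition S {p \<in> P. p \<subseteq> S}"
proof -
  have "S \<subseteq> \<Union>{p \<in> P. p \<subseteq> S}"
  proof
    fix s assume s: "s \<in> S"
    then have "{s, mate P s} \<in> P" using mate_pair[OF P] S(1) by blast
    then show "s \<in> \<Union>{p \<in> P. p \<subseteq> S}" using s S(2)[OF s] by blast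
  qed
  then show ?thesis using P by (auto simp: pair_partition_def partition_on_def disjoint_def)
qed

text \<open>Without \<open>u\<close> and \<open>v\<close> the set is a union of whole pairs of
  \<open>P\<close>, hence of even size. It locates the end of a face arc without following the
  arc.\<close>

lemma even_card_closed:
  assumes D: "finite D" and P: "pair_partition D P" and uv: "{u, v} \<in> P" and S: "S \<subseteq> D"
    and closed: "\<And>p a b. p \<in> P - {{u, v}} \<Longrightarrow> a \<in> p \<Longrightarrow> b \<in> p \<Longrightarrow> a \<in> S \<Longrightarrow> b \<in> S"
  shows "even (card S) \<longleftrightarrow> even (card (S \<inter> {u, v}))"
proof -
  let ?T = "S - {u, v}"
  have "mate P s \<in> ?T" if s: "s \<in> ?T" for s
  proof -
    have p: "{s, mate P s} \<in> P" using mate_pair[OF P] S s by blast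
    have "mate P s \<noteq> u" "mate P s \<noteq> v"
      using pair_partition_unique[OF P p uv] s by blast+
    moreover have "mate P s \<in> S"
      by (rule closed[of "{s, mate P s}" s]) (use p s in auto)
    ultimately show ?thesis by simp
  qed
  moreover have "?T \<subseteq> D" using S by auto
  ultimately have "pair_partition ?T {p \<in> P. p \<subseteq> ?T}"
    by (intro pair_partition_restrict[OF P])
  then have "even (card ?T)"
    using card_pair_partition[of ?T] finite_subset[OF S D] by simp
  moreover have "card S = card ?T + card (S \<inter> {u, v})"
    using card_Int_Diff[of S "{u, v}"] finite_subset[OF S D] by simp
  ultimately show ?thesis by simp
qed

text \<open>
  A face is a cycle and falls apart when two of its corners are cut: otherwise a connected graph on
  \<open>m\<close> edge-sides would have only \<open>m - 2\<close> pairs.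
\<close>

lemma not_connected_without_pairs:
  assumes D: "finite D" and P: "pair_partition D P" and Q: "pair_partition D Q"
    and p: "p \<in> P" and q: "q \<in> Q" and u: "u \<in> p"
  shows "\<not> p \<union> q \<subseteq> glued ((P - {p}) \<union> (Q - {q})) `` {u}"
proof
  let ?E = "(P - {p}) \<union> (Q - {q})"
  define S where "S = glued ?E `` {u}"
  assume sub: "p \<union> q \<subseteq> glued ?E `` {u}"
  have uD: "u \<in> D" using pair_partition_mem[OF P p u] .
  have "?E \<subseteq> Pow D" using pair_partition_Pow[OF P] pair_partition_Pow[OF Q] by auto
  then have SD: "S \<subseteq> D" unfolding S_def using uD by (rule glued_subset)
  then have fin: "finite S" using D finite_subset by blast
  have step: "b \<in> S" if "r \<in> P \<union> Q" "a \<in> r" "b \<in> r" "a \<in> S" for r a b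
  proof (cases "r \<in> ?E")
    case True
    then show ?thesis
      using that glued_pair[of r ?E a b] glued_trans[of u a ?E b] by (simp add: S_def)
  next
    case False
    then have "r \<subseteq> p \<union> q" using that(1) by auto
    then show ?thesis using that(3) sub by (auto simp: S_def)
  qed
  have restr: "pair_partition S {r \<in> R. r \<subseteq> S}" if R: "pair_partition D R" "R \<subseteq> P \<union> Q" for R
  proof (rule pair_partition_restrict[OF R(1) SD])
    fix s assume s: "s \<in> S"
    then have "{s, mate R s} \<in> R" using mate_pair[OF R(1)] SD by blast
    then show "mate R s \<in> S" using step[of "{s, mate R s}" s "mate R s"] R(2) s by auto
  qed
  let ?PS = "{r \<in> P. r \<subseteq> S}" and ?QS = "{r \<in> Q. r \<subseteq> S}"
  have PS: "card S = 2 * card ?PS" "card S = 2 * card ?QS"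
    using card_pair_partition[OF fin restr] P Q by (metis Un_upper1, metis Un_upper2)
  have finPS: "finite ?PS" "finite ?QS"
    using finite_pair_partition[OF D P] finite_pair_partition[OF D Q] by auto
  \<comment> \<open>The black and the white pairs inside \<open>S\<close> number
    \<open>card S\<close> in total and two of them are dropped. A black and a white pair may
    coincide, so the size of the union is only bounded from above, in the required
    direction.\<close>
  define F where "F = (?PS - {p}) \<union> (?QS - {q})"
  have "card F \<le> card (?PS - {p}) + card (?QS - {q})" unfolding F_def by (rule card_Un_le)
  moreover have "p \<in> ?PS" "q \<in> ?QS" using p q sub by (auto simp: S_def)
  then have "card (?PS - {p}) + 1 = card ?PS" "card (?QS - {q}) + 1 = card ?QS"
    using card_Suc_Diff1[OF finPS(1)] card_Suc_Diff1[OF finPS(2)] by simp_all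
  ultimately have cardF: "card F + 2 \<le> card S" using PS by simp
  have "(u, s) \<in> glued F" if "s \<in> S" for s
  proof -
    have "(u, s) \<in> glued ?E" using that by (simp add: S_def)
    then have "s \<in> {t \<in> S. (u, t) \<in> glued F}"
    proof (rule glued_closed)
      show "u \<in> {t \<in> S. (u, t) \<in> glued F}" by (simp add: S_def)
      fix r a b assume r: "r \<in> ?E" "a \<in> r" "b \<in> r" "a \<in> {t \<in> S. (u, t) \<in> glued F}"
      have "r \<subseteq> S" using step[of r a] r by blast
      then have "r \<in> F" using r by (auto simp: F_def)
      then show "b \<in> {t \<in> S. (u, t) \<in> glued F}"
        using r step[of r a b] glued_pair[of r F a b] glued_trans[of u a F b] by auto
    qed
    then show ?thesis by simp
  qed
  moreover have "card r = 2" if "r \<in> F" for r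
    using that P Q by (auto simp: F_def pair_partition_def)
  moreover have "finite F" using finPS by (simp add: F_def)
  ultimately have "card S \<le> card F + 1" using card_connected_le[of F S u] fin by blast
  then show False using cardF by simp
qed

section \<open>The faces along a new ribbon\<close>

abbreviation ribbon_faces :: "'d \<Rightarrow> 'd \<Rightarrow> 'd set set \<Rightarrow> 'd set set \<Rightarrow> 'd option \<Rightarrow> 'd option \<Rightarrow> ('d \<times> 'd) set"
  where "ribbon_faces x y P Q c d \<equiv> glued (add_ribbon x y P c \<union> add_ribbon x y Q d)"

text \<open>At a vertex of degree one the edge is itself a corner, so its sides follow each other on
  the boundary.\<close>

lemma same_face_None:
  "(x, y) \<in> ribbon_faces x y P Q None d" "(x, y) \<in> ribbon_faces x y P Q c None"
  by (rule glued_pair[of "{x, y}"]; simp add: add_ribbon_def)+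

text \<open>If the new sides share a face, old faces survive inside new ones; hence edges inserted
  earlier keep both sides on a common face.\<close>

lemma glued_subset_ribbon_faces:
  assumes P: "pair_partition D P" and Q: "pair_partition D Q"
    and c: "set_option c \<subseteq> D" and d: "set_option d \<subseteq> D"
    and xy: "(x, y) \<in> ribbon_faces x y P Q c d"
  shows "glued (P \<union> Q) \<subseteq> ribbon_faces x y P Q c d"
proof (rule glued_subI)
  fix p a b assume "p \<in> P \<union> Q" "a \<in> p" "b \<in> p"
  then show "(a, b) \<in> ribbon_faces x y P Q c d"
    using glued_add_ribbon[OF P c _ xy] glued_add_ribbon[OF Q d _ xy] by blast
qed

text \<open>
  The ribbon opens the two corners at \<open>u\<close> and \<open>w\<close>; what is left of the old faces are arcs, and the
  arc starting at \<open>u\<close> decides which of the ends are joined.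
\<close>

context
  fixes D :: "'d set" and P Q :: "'d set set" and x y u w :: 'd
  assumes D: "finite D" and P: "pair_partition D P" and Q: "pair_partition D Q"
    and xy: "x \<notin> D" "y \<notin> D" "x \<noteq> y" and u: "u \<in> D" and w: "w \<in> D"
begin

private abbreviation "v \<equiv> mate P u"
private abbreviation "z \<equiv> mate Q w"
private abbreviation "arcs \<equiv> (P - {{u, v}}) \<union> (Q - {{w, z}})"
private abbreviation "S \<equiv> glued arcs `` {u}"
private abbreviation "F c d \<equiv> ribbon_faces x y P Q (Some c) (Some d)"

private lemmas v = mate_props[OF P u] mate_pair[OF P u]
private lemmas z = mate_props[OF Q w] mate_pair[OF Q w]

private lemma S_sub: "S \<subseteq> D"
  using pair_partition_Pow[OF P] pair_partition_Pow[OF Q] u by (intro glued_subset) auto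

private lemma S_closed: "p \<in> arcs \<Longrightarrow> a \<in> p \<Longrightarrow> b \<in> p \<Longrightarrow> a \<in> S \<Longrightarrow> b \<in> S"
  using glued_pair[of p arcs a b] glued_trans[of u a arcs b] by simp

text \<open>The arc is saturated for the black pairs other than \<open>{u, v}\<close> and for the
  white pairs other than \<open>{w, z}\<close>, so either pair of ends determines the parity of
  \<open>card S\<close>.\<close>

private lemma S_parity: "even (card (S \<inter> {u, v})) \<longleftrightarrow> even (card (S \<inter> {w, z}))"
proof -
  have "even (card S) \<longleftrightarrow> even (card (S \<inter> {u, v}))"
    by (rule even_card_closed[OF D P v(4) S_sub]) (erule (2) S_closed[rotated], simp)
  moreover have "even (card S) \<longleftrightarrow> even (card (S \<inter> {w, z}))"
    by (rule even_card_closed[OF D Q z(4) S_sub]) (erule (2) S_closed[rotated], simp)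
  ultimately show ?thesis by simp
qed

private lemma u_in_S: "u \<in> S" by simp

private lemma S_sub_face: "S \<subseteq> glued (P \<union> Q) `` {u}"
  by (intro Image_mono glued_mono) auto

private lemma new_pairs: 
  "(u, x) \<in> F u c" "(v, y) \<in> F u c" "(c, x) \<in> F u c" "(mate Q c, y) \<in> F u c"
  by (rule glued_pair[of "{u, x}"] glued_pair[of "{v, y}"] glued_pair[of "{c, x}"]
      glued_pair[of "{mate Q c, y}"]; simp add: add_ribbon_def)+

private lemma S_sub_F: "s \<in> S \<Longrightarrow> (u, s) \<in> F u w" "s \<in> S \<Longrightarrow> (u, s) \<in> F u z"
proof -
  have "arcs \<subseteq> add_ribbon x y P (Some u) \<union> add_ribbon x y Q (Some w)"
    "arcs \<subseteq> add_ribbon x y P (Some u) \<union> add_ribbon x y Q (Some z)"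
    using z(3) by (auto simp: add_ribbon_def insert_commute)
  from this[THEN glued_mono] show "s \<in> S \<Longrightarrow> (u, s) \<in> F u w" "s \<in> S \<Longrightarrow> (u, s) \<in> F u z"
    by auto
qed

text \<open>The arc from \<open>u\<close> ends at \<open>c\<close>, and \<open>x\<close> is attached
  to both of these ends. So \<open>insert x S\<close> is a complete face, and it misses
  \<open>y\<close>.\<close>

private lemma separated:
  assumes "v \<notin> S" "c \<in> S" "mate Q c \<notin> S" "{c, mate Q c} = {w, z}"
  shows "(x, y) \<notin> F u c"
proof
  have y_notin: "y \<notin> insert x S" using S_sub xy by auto
  assume "(x, y) \<in> F u c"
  then have "y \<in> insert x S"
  proof (rule glued_closed)
    fix p a b assume p: "p \<in> add_ribbon x y P (Some u) \<union> add_ribbon x y Q (Some c)"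
      "a \<in> p" "b \<in> p" "a \<in> insert x S"
    consider "p \<in> arcs" | "p = {u, x}" | "p = {v, y}" | "p = {c, x}" | "p = {mate Q c, y}"
      using p(1) unfolding add_ribbon_def option.case assms(4)[symmetric] by blast
    then show "b \<in> insert x S"
    proof cases
      case 1
      then have "x \<notin> p" using pair_partition_mem[OF P] pair_partition_mem[OF Q] xy(1) by blast
      then show ?thesis using S_closed[OF 1 p(2,3)] p(2,4) by auto
    next
      case 3
      then have "p \<inter> insert x S = {}" using assms(1) y_notin v(1) xy(1) by auto
      then show ?thesis using p by auto
    next
      case 5
      have "mate Q c \<in> D" using assms(4) w z(1) by auto
      then have "p \<inter> insert x S = {}" using 5 assms(3) y_notin xy(1) by auto
      then show ?thesis using p by auto
    qed (use p(3) assms(2) u_in_S in auto)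
  qed simp
  then show False using y_notin by simp
qed

text \<open>The path runs from \<open>x\<close> to \<open>u\<close>, along the arc to
  \<open>mate Q c\<close>, and on to \<open>y\<close>.\<close>

private lemma joined:
  assumes "mate Q c \<in> S" "c = w \<or> c = z"
  shows "(x, y) \<in> F u c"
  using assms S_sub_F glued_trans[OF glued_sym[OF new_pairs(1)] glued_trans[OF _ new_pairs(4)]]
  by blast

text \<open>The arc from \<open>u\<close> stays in its old face and meets neither \<open>w\<close>
  nor \<open>z\<close>, so by parity it ends at \<open>v\<close>; this connects \<open>x\<close> to
  \<open>y\<close> whatever the twist.\<close>

lemma different_faces_join:
  assumes "(u, w) \<notin> glued (P \<union> Q)"
  shows "(x, y) \<in> F u w"
proof -
  have "(w, z) \<in> glued (P \<union> Q)" by (rule glued_pair[of "{w, z}"]) (use z in auto)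
  then have "(u, z) \<notin> glued (P \<union> Q)" using assms glued_trans glued_sym by metis
  then have "S \<inter> {w, z} = {}" using S_sub_face assms by auto
  then have "even (card (S \<inter> {u, v}))" using S_parity by simp
  then have "v \<in> S" using u_in_S by (cases "v \<in> S") (auto simp: Int_insert_right)
  then show ?thesis
    using glued_trans[OF glued_sym[OF new_pairs(1)] glued_trans[OF _ new_pairs(2)]] S_sub_F(1)
    by blast
qed

text \<open>On a common old face the arc from \<open>u\<close> must end at exactly one of
  \<open>w\<close> and \<open>z\<close>. Passing from \<open>w\<close> to \<open>z\<close> keeps the
  corner but reverses the twist, so one twist closes the arc up with \<open>x\<close> alone and the
  other leads it to \<open>y\<close>.\<close>

lemma same_face_exactly_one:
  assumes uw: "(u, w) \<in> glued (P \<union> Q)"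
  shows "(x, y) \<in> F u w \<longleftrightarrow> (x, y) \<notin> F u z"
proof (cases "v \<in> S")
  case True
  have "\<not> (w \<in> S \<and> z \<in> S)"
    using not_connected_without_pairs[OF D P Q v(4) z(4), of u] True u_in_S by auto
  moreover have "card (S \<inter> {u, v}) = 2" using True u_in_S v(2) by (auto simp: Int_insert_right)
  then have "even (card (S \<inter> {w, z}))" using S_parity by simp
  then have "w \<in> S \<longleftrightarrow> z \<in> S" by (auto simp: Int_insert_right split: if_splits)
  ultimately have wz: "w \<notin> S" "z \<notin> S" by auto
  \<comment> \<open>With \<open>v\<close> in \<open>S\<close> and both \<open>w\<close> and
    \<open>z\<close> outside, \<open>S\<close> would be saturated for all of
    \<open>P \<union> Q\<close>, so the common face would force \<open>w\<close> into it: a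
    contradiction.\<close>
  have "w \<in> S"
    using uw u_in_S
  proof (rule glued_closed)
    fix p a b assume p: "p \<in> P \<union> Q" "a \<in> p" "b \<in> p" "a \<in> S"
    consider "p \<in> arcs" | "p = {u, v}" | "p = {w, z}" using p(1) by auto
    then show "b \<in> S" by cases (use S_closed[OF _ p(2-4)] p True u_in_S wz in auto)
  qed
  then show ?thesis using wz by simp
next
  case False
  then have "S \<inter> {u, v} = {u}" using u_in_S by auto
  then have "card (S \<inter> {u, v}) = 1" by (metis is_singletonI is_singleton_altdef)
  then have "odd (card (S \<inter> {w, z}))" using S_parity by simp
  then consider "w \<in> S" "z \<notin> S" | "z \<in> S" "w \<notin> S"
    by (auto simp: Int_insert_right z(2)[symmetric] split: if_splits)
  then show ?thesis
  proof cases
    case 1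
    then show ?thesis using separated[of w] joined[of z] False z(3) by auto
  next
    case 2
    then show ?thesis using separated[of z] joined[of w] False z(3) by auto
  qed
qed

end

section \<open>Counting along a removal order\<close>

text \<open>Faces and components agree in number iff the two sides of every edge lie on a common face.\<close>

fun good_removal :: "'d set list \<Rightarrow> 'd set set \<Rightarrow> 'd set set \<Rightarrow> bool" where
  "good_removal [] P Q \<longleftrightarrow> True"
| "good_removal (e # es) P Q \<longleftrightarrow>
     (\<forall>p \<in> insert e (set es). p \<times> p \<subseteq> glued (P \<union> Q)) \<and>
     good_removal es (merge_corners e P) (merge_corners e Q)"

lemma good_removal_glued: "good_removal es P Q \<Longrightarrow> p \<in> set es \<Longrightarrow> p \<times> p \<subseteq> glued (P \<union> Q)"
  by (cases es) auto

definition good_maps ::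
    "'d set \<Rightarrow> 'd set list \<Rightarrow> ('d \<Rightarrow> 'v) \<Rightarrow> ('d \<Rightarrow> 'w) \<Rightarrow> ('d set set \<times> 'd set set) set" where
  "good_maps D es b w =
     {(P, Q). corners_at D (set es) b P \<and> corners_at D (set es) w Q \<and> good_removal es P Q}"

text \<open>There are \<open>2 ^ c\<close> such unions for a graph with \<open>c\<close> components.\<close>

definition component_unions :: "'d set \<Rightarrow> ('d \<Rightarrow> 'v) \<Rightarrow> ('d \<Rightarrow> 'w) \<Rightarrow> 'd set set" where
  "component_unions D b w =
     {S. S \<subseteq> D \<and> (\<forall>s \<in> D. \<forall>t \<in> D. b s = b t \<or> w s = w t \<longrightarrow> (s \<in> S \<longleftrightarrow> t \<in> S))}"

lemma finite_component_unions: "finite D \<Longrightarrow> finite (component_unions D b w)"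
  by (rule finite_subset[of _ "Pow D"]) (auto simp: component_unions_def)

lemma corners_at_pair_partition: "corners_at D E b P \<Longrightarrow> pair_partition D P"
  by (simp add: corners_at_def)

lemma corners_at_label:
  assumes "corners_at D E b P" "p \<in> P" "s \<in> p" "t \<in> p"
  shows "b s = b t"
  using assms glued_pair[of p "E \<union> P" s t] pair_partition_mem[of D P p]
  unfolding corners_at_def by auto

lemma finite_good_maps: "finite D \<Longrightarrow> finite (good_maps D es b w)"
  by (rule finite_subset[of _ "{P. pair_partition D P} \<times> {P. pair_partition D P}"])
    (auto simp: good_maps_def corners_at_def intro: finite_pair_partitions)

definition joining_corners ::
    "'d set \<Rightarrow> ('d \<Rightarrow> 'v) \<Rightarrow> ('d \<Rightarrow> 'w) \<Rightarrow> 'd \<Rightarrow> 'd \<Rightarrow> 'd set set \<Rightarrow> 'd set set \<Rightarrow>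
     ('d option \<times> 'd option) set" where
  "joining_corners D b w x y P Q =
     {(c, d) \<in> attach D b x \<times> attach D w x. (x, y) \<in> ribbon_faces x y P Q c d}"

context
  fixes D :: "'d set" and x y :: 'd and es :: "'d set list" and b :: "'d \<Rightarrow> 'v" and w :: "'d \<Rightarrow> 'w"
  assumes D: "finite D" and E: "pair_partition D (set es)"
    and xy: "x \<notin> D" "y \<notin> D" "x \<noteq> y" and bx: "b x = b y" and wx: "w x = w y"
begin

private abbreviation "D' \<equiv> insert x (insert y D)"
private abbreviation "U \<equiv> {t \<in> D. b t = b x}"
private abbreviation "W \<equiv> {t \<in> D. w t = w x}"

text \<open>The maps are sorted by what remains after the removal of the first edge of the list,
  which is the edge inserted last.\<close>

lemma card_good_maps_Cons:
  "card (good_maps D' ({x, y} # es) b w) =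
     (\<Sum>(P, Q) \<in> good_maps D es b w. card (joining_corners D b w x y P Q))"
proof -
  let ?J = "\<lambda>(P, Q). joining_corners D b w x y P Q"
  let ?f = "\<lambda>((P, Q), (c, d)). (add_ribbon x y P c, add_ribbon x y Q d)"
  have inj: "inj_on ?f (Sigma (good_maps D es b w) ?J)"
  proof (rule inj_onI)
    fix M N assume MN: "M \<in> Sigma (good_maps D es b w) ?J" "N \<in> Sigma (good_maps D es b w) ?J" "?f M = ?f N"
    obtain P Q c d P' Q' c' d' where M: "M = ((P, Q), (c, d))" and N: "N = ((P', Q'), (c', d'))"
      by (metis surj_pair)
    have 1: "(P, Q) \<in> good_maps D es b w" "(c, d) \<in> joining_corners D b w x y P Q"
      and 2: "(P', Q') \<in> good_maps D es b w" "(c', d') \<in> joining_corners D b w x y P' Q'"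
      and eq: "add_ribbon x y P c = add_ribbon x y P' c'" "add_ribbon x y Q d = add_ribbon x y Q' d'"
      using MN M N by auto
    have pp: "pair_partition D P" "pair_partition D Q" "pair_partition D P'" "pair_partition D Q'"
      and sub: "set_option c \<subseteq> D" "set_option d \<subseteq> D" "set_option c' \<subseteq> D" "set_option d' \<subseteq> D"
      using 1 2 by (auto simp: good_maps_def corners_at_def joining_corners_def dest: attach_subset)
    have "P = P'" "Q = Q'"
      using merge_corners_add_ribbon[OF pp(1) xy sub(1)] merge_corners_add_ribbon[OF pp(3) xy sub(3)]
        merge_corners_add_ribbon[OF pp(2) xy sub(2)] merge_corners_add_ribbon[OF pp(4) xy sub(4)] eq
      by simp_all
    then show "M = N"
      unfolding M N using add_ribbon_inj[OF pp(1) xy sub(1,3)] add_ribbon_inj[OF pp(2) xy sub(2,4)] eq by simp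
  qed
  have im: "?f ` Sigma (good_maps D es b w) ?J = good_maps D' ({x, y} # es) b w"
  proof (intro equalityI subsetI)
    fix M assume "M \<in> ?f ` Sigma (good_maps D es b w) ?J"
    then obtain P Q c d where M: "M = (add_ribbon x y P c, add_ribbon x y Q d)"
      and PQ: "(P, Q) \<in> good_maps D es b w" and cd: "(c, d) \<in> joining_corners D b w x y P Q"
      by auto
    have pp: "pair_partition D P" "pair_partition D Q"
      and at: "corners_at D (set es) b P" "corners_at D (set es) w Q" and good: "good_removal es P Q"
      and c: "c \<in> attach D b x" "set_option c \<subseteq> D" and d: "d \<in> attach D w x" "set_option d \<subseteq> D"
      and face: "(x, y) \<in> ribbon_faces x y P Q c d"
      using PQ cd by (auto simp: good_maps_def corners_at_def joining_corners_def dest: attach_subset)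
    \<comment> \<open>Through this inclusion the condition on the other edges is inherited, leaving
      only the sides of the new edge to be tested.\<close>
    note sub = glued_subset_ribbon_faces[OF pp c(2) d(2) face]
    have "p \<times> p \<subseteq> ribbon_faces x y P Q c d" if "p \<in> insert {x, y} (set es)" for p
    proof (cases "p = {x, y}")
      case True
      then show ?thesis using face glued_sym[OF face] by auto
    next
      case False
      then show ?thesis using good_removal_glued[OF good, of p] sub that by auto
    qed
    then show "M \<in> good_maps D' ({x, y} # es) b w"
      using corners_at_add_ribbon[where b = b, OF E pp(1) xy bx c(2)]
        corners_at_add_ribbon[where b = w, OF E pp(2) xy wx d(2)] at c d good
        merge_corners_add_ribbon[OF pp(1) xy c(2)] merge_corners_add_ribbon[OF pp(2) xy d(2)]
      by (auto simp: M good_maps_def)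
  next
    fix M assume "M \<in> good_maps D' ({x, y} # es) b w"
    then obtain P' Q' where M: "M = (P', Q')"
      and at: "corners_at D' (insert {x, y} (set es)) b P'" "corners_at D' (insert {x, y} (set es)) w Q'"
      and good: "good_removal ({x, y} # es) P' Q'" by (auto simp: good_maps_def)
    define P where "P = merge_corners {x, y} P'"
    define Q where "Q = merge_corners {x, y} Q'"
    obtain c where c: "set_option c \<subseteq> D" "pair_partition D P" "P' = add_ribbon x y P c"
      using add_ribbon_surj[OF corners_at_pair_partition[OF at(1)] xy] unfolding P_def by metis
    obtain d where d: "set_option d \<subseteq> D" "pair_partition D Q" "Q' = add_ribbon x y Q d"
      using add_ribbon_surj[OF corners_at_pair_partition[OF at(2)] xy] unfolding Q_def by metis
    have face: "(x, y) \<in> glued (P' \<union> Q')" and "good_removal es P Q"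
      using good by (auto simp: P_def Q_def)
    moreover have "corners_at D (set es) b P \<and> c \<in> attach D b x"
      using corners_at_add_ribbon[where b = b, OF E c(2) xy bx c(1)] at(1) unfolding c(3) by (rule iffD1)
    moreover have "corners_at D (set es) w Q \<and> d \<in> attach D w x"
      using corners_at_add_ribbon[where b = w, OF E d(2) xy wx d(1)] at(2) unfolding d(3) by (rule iffD1)
    moreover have "(x, y) \<in> ribbon_faces x y P Q c d" using face unfolding c(3) d(3) .
    ultimately have "(P, Q) \<in> good_maps D es b w \<and> (c, d) \<in> joining_corners D b w x y P Q"
      by (simp add: joining_corners_def good_maps_def)
    then have "((P, Q), (c, d)) \<in> Sigma (good_maps D es b w) ?J" by simp
    then show "M \<in> ?f ` Sigma (good_maps D es b w) ?J"
      using M c(3) d(3) by (intro image_eqI[of _ _ "((P, Q), (c, d))"]) auto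
  qed
  have "card (good_maps D' ({x, y} # es) b w) = card (Sigma (good_maps D es b w) ?J)"
    unfolding im[symmetric] by (rule card_image[OF inj])
  moreover have "finite (attach D b x \<times> attach D w x)"
    using D by (auto simp: attach_def)
  then have "finite (joining_corners D b w x y P Q)" for P Q
    by (rule rev_finite_subset) (auto simp: joining_corners_def)
  then have "card (Sigma (good_maps D es b w) ?J) = (\<Sum>M \<in> good_maps D es b w. card (?J M))"
    using finite_good_maps[OF D] by (intro card_SigmaI) auto
  ultimately show ?thesis by (simp add: case_prod_beta)
qed

text \<open>A union over the larger set is fixed by its old part and by the value \<open>i\<close>
  saying whether it contains the new edge. Old sides at the ends dictate \<open>i\<close>; without
  any, both values occur, the doubling caused by a new component.\<close>

lemma card_component_unions_insert:
  "card (component_unions D' b w) =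
     card {(S, i). S \<in> component_unions D b w \<and> (\<forall>t \<in> U \<union> W. t \<in> S \<longleftrightarrow> i)}"
proof -
  let ?A = "{(S, i). S \<in> component_unions D b w \<and> (\<forall>t \<in> U \<union> W. t \<in> S \<longleftrightarrow> i)}"
  let ?f = "\<lambda>(S, i). S \<union> (if i then {x, y} else {})"
  let ?g = "\<lambda>S. (S \<inter> D, x \<in> S)"
  have "bij_betw ?f ?A (component_unions D' b w)"
  proof (rule bij_betw_byWitness[where f' = ?g])
    show "\<forall>a \<in> ?A. ?g (?f a) = a" using xy by (auto simp: component_unions_def)
    show "\<forall>S \<in> component_unions D' b w. ?f (?g S) = S"
    proof
      fix S assume "S \<in> component_unions D' b w"
      then have "S \<subseteq> D'" "x \<in> S \<longleftrightarrow> y \<in> S" using bx unfolding component_unions_def by blast+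
      then show "?f (?g S) = S" by auto
    qed
    show "?f ` ?A \<subseteq> component_unions D' b w"
    proof clarify
      fix S i assume S: "S \<in> component_unions D b w" and i: "\<forall>t \<in> U \<union> W. t \<in> S \<longleftrightarrow> i"
      show "S \<union> (if i then {x, y} else {}) \<in> component_unions D' b w"
        unfolding component_unions_def
      proof (intro CollectI conjI ballI impI)
        let ?T = "S \<union> (if i then {x, y} else {})"
        show "?T \<subseteq> D'" using S by (auto simp: component_unions_def)
        have new: "z \<in> ?T \<longleftrightarrow> i" if "z = x \<or> z = y" for z
          using S xy that by (auto simp: component_unions_def)
        have old: "z \<in> ?T \<longleftrightarrow> z \<in> S" if "z \<in> D" for z using xy that by auto
        have att: "z \<in> S \<longleftrightarrow> i" if "z \<in> D" "b z = b x \<or> w z = w x" for z using i that by auto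
        fix s t assume st: "s \<in> D'" "t \<in> D'" "b s = b t \<or> w s = w t"
        consider "s = x \<or> s = y" "t = x \<or> t = y" | "s = x \<or> s = y" "t \<in> D"
          | "s \<in> D" "t = x \<or> t = y" | "s \<in> D" "t \<in> D" using st by blast
        then show "s \<in> ?T \<longleftrightarrow> t \<in> ?T"
        proof cases
          case 1
          then show ?thesis using new by metis
        next
          case 2
          then have "b t = b x \<or> w t = w x" using st(3) bx wx by metis
          then show ?thesis using 2 new old att by metis
        next
          case 3
          then have "b s = b x \<or> w s = w x" using st(3) bx wx by metis
          then show ?thesis using 3 new old att by metis
        next
          case 4
          then show ?thesis using S st(3) old unfolding component_unions_def by blast
        qed
      qed
    qed
    show "?g ` component_unions D' b w \<subseteq> ?A"
    proof clarify
      fix S assume S: "S \<in> component_unions D' b w"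
      then have "S \<inter> D \<in> component_unions D b w" unfolding component_unions_def by blast
      moreover have "t \<in> S \<inter> D \<longleftrightarrow> x \<in> S" if "t \<in> U \<union> W" for t
      proof -
        have "t \<in> D'" "x \<in> D'" "b t = b x \<or> w t = w x" "t \<in> D" using that by auto
        then show ?thesis using S unfolding component_unions_def by blast
      qed
      ultimately show "S \<inter> D \<in> component_unions D b w \<and> (\<forall>t \<in> U \<union> W. (t \<in> S \<inter> D) = (x \<in> S))"
        by blast
    qed
  qed
  then show ?thesis by (simp add: bij_betw_same_card)
qed

text \<open>Each edge at a vertex contributes both of its sides.\<close>

lemma even_card_attached:
  assumes "\<And>p s t. p \<in> set es \<Longrightarrow> s \<in> p \<Longrightarrow> t \<in> p \<Longrightarrow> f s = f t"
  shows "even (card {t \<in> D. f t = f x})"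
proof -
  have "pair_partition {t \<in> D. f t = f x} {p \<in> set es. p \<subseteq> {t \<in> D. f t = f x}}"
  proof (rule pair_partition_restrict[OF E])
    fix s assume s: "s \<in> {t \<in> D. f t = f x}"
    then have "f s = f (mate (set es) s)"
      using mate_pair[OF E, of s] by (intro assms[of "{s, mate (set es) s}"]) auto
    then show "mate (set es) s \<in> {t \<in> D. f t = f x}" using s mate_props[OF E, of s] by auto
  qed auto
  from card_pair_partition[OF _ this] D show ?thesis by simp
qed

text \<open>A union survives the insertion iff it contains both or neither of \<open>u\<close> and
  \<open>v\<close>. This is automatic within one component; otherwise flipping membership of one
  component matches the survivors with the rest.\<close>

lemma card_component_unions_half:
  assumes PQ: "(P, Q) \<in> good_maps D es b w" and u: "u \<in> U" and v: "v \<in> W"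
  shows "card (component_unions D' b w) * (if (u, v) \<in> glued (P \<union> Q) then 1 else 2) =
    card (component_unions D b w)"
proof -
  let ?K = "component_unions D b w"
  have bP: "corners_at D (set es) b P" and wQ: "corners_at D (set es) w Q"
    and good: "good_removal es P Q" using PQ by (auto simp: good_maps_def)
  note pp = corners_at_pair_partition[OF bP] corners_at_pair_partition[OF wQ]
  have label: "t \<in> S" if S: "S \<in> ?K" and st: "s \<in> D" "t \<in> D" "b s = b t \<or> w s = w t" "s \<in> S" for S s t
    using S st unfolding component_unions_def by blast
  have closed: "t \<in> S" if S: "S \<in> ?K" and st: "(s, t) \<in> glued (P \<union> Q)" "s \<in> S" for S s t
    using st
  proof (rule glued_closed)
    fix p i j assume p: "p \<in> P \<union> Q" "i \<in> p" "j \<in> p" "i \<in> S"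
    then have "b i = b j \<or> w i = w j" using corners_at_label[OF bP] corners_at_label[OF wQ] by blast
    moreover have "i \<in> D" "j \<in> D" using p pair_partition_mem[OF pp(1)] pair_partition_mem[OF pp(2)] by blast+
    ultimately show "j \<in> S" using label[OF S] p(4) by blast
  qed
  \<comment> \<open>In a good map every edge lies inside a face, hence so does every vertex. Thus
    faces are whole components, and \<open>glued (P \<union> Q)\<close> tests connectedness.\<close>
  have same: "(s, t) \<in> glued (P \<union> Q)" if "s \<in> D" "t \<in> D" "b s = b t \<or> w s = w t" for s t
  proof -
    have "(s, t) \<in> glued (set es \<union> P) \<or> (s, t) \<in> glued (set es \<union> Q)"
      using that bP wQ unfolding corners_at_def by blast
    moreover have "glued (set es \<union> P) \<subseteq> glued (P \<union> Q)" "glued (set es \<union> Q) \<subseteq> glued (P \<union> Q)"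
      by (rule glued_subI; use good_removal_glued[OF good] glued_pair[of _ "P \<union> Q"] in blast)+
    ultimately show ?thesis by blast
  qed
  have uv: "u \<in> D" "v \<in> D" "b u = b x" "w v = w x" using u v by auto
  have uS: "(\<forall>t \<in> U \<union> W. t \<in> S \<longleftrightarrow> i) \<longleftrightarrow> (u \<in> S \<longleftrightarrow> i) \<and> (v \<in> S \<longleftrightarrow> i)" if S: "S \<in> ?K" for S i
  proof
    assume i: "(u \<in> S \<longleftrightarrow> i) \<and> (v \<in> S \<longleftrightarrow> i)"
    show "\<forall>t \<in> U \<union> W. t \<in> S \<longleftrightarrow> i"
    proof
      fix t assume t: "t \<in> U \<union> W"
      then consider "t \<in> D" "b t = b u" | "t \<in> D" "w t = w v" using uv by auto
      then show "t \<in> S \<longleftrightarrow> i" using label[OF S, of t u] label[OF S, of u t]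
        label[OF S, of t v] label[OF S, of v t] uv i by cases auto
    qed
  qed (use u v in blast)
  have "{(S, i). S \<in> ?K \<and> (\<forall>t \<in> U \<union> W. t \<in> S \<longleftrightarrow> i)} =
      (\<lambda>S. (S, u \<in> S)) ` {S \<in> ?K. u \<in> S \<longleftrightarrow> v \<in> S}" (is "?L = ?R")
  proof (rule set_eqI)
    fix M :: "'d set \<times> bool"
    obtain S i where M: "M = (S, i)" by (cases M)
    have "M \<in> ?L \<longleftrightarrow> S \<in> ?K \<and> (u \<in> S \<longleftrightarrow> i) \<and> (v \<in> S \<longleftrightarrow> i)"
      using uS[of S i] unfolding M by blast
    also have "\<dots> \<longleftrightarrow> M \<in> ?R" unfolding M by auto
    finally show "M \<in> ?L \<longleftrightarrow> M \<in> ?R" .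
  qed
  then have c: "card (component_unions D' b w) = card {S \<in> ?K. u \<in> S \<longleftrightarrow> v \<in> S}"
    unfolding card_component_unions_insert by (simp add: card_image inj_on_def)
  show ?thesis
  proof (cases "(u, v) \<in> glued (P \<union> Q)")
    case True
    then have "{S \<in> ?K. u \<in> S \<longleftrightarrow> v \<in> S} = ?K"
      using closed[of _ u v] closed[of _ v u] glued_sym[OF True] by blast
    then show ?thesis using c True by simp
  next
    case False
    let ?C = "glued (P \<union> Q) `` {u}"
    \<comment> \<open>Symmetric difference with the component of \<open>u\<close>: it switches the
      membership of \<open>u\<close> and keeps that of \<open>v\<close>.\<close>
    define flip where "flip S = (S - ?C) \<union> (?C - S)" for S
    have CD: "?C \<subseteq> D"
      using pair_partition_Pow[OF pp(1)] pair_partition_Pow[OF pp(2)] uv by (intro glued_subset) auto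
    have flip_K: "flip S \<in> ?K" if S: "S \<in> ?K" for S
      unfolding component_unions_def
    proof (intro CollectI conjI ballI impI)
      show "flip S \<subseteq> D" using S CD by (auto simp: flip_def component_unions_def)
      fix s t assume st: "s \<in> D" "t \<in> D" "b s = b t \<or> w s = w t"
      then have ts: "b t = b s \<or> w t = w s" by auto
      have "s \<in> S \<longleftrightarrow> t \<in> S" using label[OF S st] label[OF S st(2,1) ts] by blast
      moreover have "s \<in> ?C \<longleftrightarrow> t \<in> ?C"
        using glued_trans[of u s _ t, OF _ same[OF st]]
          glued_trans[of u t _ s, OF _ glued_sym[OF same[OF st]]] by auto
      ultimately show "s \<in> flip S \<longleftrightarrow> t \<in> flip S" unfolding flip_def by blast
    qed
    have flip_flip: "flip (flip S) = S" for S unfolding flip_def by blast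
    have flip_uv: "u \<in> flip S \<longleftrightarrow> u \<notin> S" "v \<in> flip S \<longleftrightarrow> v \<in> S" for S
      using False by (auto simp: flip_def)
    have "bij_betw flip {S \<in> ?K. u \<in> S \<longleftrightarrow> v \<in> S} {S \<in> ?K. \<not> (u \<in> S \<longleftrightarrow> v \<in> S)}"
      by (rule bij_betw_byWitness[where f' = flip]) (use flip_K flip_uv in \<open>auto simp: flip_flip\<close>)
    then have "card {S \<in> ?K. u \<in> S \<longleftrightarrow> v \<in> S} = card {S \<in> ?K. \<not> (u \<in> S \<longleftrightarrow> v \<in> S)}"
      by (rule bij_betw_same_card)
    moreover have "card ?K = card ({S \<in> ?K. u \<in> S \<longleftrightarrow> v \<in> S} \<union> {S \<in> ?K. \<not> (u \<in> S \<longleftrightarrow> v \<in> S)})"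
      by (rule arg_cong[of _ _ card]) blast
    then have "card ?K = card {S \<in> ?K. u \<in> S \<longleftrightarrow> v \<in> S} + card {S \<in> ?K. \<not> (u \<in> S \<longleftrightarrow> v \<in> S)}"
      using finite_component_unions[OF D, of b w] by (subst (asm) card_Un_disjoint) auto
    ultimately show ?thesis using c False by simp
  qed
qed

text \<open>On different faces every attachment joins the new sides; on a common face, exchanging
  \<open>j\<close> with \<open>mate Q j\<close> matches the joining attachments with the others. The
  factor 2 on the left avoids a division.\<close>

lemma card_joining_corners_both:
  assumes PQ: "(P, Q) \<in> good_maps D es b w" and u: "u \<in> U" and v: "v \<in> W"
  shows "card (joining_corners D b w x y P Q) * 2 =
    card U * card W * (if (u, v) \<in> glued (P \<union> Q) then 1 else 2)"
proof -
  have bP: "corners_at D (set es) b P" and wQ: "corners_at D (set es) w Q"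
    and good: "good_removal es P Q" using PQ by (auto simp: good_maps_def)
  note pp = corners_at_pair_partition[OF bP] corners_at_pair_partition[OF wQ]
  let ?G = "{(i, j) \<in> U \<times> W. (x, y) \<in> ribbon_faces x y P Q (Some i) (Some j)}"
  let ?B = "{(i, j) \<in> U \<times> W. (x, y) \<notin> ribbon_faces x y P Q (Some i) (Some j)}"
  have "attach D b x = Some ` U" "attach D w x = Some ` W"
    using u v by (auto simp: attach_def)
  then have "joining_corners D b w x y P Q = (\<lambda>(i, j). (Some i, Some j)) ` ?G"
    by (auto simp: joining_corners_def)
  moreover have "inj_on (\<lambda>(i, j). (Some i, Some j)) ?G" by (auto simp: inj_on_def)
  ultimately have c: "card (joining_corners D b w x y P Q) = card ?G" by (simp add: card_image)
  have sub: "glued (set es \<union> P) \<subseteq> glued (P \<union> Q)" "glued (set es \<union> Q) \<subseteq> glued (P \<union> Q)"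
    by (rule glued_subI; use good_removal_glued[OF good] glued_pair[of _ "P \<union> Q"] in blast)+
  \<comment> \<open>Which case holds does not depend on the chosen sides: all sides of one vertex
    lie on one face of a good map.\<close>
  have face: "(i, j) \<in> glued (P \<union> Q) \<longleftrightarrow> (u, v) \<in> glued (P \<union> Q)" if "i \<in> U" "j \<in> W" for i j
  proof -
    have "(i, u) \<in> glued (set es \<union> P)" "(j, v) \<in> glued (set es \<union> Q)"
      using bP wQ that u v unfolding corners_at_def by auto
    then have ij: "(i, u) \<in> glued (P \<union> Q)" "(j, v) \<in> glued (P \<union> Q)" using sub by auto
    then show ?thesis using glued_trans glued_sym by metis
  qed
  show ?thesis
  proof (cases "(u, v) \<in> glued (P \<union> Q)")
    case True
    let ?f = "\<lambda>(i, j). (i, mate Q j)"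
    have mW: "mate Q j \<in> W" if "j \<in> W" for j
      using that mate_props[OF pp(2), of j] corners_at_label[OF wQ mate_pair[OF pp(2)], of j j "mate Q j"]
      by auto
    have flip: "(x, y) \<in> ribbon_faces x y P Q (Some i) (Some j) \<longleftrightarrow>
        (x, y) \<notin> ribbon_faces x y P Q (Some i) (Some (mate Q j))" if "i \<in> U" "j \<in> W" for i j
      by (rule same_face_exactly_one[OF D pp xy]) (use that face True in auto)
    have mm: "mate Q (mate Q j) = j" if "j \<in> W" for j using mate_props[OF pp(2), of j] that by auto
    have "bij_betw ?f ?G ?B"
      by (rule bij_betw_byWitness[where f' = ?f]) (use flip mW mm in auto)
    then have "card ?G = card ?B" by (rule bij_betw_same_card)
    moreover have "?G \<union> ?B = U \<times> W" by auto
    then have "card U * card W = card (?G \<union> ?B)" by (simp add: card_cartesian_product)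
    moreover have "finite ?G" "finite ?B"
      by (rule finite_subset[of _ "U \<times> W"]; use D in auto)+
    then have "card (?G \<union> ?B) = card ?G + card ?B" by (intro card_Un_disjoint) auto
    ultimately show ?thesis using c True by simp
  next
    case False
    then have "?G = U \<times> W"
      using different_faces_join[OF D pp xy] face by auto
    then show ?thesis using c False by (simp add: card_cartesian_product)
  qed
qed

text \<open>Both factors on the left depend on whether the ends were already connected, the first
  through the face condition and the second through the merging of components; the two dependences
  cancel. Halving \<open>card U\<close> counts edges instead of sides, and \<open>max 1\<close>
  covers a new vertex.\<close>

lemma card_joining_corners:
  assumes PQ: "(P, Q) \<in> good_maps D es b w"
    and const: "\<And>p s t. p \<in> set es \<Longrightarrow> s \<in> p \<Longrightarrow> t \<in> p \<Longrightarrow> b s = b t \<and> w s = w t"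
  shows "card (joining_corners D b w x y P Q) * card (component_unions D' b w) =
    2 * max 1 (card U div 2) * max 1 (card W div 2) * card (component_unions D b w)"
proof -
  have even: "even (card U)" "even (card W)" using even_card_attached const by blast+
  have pos: "card {t \<in> D. R t} div 2 \<ge> 1" if "even (card {t \<in> D. R t})" "t \<in> D" "R t" for R t
  proof -
    have "card {t \<in> D. R t} \<noteq> 0" using that D by auto
    then show ?thesis using that(1) by presburger
  qed
  let ?K = "component_unions D b w"
  have K_label: "s \<in> S \<longleftrightarrow> t \<in> S" if "S \<in> ?K" "s \<in> D" "t \<in> D" "b s = b t \<or> w s = w t" for S s t
    using that unfolding component_unions_def by blast
  \<comment> \<open>When all sides in \<open>V\<close> share a vertex with \<open>u\<close>, the
    value \<open>i\<close> is forced to be \<open>u \<in> S\<close>, so every old union extends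
    uniquely.\<close>
  have leaf: "card {(S, i). S \<in> ?K \<and> (\<forall>t \<in> V. t \<in> S \<longleftrightarrow> i)} = card ?K"
    if "u \<in> V" "\<And>t. t \<in> V \<Longrightarrow> t \<in> D \<and> (b u = b t \<or> w u = w t)" for u V
  proof -
    have "t \<in> S \<longleftrightarrow> u \<in> S" if "t \<in> V" "S \<in> ?K" for t S
      using K_label[of S u t] that \<open>u \<in> V\<close> \<open>\<And>t. t \<in> V \<Longrightarrow> t \<in> D \<and> (b u = b t \<or> w u = w t)\<close> by blast
    then have eq: "S \<in> ?K \<and> (\<forall>t \<in> V. t \<in> S \<longleftrightarrow> i) \<longleftrightarrow> S \<in> ?K \<and> i = (u \<in> S)" for S i
      using that(1) by blast
    have "{(S, i). S \<in> ?K \<and> (\<forall>t \<in> V. t \<in> S \<longleftrightarrow> i)} = (\<lambda>S. (S, u \<in> S)) ` ?K"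
      unfolding eq by auto
    then show ?thesis by (simp add: card_image inj_on_def)
  qed
  consider (iso) "U = {}" "W = {}" | (black) u where "u \<in> U" "W = {}" | (white) v where "U = {}" "v \<in> W"
    | (both) u v where "u \<in> U" "v \<in> W" by blast
  then show ?thesis
  proof cases
    case iso
    then have "joining_corners D b w x y P Q = {(None, None)}"
      using same_face_None by (auto simp: joining_corners_def attach_def)
    \<comment> \<open>The edge is a component of its own: one gluing, and twice as many
      unions.\<close>
    moreover have "{(S, i). S \<in> ?K \<and> (\<forall>t \<in> U \<union> W. t \<in> S \<longleftrightarrow> i)} = ?K \<times> UNIV"
      unfolding iso by auto
    then have "card (component_unions D' b w) = 2 * card ?K"
      unfolding card_component_unions_insert by (simp add: card_cartesian_product)
    ultimately show ?thesis unfolding iso by simp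
  next
    case black
    then have "attach D b x = Some ` U" "attach D w x = {None}" by (auto simp: attach_def)
    then have "joining_corners D b w x y P Q = (\<lambda>u. (Some u, None)) ` U"
      unfolding joining_corners_def by (auto simp: same_face_None)
    then have "card (joining_corners D b w x y P Q) = card U" by (simp add: card_image inj_on_def)
    moreover have "card (component_unions D' b w) = card ?K"
      unfolding card_component_unions_insert by (rule leaf[of u]) (use black in auto)
    moreover have "card W = 0" unfolding black(2) by simp
    ultimately show ?thesis
      using pos[of "\<lambda>t. b t = b x" u] even black(1) by simp
  next
    case white
    then have "attach D w x = Some ` W" "attach D b x = {None}" by (auto simp: attach_def)
    then have "joining_corners D b w x y P Q = (\<lambda>u. (None, Some u)) ` W"
      unfolding joining_corners_def by (auto simp: same_face_None)
    then have "card (joining_corners D b w x y P Q) = card W" by (simp add: card_image inj_on_def)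
    moreover have "card (component_unions D' b w) = card ?K"
      unfolding card_component_unions_insert by (rule leaf[of v]) (use white in auto)
    moreover have "card U = 0" unfolding white(1) by simp
    ultimately show ?thesis
      using pos[of "\<lambda>t. w t = w x" v] even white(2) by simp
  next
    case both
    \<comment> \<open>\<open>f\<close> multiplies the number of gluings and divides the number of
      unions, so it drops out of the product.\<close>
    define f :: nat where "f = (if (u, v) \<in> glued (P \<union> Q) then 1 else 2)"
    have 1: "card (component_unions D' b w) * f = card ?K"
      using card_component_unions_half[OF PQ both] by (simp add: f_def)
    have 2: "card (joining_corners D b w x y P Q) * 2 = card U * card W * f"
      using card_joining_corners_both[OF PQ both] by (simp add: f_def)
    obtain i j where ij: "card U = 2 * i" "card W = 2 * j" using even by (auto elim!: evenE)
    have "i \<ge> 1" "j \<ge> 1" using pos[of "\<lambda>t. b t = b x" u] pos[of "\<lambda>t. w t = w x" v] even both ij by auto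
    then have m: "max 1 (card U div 2) = i" "max 1 (card W div 2) = j" using ij by auto
    have "card (joining_corners D b w x y P Q) = 2 * i * j * f" using 2 ij by simp
    then show ?thesis unfolding m 1[symmetric] by simp
  qed
qed

end

section \<open>The product formula for good maps\<close>

text \<open>When the two sides of each edge carry one label, half the count is the degree among the
  remaining edges. The product is then that of (d - 1)! over the vertices of final degree d, the
  number of cyclic orders around them; \<open>max 1\<close> is the factor of the first edge at a
  vertex.\<close>

fun ribbon_choices :: "('d \<Rightarrow> 'v) \<Rightarrow> 'd set list \<Rightarrow> nat" where
  "ribbon_choices b [] = 1"
| "ribbon_choices b (e # es) =
     max 1 (card {t \<in> \<Union>(set es). b t \<in> b ` e} div 2) * ribbon_choices b es"

lemma edge_list_ConsE:
  assumes "pair_partition D (set (e # es))" "distinct (e # es)"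
  obtains x y where "e = {x, y}" "x \<noteq> y" "x \<notin> \<Union>(set es)" "y \<notin> \<Union>(set es)"
    "pair_partition (\<Union>(set es)) (set es)" "D = insert x (insert y (\<Union>(set es)))"
proof -
  obtain x y where e: "e = {x, y}" "x \<noteq> y"
    using assms(1) by (auto simp: pair_partition_def card_2_iff)
  have U: "\<Union>(set (e # es)) = D" using assms(1) by (simp add: pair_partition_def partition_on_def)
  have "pair_partition (D - e) (set (e # es) - {e})"
    by (rule pair_partition_remove[OF assms(1)]) simp
  moreover have "set (e # es) - {e} = set es" using assms(2) by auto
  ultimately have pp: "pair_partition (D - e) (set es)" by simp
  then have "D - e = \<Union>(set es)" by (simp add: pair_partition_def partition_on_def)
  then show thesis using that[of x y] e pp U by auto
qed

text \<open>The factor from \<open>card_joining_corners\<close> is the same for every smaller map,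
  so the sum over smaller maps collapses to a product. \<open>D\<close> is generalised because it
  shrinks with each removal.\<close>

theorem card_good_maps:
  assumes "finite D" "pair_partition D (set es)" "distinct es"
    and "\<And>p s t. p \<in> set es \<Longrightarrow> s \<in> p \<Longrightarrow> t \<in> p \<Longrightarrow> b s = b t \<and> w s = w t"
  shows "card (good_maps D es b w) * card (component_unions D b w) =
    2 ^ length es * ribbon_choices b es * ribbon_choices w es"
  using assms
proof (induction es arbitrary: D)
  case Nil
  then have "good_maps D [] b w = {({}, {})}" "component_unions D b w = {{}}"
    by (auto simp: good_maps_def component_unions_def corners_at_def)
  then show ?case by simp
next
  case (Cons e es)
  let ?D = "\<Union>(set es)"
  obtain x y where e: "e = {x, y}" and xy: "x \<notin> ?D" "y \<notin> ?D" "x \<noteq> y"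
    and E: "pair_partition ?D (set es)" and D: "D = insert x (insert y ?D)"
    using edge_list_ConsE[OF Cons.prems(2,3)] by metis
  have fin: "finite ?D" using Cons.prems(1) D by simp
  have lab: "b x = b y" "w x = w y" using Cons.prems(4)[of e x y] e by auto
  have const: "\<And>p s t. p \<in> set es \<Longrightarrow> s \<in> p \<Longrightarrow> t \<in> p \<Longrightarrow> b s = b t \<and> w s = w t"
    by (rule Cons.prems(4)) auto
  define m where "m = max 1 (card {t \<in> ?D. b t = b x} div 2) * max 1 (card {t \<in> ?D. w t = w x} div 2)"
  have "card (good_maps D (e # es) b w) * card (component_unions D b w) =
      (\<Sum>(P, Q) \<in> good_maps ?D es b w.
        card (joining_corners ?D b w x y P Q) * card (component_unions D b w))"
    unfolding e D card_good_maps_Cons[OF fin E xy lab] by (simp add: sum_distrib_right case_prod_unfold)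
  also have "\<dots> = (\<Sum>(P, Q) \<in> good_maps ?D es b w. 2 * m * card (component_unions ?D b w))"
  proof (rule sum.cong[OF refl], clarify)
    fix P Q assume "(P, Q) \<in> good_maps ?D es b w"
    then show "card (joining_corners ?D b w x y P Q) * card (component_unions D b w) =
        2 * m * card (component_unions ?D b w)"
      unfolding D m_def using card_joining_corners[OF fin E xy lab _ const, of P Q] by (simp add: mult.assoc)
  qed
  also have "\<dots> = 2 * m * (card (good_maps ?D es b w) * card (component_unions ?D b w))" by simp
  also have "\<dots> = 2 * m * (2 ^ length es * ribbon_choices b es * ribbon_choices w es)"
    using Cons.IH[OF fin E _ const] Cons.prems(3) by simp
  also have "\<dots> = 2 ^ length (e # es) * ribbon_choices b (e # es) * ribbon_choices w (e # es)"
    unfolding m_def e by (simp add: lab)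
  finally show ?case .
qed

section \<open>Counting oriented gluings of a fixed graph\<close>

text \<open>The condition of \<open>orientation\<close> for a single family of pairs, so that edges,
  black corners and white corners can be treated separately.\<close>

definition balanced :: "'d set \<Rightarrow> 'd set set \<Rightarrow> bool" where
  "balanced B P \<longleftrightarrow> (\<forall>p \<in> P. card (p \<inter> B) = 1)"

lemma card_pair_Int: "s \<noteq> t \<Longrightarrow> card ({s, t} \<inter> B) = 1 \<longleftrightarrow> (s \<in> B \<longleftrightarrow> t \<notin> B)"
  by (auto simp: Int_insert_left)

lemma balanced_mate:
  assumes "pair_partition D P" "balanced B P" "s \<in> D"
  shows "s \<in> B \<longleftrightarrow> mate P s \<notin> B"
  using mate_pair[OF assms(1,3)] mate_props(2)[OF assms(1,3)] card_pair_Int[of s "mate P s" B] assms(2)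
  by (auto simp: balanced_def)

text \<open>With \<open>x\<close> and \<open>y\<close> on opposite sides of \<open>B\<close> and
  \<open>u\<close> opposite to \<open>x\<close>, alternation at the corner
  \<open>{mate P u, y}\<close> amounts to alternation at the old corner
  \<open>{u, mate P u}\<close>.\<close>

lemma balanced_add_ribbon:
  assumes P: "pair_partition D P" and xy: "x \<notin> D" "y \<notin> D" "x \<noteq> y" and c: "set_option c \<subseteq> D"
    and B: "x \<in> B \<longleftrightarrow> y \<notin> B"
  shows "balanced B (add_ribbon x y P c) \<longleftrightarrow> balanced B P \<and> (\<forall>u \<in> set_option c. u \<in> B \<longleftrightarrow> x \<notin> B)"
proof (cases c)
  case None
  then show ?thesis using card_pair_Int[OF xy(3)] B by (simp add: add_ribbon_def balanced_def)
next
  case (Some u)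
  let ?v = "mate P u" and ?R = "P - {{u, mate P u}}"
  have u: "u \<in> D" using c Some by simp
  note v = mate_props[OF P u]
  have "P = insert {u, ?v} ?R" using mate_pair[OF P u] by auto
  then have "balanced B P \<longleftrightarrow> card ({u, ?v} \<inter> B) = 1 \<and> balanced B ?R"
    by (metis balanced_def insert_iff)
  moreover have "u \<noteq> x" "?v \<noteq> y" using u v xy by auto
  ultimately show ?thesis
    using card_pair_Int[of u x B] card_pair_Int[of ?v y B] card_pair_Int[of u ?v B] v(2) B
    by (auto simp: Some add_ribbon_def balanced_def)
qed

text \<open>Each edge at the vertex has one side in \<open>B\<close> and one outside, exchanged by
  \<open>mate E\<close>; so half of the sides qualify, or \<open>None\<close> alone at a new
  vertex.\<close>

lemma card_attached_opposite:
  assumes D: "finite D" and E: "pair_partition D E" and B: "balanced B E"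
    and const: "\<And>p s t. p \<in> E \<Longrightarrow> s \<in> p \<Longrightarrow> t \<in> p \<Longrightarrow> b s = b t"
  shows "card {c \<in> attach D b x. \<forall>u \<in> set_option c. u \<in> B \<longleftrightarrow> i} = max 1 (card {t \<in> D. b t = b x} div 2)"
proof (cases "{t \<in> D. b t = b x} = {}")
  case True
  then have "{c \<in> attach D b x. \<forall>u \<in> set_option c. u \<in> B \<longleftrightarrow> i} = {None}"
    by (auto simp: attach_def)
  moreover have "card {t \<in> D. b t = b x} = 0" unfolding True by simp
  ultimately show ?thesis by simp
next
  case False
  let ?U = "\<lambda>i. {t \<in> D. b t = b x \<and> (t \<in> B \<longleftrightarrow> i)}"
  have mb: "mate E s \<in> D" "mate E (mate E s) = s" "b (mate E s) = b s" "mate E s \<in> B \<longleftrightarrow> s \<notin> B"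
    if "s \<in> D" for s
    using mate_props[OF E that] balanced_mate[OF E B that]
      const[OF mate_pair[OF E that], of "mate E s" s] by simp_all
  have "bij_betw (mate E) (?U True) (?U False)"
    by (rule bij_betw_byWitness[where f' = "mate E"])
      (use mb in auto)
  then have eq: "card (?U True) = card (?U False)" by (rule bij_betw_same_card)
  have "{t \<in> D. b t = b x} = ?U True \<union> ?U False" by auto
  moreover have "card (?U True \<union> ?U False) = card (?U True) + card (?U False)"
    using D by (intro card_Un_disjoint) auto
  ultimately have U: "card {t \<in> D. b t = b x} = 2 * card (?U i)" using eq by (cases i) auto
  have "{c \<in> attach D b x. \<forall>u \<in> set_option c. u \<in> B \<longleftrightarrow> i} = Some ` ?U i"
    using False by (auto simp: attach_def)
  then have "card {c \<in> attach D b x. \<forall>u \<in> set_option c. u \<in> B \<longleftrightarrow> i} = card (?U i)"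
    by (simp add: card_image)
  moreover have "card {t \<in> D. b t = b x} \<noteq> 0" using False D by auto
  ultimately show ?thesis using U by simp
qed

text \<open>Once \<open>B\<close> is fixed, each corner offers only one of its two sides as
  neighbour of \<open>x\<close>, the one opposite to \<open>x\<close>. The twist is forced, and the
  places for the ribbon end are counted by the corners of the vertex.\<close>

theorem card_balanced_corners:
  assumes "finite D" "pair_partition D (set es)" "distinct es" "balanced B (set es)"
    and "\<And>p s t. p \<in> set es \<Longrightarrow> s \<in> p \<Longrightarrow> t \<in> p \<Longrightarrow> b s = b t"
  shows "card {P. corners_at D (set es) b P \<and> balanced B P} = ribbon_choices b es"
  using assms
proof (induction es arbitrary: D)
  case Nil
  then have "{P. corners_at D (set []) b P \<and> balanced B P} = {{}}"
    by (auto simp: corners_at_def balanced_def)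
  then show ?case by simp
next
  case (Cons e es)
  let ?D = "\<Union>(set es)"
  obtain x y where e: "e = {x, y}" and xy: "x \<notin> ?D" "y \<notin> ?D" "x \<noteq> y"
    and E: "pair_partition ?D (set es)" and D: "D = insert x (insert y ?D)"
    using edge_list_ConsE[OF Cons.prems(2,3)] by metis
  have fin: "finite ?D" using Cons.prems(1) D by simp
  have lab: "b x = b y" using Cons.prems(5)[of e x y] e by auto
  have const: "\<And>p s t. p \<in> set es \<Longrightarrow> s \<in> p \<Longrightarrow> t \<in> p \<Longrightarrow> b s = b t"
    by (rule Cons.prems(5)) auto
  have bal: "balanced B (set es)" "x \<in> B \<longleftrightarrow> y \<notin> B"
    using Cons.prems(4) card_pair_Int[OF xy(3)] by (auto simp: balanced_def e)
  define A where "A = {P. corners_at ?D (set es) b P \<and> balanced B P}"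
  define C where "C = {c \<in> attach ?D b x. \<forall>u \<in> set_option c. u \<in> B \<longleftrightarrow> x \<notin> B}"
  let ?f = "\<lambda>(P, c). add_ribbon x y P c"
  have A: "pair_partition ?D P" if "P \<in> A" for P using that by (simp add: A_def corners_at_def)
  have C: "set_option c \<subseteq> ?D" if "c \<in> C" for c using that attach_subset[of c ?D b x] by (simp add: C_def)
  have inj: "inj_on ?f (A \<times> C)"
  proof (rule inj_onI)
    fix M N assume MN: "M \<in> A \<times> C" "N \<in> A \<times> C" "?f M = ?f N"
    obtain P c P' c' where M: "M = (P, c)" and N: "N = (P', c')" by (metis surj_pair)
    have PA: "P \<in> A" "P' \<in> A" "c \<in> C" "c' \<in> C" and eq: "add_ribbon x y P c = add_ribbon x y P' c'"
      using MN M N by auto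
    have "P = P'"
      using merge_corners_add_ribbon[OF A[OF PA(1)] xy C[OF PA(3)]]
        merge_corners_add_ribbon[OF A[OF PA(2)] xy C[OF PA(4)]] eq by simp
    then show "M = N"
      using add_ribbon_inj[OF A[OF PA(1)] xy C[OF PA(3)] C[OF PA(4)]] eq M N by simp
  qed
  have "?f ` (A \<times> C) = {P. corners_at D (set (e # es)) b P \<and> balanced B P}"
  proof (intro equalityI subsetI)
    fix M assume "M \<in> ?f ` (A \<times> C)"
    then obtain P c where M: "M = add_ribbon x y P c" and Pc: "P \<in> A" "c \<in> C" by auto
    then show "M \<in> {P. corners_at D (set (e # es)) b P \<and> balanced B P}"
      using corners_at_add_ribbon[OF E A[OF Pc(1)] xy lab C[OF Pc(2)]]
        balanced_add_ribbon[OF A[OF Pc(1)] xy C[OF Pc(2)] bal(2)]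
      by (simp add: D[symmetric] e[symmetric]) (simp add: A_def C_def)
  next
    fix M assume M: "M \<in> {P. corners_at D (set (e # es)) b P \<and> balanced B P}"
    define P where "P = merge_corners {x, y} M"
    have "pair_partition (insert x (insert y ?D)) M" using M D by (simp add: corners_at_def)
    then obtain c where c: "set_option c \<subseteq> ?D" "pair_partition ?D P" "M = add_ribbon x y P c"
      using add_ribbon_surj xy unfolding P_def by metis
    have "corners_at D (set (e # es)) b (add_ribbon x y P c)" "balanced B (add_ribbon x y P c)"
      using M c(3) by auto
    then have "P \<in> A \<and> c \<in> C"
      using corners_at_add_ribbon[where b = b, OF E c(2) xy lab c(1)]
        balanced_add_ribbon[OF c(2) xy c(1) bal(2)]
      by (simp add: D[symmetric] e[symmetric]) (simp add: A_def C_def)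
    then show "M \<in> ?f ` (A \<times> C)" using c(3) by auto
  qed
  then have "card {P. corners_at D (set (e # es)) b P \<and> balanced B P} = card A * card C"
    using card_image[OF inj] by (simp add: card_cartesian_product)
  moreover have "card A = ribbon_choices b es"
    unfolding A_def using Cons.IH[OF fin E _ bal(1) const] Cons.prems(3) by simp
  moreover have "card C = max 1 (card {t \<in> ?D. b t = b x} div 2)"
    unfolding C_def by (rule card_attached_opposite[OF fin E bal(1)]) (rule const)
  ultimately show ?case unfolding e by (simp add: lab)
qed

theorem card_balanced_sets:
  assumes "pair_partition D (set es)" "distinct es"
  shows "card {B. B \<subseteq> D \<and> balanced B (set es)} = 2 ^ length es"
  using assms
proof (induction es arbitrary: D)
  case Nil
  then have "{B. B \<subseteq> D \<and> balanced B (set [])} = {{}}" by (auto simp: balanced_def)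
  then show ?case by simp
next
  case (Cons e es)
  let ?D = "\<Union>(set es)"
  obtain x y where e: "e = {x, y}" and xy: "x \<notin> ?D" "y \<notin> ?D" "x \<noteq> y"
    and E: "pair_partition ?D (set es)" and D: "D = insert x (insert y ?D)"
    using edge_list_ConsE[OF Cons.prems] by metis
  let ?A = "{B. B \<subseteq> ?D \<and> balanced B (set es)}"
  let ?f = "\<lambda>(B, i). insert (if i then x else y) B"
  let ?g = "\<lambda>B. (B \<inter> ?D, x \<in> B)"
  have restr: "balanced B (set es) \<longleftrightarrow> balanced C (set es)" if "B \<inter> ?D = C \<inter> ?D" for B C
  proof -
    have "p \<inter> B = p \<inter> C" if "p \<in> set es" for p
      using that \<open>B \<inter> ?D = C \<inter> ?D\<close> by blast
    then show ?thesis by (simp add: balanced_def)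
  qed
  have bal: "balanced B (set (e # es)) \<longleftrightarrow> (x \<in> B \<longleftrightarrow> y \<notin> B) \<and> balanced B (set es)" for B
    using card_pair_Int[OF xy(3), of B] by (simp add: balanced_def e)
  have "bij_betw ?f (?A \<times> UNIV) {B. B \<subseteq> D \<and> balanced B (set (e # es))}"
  proof (rule bij_betw_byWitness[where f' = ?g])
    show "\<forall>a \<in> ?A \<times> UNIV. ?g (?f a) = a" using xy by auto
    show "\<forall>B \<in> {B. B \<subseteq> D \<and> balanced B (set (e # es))}. ?f (?g B) = B"
      unfolding bal D using xy(3) by auto
    show "?f ` (?A \<times> UNIV) \<subseteq> {B. B \<subseteq> D \<and> balanced B (set (e # es))}"
    proof (rule image_subsetI)
      fix M assume M: "M \<in> ?A \<times> (UNIV :: bool set)"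
      obtain B i where Bi: "M = (B, i)" by (cases M)
      then have B: "B \<subseteq> ?D" "balanced B (set es)" using M by auto
      let ?B = "insert (if i then x else y) B"
      have "?B \<inter> ?D = B \<inter> ?D" using xy by auto
      then have "balanced ?B (set es)" using restr B(2) by blast
      moreover have "x \<in> ?B \<longleftrightarrow> y \<notin> ?B" "?B \<subseteq> D" using xy B(1) D by auto
      ultimately show "?f M \<in> {B. B \<subseteq> D \<and> balanced B (set (e # es))}" unfolding bal Bi by simp
    qed
    show "?g ` {B. B \<subseteq> D \<and> balanced B (set (e # es))} \<subseteq> ?A \<times> UNIV"
    proof (rule image_subsetI)
      fix B assume "B \<in> {B. B \<subseteq> D \<and> balanced B (set (e # es))}"
      then show "?g B \<in> ?A \<times> UNIV" using restr[of B "B \<inter> ?D"] bal by simp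
    qed
  qed
  then have "card {B. B \<subseteq> D \<and> balanced B (set (e # es))} = card (?A \<times> (UNIV :: bool set))"
    by (simp add: bij_betw_same_card)
  then show ?case using Cons.IH[OF E] Cons.prems(2) by (simp add: card_cartesian_product)
qed

definition oriented_maps ::
    "'d set \<Rightarrow> 'd set set \<Rightarrow> ('d \<Rightarrow> 'v) \<Rightarrow> ('d \<Rightarrow> 'w) \<Rightarrow> ('d set set \<times> 'd set set \<times> 'd set) set" where
  "oriented_maps D E b w =
     {(P, Q, B). corners_at D E b P \<and> corners_at D E w Q \<and>
        B \<subseteq> D \<and> balanced B E \<and> balanced B P \<and> balanced B Q}"

text \<open>Choosing \<open>B\<close> first makes the black and the white corners independent,
  unlike in good maps, where the face condition couples them.\<close>

theorem card_oriented_maps: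
  assumes D: "finite D" and E: "pair_partition D (set es)" "distinct es"
    and const: "\<And>p s t. p \<in> set es \<Longrightarrow> s \<in> p \<Longrightarrow> t \<in> p \<Longrightarrow> b s = b t \<and> w s = w t"
  shows "card (oriented_maps D (set es) b w) = 2 ^ length es * ribbon_choices b es * ribbon_choices w es"
proof -
  let ?N = "{B. B \<subseteq> D \<and> balanced B (set es)}"
  let ?A = "\<lambda>B. {P. corners_at D (set es) b P \<and> balanced B P}"
  let ?C = "\<lambda>B. {P. corners_at D (set es) w P \<and> balanced B P}"
  let ?f = "\<lambda>(B, P, Q). (P, Q, B)"
  have "oriented_maps D (set es) b w = ?f ` (SIGMA B:?N. ?A B \<times> ?C B)"
  proof (intro equalityI subsetI)
    fix M assume M: "M \<in> oriented_maps D (set es) b w"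
    obtain P Q B where [simp]: "M = (P, Q, B)" by (metis surj_pair)
    have "?f (B, P, Q) \<in> ?f ` (SIGMA B:?N. ?A B \<times> ?C B)"
      by (rule imageI) (use M in \<open>simp add: oriented_maps_def\<close>)
    then show "M \<in> ?f ` (SIGMA B:?N. ?A B \<times> ?C B)" by simp
  qed (auto simp: oriented_maps_def)
  moreover have "inj_on ?f (SIGMA B:?N. ?A B \<times> ?C B)" by (auto simp: inj_on_def)
  ultimately have "card (oriented_maps D (set es) b w) = card (SIGMA B:?N. ?A B \<times> ?C B)"
    by (simp add: card_image)
  also have "\<dots> = (\<Sum>B \<in> ?N. card (?A B \<times> ?C B))"
  proof (rule card_SigmaI)
    show "\<forall>B \<in> ?N. finite (?A B \<times> ?C B)"
    proof (intro ballI finite_cartesian_product)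
      fix B
      show "finite (?A B)" "finite (?C B)"
        by (rule finite_subset[OF _ finite_pair_partitions[OF D]]; simp add: corners_at_def Collect_mono)+
    qed
  qed (use D in simp)
  also have "\<dots> = (\<Sum>B \<in> ?N. ribbon_choices b es * ribbon_choices w es)"
  proof (rule sum.cong[OF refl])
    fix B assume B: "B \<in> ?N"
    have "card (?A B) = ribbon_choices b es" "card (?C B) = ribbon_choices w es"
      by (rule card_balanced_corners[OF D E]; use B const in blast)+
    then show "card (?A B \<times> ?C B) = ribbon_choices b es * ribbon_choices w es"
      by (simp add: card_cartesian_product)
  qed
  also have "\<dots> = 2 ^ length es * ribbon_choices b es * ribbon_choices w es"
    using card_balanced_sets[OF E] by simp
  finally show ?thesis .
qed

section \<open>The average over all removal orders\<close>

lemma bicolored_map_remove_edge: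
  assumes M: "bicolored_map M" and e: "e \<in> edges M"
  shows "bicolored_map (remove_edge e M)"
proof -
  let ?D = "sides M - e"
  have E: "pair_partition (sides M) (edges M)" using M by (simp add: bicolored_map_def)
  obtain x y where xy: "e = {x, y}" "x \<noteq> y"
    using E e by (auto simp: pair_partition_def card_2_iff)
  have D: "sides M = insert x (insert y ?D)" using pair_partition_mem[OF E e] xy by auto
  have "pair_partition ?D (merge_corners e P)" if P: "pair_partition (sides M) P" for P
  proof -
    have "pair_partition (insert x (insert y ?D)) P" using P D by simp
    then show ?thesis using add_ribbon_surj[of x y ?D P] xy by blast
  qed
  then show ?thesis
    using M e pair_partition_remove[OF E e] by (auto simp: bicolored_map_def remove_edge_def)
qed

text \<open>Coarsening maps classes onto classes; between finite sets of equal size it is injective,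
  so nothing was merged.\<close>

lemma glued_eq_of_card_quotient:
  assumes D: "finite D" and sub: "P \<subseteq> R" and eq: "card (D // glued P) = card (D // glued R)"
    and st: "(s, t) \<in> glued R" "s \<in> D" "t \<in> D"
  shows "(s, t) \<in> glued P"
proof -
  have mono: "glued P \<subseteq> glued R" by (rule glued_mono[OF sub])
  have h: "glued R `` (glued P `` {i}) = glued R `` {i}" for i
  proof (intro equalityI subsetI)
    fix j assume "j \<in> glued R `` (glued P `` {i})"
    then obtain k where "(i, k) \<in> glued R" "(k, j) \<in> glued R" using mono by auto
    then show "j \<in> glued R `` {i}" using glued_trans by (simp add: glued_trans[of i k])
  qed (use glued_refl[of i P] in blast)
  have "(``) (glued R) ` (D // glued P) = D // glued R"
    using h by (auto simp: quotient_def image_iff)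
  moreover have "finite (D // glued P)" using D by (simp add: quotient_def)
  ultimately have inj: "inj_on ((``) (glued R)) (D // glued P)"
    using eq by (intro eq_card_imp_inj_on) auto
  have "glued P `` {s} = glued P `` {t}"
    by (rule inj_onD[OF inj])
      (use h glued_class_eq[OF st(1)] st(2,3) in \<open>auto intro: quotientI\<close>)
  then show ?thesis using glued_sym[of t s P] by (metis Image_singleton_iff glued_refl)
qed

text \<open>Components arise from faces by gluing along edges as well, so equal numbers of classes
  force the two relations to agree on the edge-sides.\<close>

lemma card_faces_eq_card_components_iff:
  assumes M: "bicolored_map M"
  shows "card (faces M) = card (components M) \<longleftrightarrow>
    (\<forall>p \<in> edges M. p \<times> p \<subseteq> glued (black_corners M \<union> white_corners M))"
proof
  assume eq: "card (faces M) = card (components M)"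
  show "\<forall>p \<in> edges M. p \<times> p \<subseteq> glued (black_corners M \<union> white_corners M)"
  proof clarify
    fix p s t assume p: "p \<in> edges M" "s \<in> p" "t \<in> p"
    let ?R = "edges M \<union> black_corners M \<union> white_corners M"
    have E: "pair_partition (sides M) (edges M)" using M by (simp add: bicolored_map_def)
    show "(s, t) \<in> glued (black_corners M \<union> white_corners M)"
    proof (rule glued_eq_of_card_quotient)
      show "(s, t) \<in> glued ?R" by (rule glued_pair[of p]) (use p in auto)
      show "s \<in> sides M" "t \<in> sides M" using pair_partition_mem[OF E] p by auto
    qed (use M eq in \<open>auto simp: bicolored_map_def faces_def components_def\<close>)
  qed
next
  assume "\<forall>p \<in> edges M. p \<times> p \<subseteq> glued (black_corners M \<union> white_corners M)"
  then have "glued (edges M \<union> black_corners M \<union> white_corners M) \<subseteq>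
      glued (black_corners M \<union> white_corners M)"
    by (intro glued_subI) (auto intro: glued_pair[of _ "black_corners M \<union> white_corners M"])
  moreover have "glued (black_corners M \<union> white_corners M) \<subseteq>
      glued (edges M \<union> black_corners M \<union> white_corners M)"
    by (rule glued_mono) auto
  ultimately show "card (faces M) = card (components M)"
    by (simp add: faces_def components_def equalityI)
qed

lemma good_removal_iff:
  assumes "bicolored_map M" "set es = edges M" "distinct es"
  shows "(\<forall>k \<le> length es. let N = fold remove_edge (take k es) M in card (faces N) = card (components N))
    \<longleftrightarrow> good_removal es (black_corners M) (white_corners M)"
  using assms
proof (induction es arbitrary: M)
  case Nil
  \<comment> \<open>The stage after the last removal is the empty map, with no faces and no
    components, so \<open>good_removal\<close> demands nothing there.\<close>
  then have "sides M = {}" by (auto simp: bicolored_map_def)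
  then show ?case by (simp add: faces_def components_def)
next
  case (Cons e es)
  let ?N = "remove_edge e M"
  let ?F = "\<lambda>N. card (faces N) = card (components N)"
  have N: "bicolored_map ?N" using bicolored_map_remove_edge[OF Cons.prems(1)] Cons.prems(2) by auto
  have edges: "set es = edges ?N" using Cons.prems(2,3) by (auto simp: remove_edge_def)
  have "(\<forall>k \<le> length (e # es). let N = fold remove_edge (take k (e # es)) M in ?F N) \<longleftrightarrow>
      ?F M \<and> (\<forall>k \<le> length es. let N = fold remove_edge (take k es) ?N in ?F N)"
    (is "?L \<longleftrightarrow> ?R")
  proof
    assume L: ?L
    have "let N = fold remove_edge (take k es) ?N in ?F N" if "k \<le> length es" for k
      using L[rule_format, of "Suc k"] that by simp
    then show ?R using L[rule_format, of 0] by simp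
  next
    assume R: ?R
    show ?L
    proof (intro allI impI)
      fix k assume "k \<le> length (e # es)"
      then show "let N = fold remove_edge (take k (e # es)) M in ?F N"
        using R by (cases k) auto
    qed
  qed
  also have "\<dots> \<longleftrightarrow> ?F M \<and> good_removal es (black_corners ?N) (white_corners ?N)"
    using Cons.IH[OF N edges] Cons.prems(3) by simp
  also have "\<dots> \<longleftrightarrow> good_removal (e # es) (black_corners M) (white_corners M)"
    using card_faces_eq_card_components_iff[OF Cons.prems(1)] Cons.prems(2)
    by (simp add: remove_edge_def)
  finally show ?case .
qed

lemma finite_edges: "bicolored_map M \<Longrightarrow> finite (edges M)"
  by (auto simp: bicolored_map_def intro: finite_pair_partition)

lemma mon_top_eq:
  assumes M: "bicolored_map M"
  shows "mon_top M =
    card {es \<in> permutations_of_set (edges M). good_removal es (black_corners M) (white_corners M)} /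
    fact (card (edges M))"
proof -
  have fin: "finite (edges M)" using finite_edges[OF M] .
  let ?Q = "\<lambda>es. \<forall>k \<le> length es. let N = fold remove_edge (take k es) M in card (faces N) = card (components N)"
  have "permutations_of_set (edges M) \<inter> {es. ?Q es} =
      {es \<in> permutations_of_set (edges M). good_removal es (black_corners M) (white_corners M)}"
    using good_removal_iff[OF M] by (auto simp: permutations_of_set_def)
  then show ?thesis
    unfolding mon_top_def using fin by (simp add: measure_pmf_of_set)
qed

lemma mon_top_zero:
  assumes M: "bicolored_map M" and "card (faces M) \<noteq> card (components M)"
  shows "mon_top M = 0"
proof -
  have "edges M \<noteq> {}"
    using assms by (auto simp: bicolored_map_def faces_def components_def)
  have "\<not> good_removal es (black_corners M) (white_corners M)" if "es \<in> permutations_of_set (edges M)" for es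
    using good_removal_glued[of es "black_corners M" "white_corners M"] that
      card_faces_eq_card_components_iff[OF M] assms(2)
    unfolding permutations_of_set_def by blast
  then have "{es \<in> permutations_of_set (edges M). good_removal es (black_corners M) (white_corners M)} = {}"
    by blast
  then show ?thesis unfolding mon_top_eq[OF M] by simp
qed

section \<open>Maps sharing one underlying graph\<close>

lemma orientation_iff:
  "orientation M B \<longleftrightarrow> B \<subseteq> sides M \<and> balanced B (edges M) \<and> balanced B (black_corners M) \<and>
     balanced B (white_corners M)"
  by (auto simp: orientation_def balanced_def)

text \<open>Labeling each side by its vertex in a reference map turns the condition on labels into
  equality of vertex relations. Off \<open>D\<close> both relations are the identity, which extends
  the agreement to the whole type.\<close>

lemma corners_at_glued_iff:
  assumes E: "pair_partition D E" and P\<^sub>0: "pair_partition D P\<^sub>0" and P: "pair_partition D P"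
  shows "corners_at D E (\<lambda>s. glued (E \<union> P\<^sub>0) `` {s}) P \<longleftrightarrow> glued (E \<union> P) = glued (E \<union> P\<^sub>0)"
proof -
  let ?G = "glued (E \<union> P)" and ?H = "glued (E \<union> P\<^sub>0)"
  have cls: "?H `` {s} = ?H `` {t} \<longleftrightarrow> (s, t) \<in> ?H" for s t
    using glued_class_eq[of s t] glued_sym[of t s] by (metis Image_singleton_iff glued_refl)
  have cor: "corners_at D E (\<lambda>s. ?H `` {s}) P \<longleftrightarrow> (\<forall>s \<in> D. \<forall>t \<in> D. (s, t) \<in> ?G \<longleftrightarrow> (s, t) \<in> ?H)"
    using P cls by (simp add: corners_at_def)
  have inside: "t \<in> D" if "(s, t) \<in> glued (E \<union> R)" "s \<in> D" "pair_partition D R" for s t R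
    using glued_subset[of "E \<union> R" D s] that pair_partition_Pow[OF E] pair_partition_Pow[OF that(3)]
    by auto
  have outside: "t = s" if "(s, t) \<in> glued (E \<union> R)" "s \<notin> D" "pair_partition D R" for s t R
    using glued_outside[OF that(1)] that(2) pair_partition_mem[OF E] pair_partition_mem[OF that(3)]
    by blast
  show ?thesis
    unfolding cor
  proof
    assume L: "\<forall>s \<in> D. \<forall>t \<in> D. (s, t) \<in> ?G \<longleftrightarrow> (s, t) \<in> ?H"
    have "(s, t) \<in> ?G \<longleftrightarrow> (s, t) \<in> ?H" for s t
    proof (cases "s \<in> D")
      case True
      then show ?thesis using L inside[OF _ True P, of t] inside[OF _ True P\<^sub>0, of t] by blast
    next
      case False
      then show ?thesis using outside[OF _ False P, of t] outside[OF _ False P\<^sub>0, of t] by auto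
    qed
    then show "?G = ?H" by auto
  qed simp
qed

definition same_graph_corners :: "'d bimap \<Rightarrow> ('d set set \<times> 'd set set) set" where
  "same_graph_corners M =
     {(P, Q). corners_at (sides M) (edges M) (\<lambda>s. glued (edges M \<union> black_corners M) `` {s}) P \<and>
        corners_at (sides M) (edges M) (\<lambda>s. glued (edges M \<union> white_corners M) `` {s}) Q}"

lemma same_graph_corners_iff:
  assumes "bicolored_map M"
  shows "(P, Q) \<in> same_graph_corners M \<longleftrightarrow>
    pair_partition (sides M) P \<and> pair_partition (sides M) Q \<and>
    glued (edges M \<union> P) = glued (edges M \<union> black_corners M) \<and>
    glued (edges M \<union> Q) = glued (edges M \<union> white_corners M)"
proof -
  have pp: "pair_partition (sides M) (edges M)" "pair_partition (sides M) (black_corners M)"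
    "pair_partition (sides M) (white_corners M)" using assms by (auto simp: bicolored_map_def)
  show ?thesis
  proof (cases "pair_partition (sides M) P \<and> pair_partition (sides M) Q")
    case True
    then show ?thesis
      unfolding same_graph_corners_def
      by (simp only: mem_Collect_eq case_prod_conv corners_at_glued_iff[OF pp(1,2)]
          corners_at_glued_iff[OF pp(1,3)] simp_thms)
  next
    case False
    then show ?thesis by (simp add: same_graph_corners_def corners_at_def) blast
  qed
qed

lemma glued_of_card_quotient_1:
  assumes "card (D // glued P) = 1" "s \<in> D" "t \<in> D"
  shows "(s, t) \<in> glued P"
proof -
  obtain X where "D // glued P = {X}" using assms(1) by (auto simp: card_1_singleton_iff)
  then have "glued P `` {s} = glued P `` {t}"
    using quotientI[OF assms(2), of "glued P"] quotientI[OF assms(3), of "glued P"] by simp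
  then show ?thesis by (metis Image_singleton_iff glued_refl)
qed

text \<open>A set saturated for black and white vertices is saturated for components, so
  connectedness leaves only the empty and the full set.\<close>

lemma card_component_unions_connected:
  assumes M: "bicolored_map M" and c: "card (components M) = 1"
  shows "card (component_unions (sides M) (\<lambda>s. glued (edges M \<union> black_corners M) `` {s})
    (\<lambda>s. glued (edges M \<union> white_corners M) `` {s})) = 2" (is "card (component_unions ?D ?b ?w) = 2")
proof -
  let ?R = "edges M \<union> black_corners M \<union> white_corners M"
  have conn: "(s, t) \<in> glued ?R" if "s \<in> ?D" "t \<in> ?D" for s t
    using glued_of_card_quotient_1[of ?D ?R] c that by (simp add: components_def)
  have ne: "?D \<noteq> {}" using c by (auto simp: components_def)
  have "S = {} \<or> S = ?D" if S: "S \<in> component_unions ?D ?b ?w" for S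
  proof (rule disjCI)
    assume "S \<noteq> ?D"
    moreover have SD: "S \<subseteq> ?D" using S unfolding component_unions_def by blast
    ultimately obtain t where t: "t \<in> ?D" "t \<notin> S" by blast
    show "S = {}"
    proof (rule ccontr)
      assume "S \<noteq> {}"
      then obtain s where s: "s \<in> S" "s \<in> ?D" using SD by blast
      have "t \<in> S"
        using conn[OF s(2) t(1)] s(1)
      proof (rule glued_closed)
        fix p i j assume p: "p \<in> ?R" "i \<in> p" "j \<in> p" "i \<in> S"
        have D: "i \<in> ?D" "j \<in> ?D"
          using p M pair_partition_mem[of ?D] by (auto simp: bicolored_map_def)
        have "(i, j) \<in> glued (edges M \<union> black_corners M) \<or> (i, j) \<in> glued (edges M \<union> white_corners M)"
          using p glued_pair[of p "edges M \<union> black_corners M" i j]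
            glued_pair[of p "edges M \<union> white_corners M" i j] by auto
        then have "?b i = ?b j \<or> ?w i = ?w j" using glued_class_eq by metis
        then show "j \<in> S" using S D p(4) unfolding component_unions_def by blast
      qed
      then show False using t by simp
    qed
  qed
  moreover have "{} \<in> component_unions ?D ?b ?w" "?D \<in> component_unions ?D ?b ?w"
    by (auto simp: component_unions_def)
  ultimately have "component_unions ?D ?b ?w = {{}, ?D}" by blast
  then show ?thesis using ne by simp
qed

theorem sum_same_graph:
  assumes M: "bicolored_map M" and c: "card (components M) = 1"
  shows "(\<Sum>(P, Q) \<in> same_graph_corners M.
      real (card {B. orientation (M\<lparr>black_corners := P, white_corners := Q\<rparr>) B})) =
    2 * (\<Sum>(P, Q) \<in> same_graph_corners M. mon_top (M\<lparr>black_corners := P, white_corners := Q\<rparr>))"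
proof -
  let ?D = "sides M" and ?E = "edges M"
  let ?b = "\<lambda>s. glued (edges M \<union> black_corners M) `` {s}"
  let ?w = "\<lambda>s. glued (edges M \<union> white_corners M) `` {s}"
  let ?F = "same_graph_corners M"
  let ?M = "\<lambda>P Q. M\<lparr>black_corners := P, white_corners := Q\<rparr>"
  have pp: "finite ?D" "pair_partition ?D ?E" using M by (auto simp: bicolored_map_def)
  have finF: "finite ?F"
    by (rule finite_subset[of _ "{P. pair_partition ?D P} \<times> {P. pair_partition ?D P}"])
      (use finite_pair_partitions[OF pp(1)] in \<open>auto simp: same_graph_corners_def corners_at_def\<close>)
  have const: "?b s = ?b t \<and> ?w s = ?w t" if "p \<in> ?E" "s \<in> p" "t \<in> p" for p s t
    using glued_class_eq[OF glued_pair[of p "?E \<union> black_corners M" s t]]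
      glued_class_eq[OF glued_pair[of p "?E \<union> white_corners M" s t]] that by simp
  \<comment> \<open>The two unions of components of a connected graph supply the factor 2, for every
    order alike.\<close>
  have order: "2 * card (good_maps ?D es ?b ?w) = card (oriented_maps ?D ?E ?b ?w)"
    if "es \<in> permutations_of_set ?E" for es
  proof -
    have es: "set es = ?E" "distinct es" using that by (auto simp: permutations_of_set_def)
    have E: "pair_partition ?D (set es)" using pp es by simp
    have k: "\<And>p s t. p \<in> set es \<Longrightarrow> s \<in> p \<Longrightarrow> t \<in> p \<Longrightarrow> ?b s = ?b t \<and> ?w s = ?w t"
      unfolding es(1) by (rule const)
    have "card (good_maps ?D es ?b ?w) * card (component_unions ?D ?b ?w) =
        2 ^ length es * ribbon_choices ?b es * ribbon_choices ?w es"
      by (rule card_good_maps[OF pp(1) E es(2)]) (rule k)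
    moreover have "card (oriented_maps ?D (set es) ?b ?w) =
        2 ^ length es * ribbon_choices ?b es * ribbon_choices ?w es"
      by (rule card_oriented_maps[OF pp(1) E es(2)]) (rule k)
    ultimately have "card (good_maps ?D es ?b ?w) * card (component_unions ?D ?b ?w) =
        card (oriented_maps ?D (set es) ?b ?w)" by simp
    then show ?thesis unfolding card_component_unions_connected[OF M c] es(1) by simp
  qed
  let ?A = "permutations_of_set ?E"
  have finE: "finite ?E" using finite_edges[OF M] .
  then have cardA: "card ?A = fact (card ?E)" by simp
  have mon: "mon_top (?M P Q) = card {es \<in> ?A. good_removal es P Q} / fact (card ?E)"
    if "(P, Q) \<in> ?F" for P Q
  proof -
    have "bicolored_map (?M P Q)" using that M same_graph_corners_iff[OF M] by (simp add: bicolored_map_def)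
    then show ?thesis by (simp add: mon_top_eq)
  qed
  \<comment> \<open>Double counting of the pairs of a gluing and a removal order good for
    it.\<close>
  have "(\<Sum>(P, Q) \<in> ?F. card {es \<in> ?A. good_removal es P Q}) =
      (\<Sum>M \<in> ?F. \<Sum>es \<in> ?A. if good_removal es (fst M) (snd M) then 1 else 0)"
    by (intro sum.cong) (auto simp: sum.If_cases Int_def)
  also have "\<dots> = (\<Sum>es \<in> ?A. \<Sum>M \<in> ?F. if good_removal es (fst M) (snd M) then 1 else 0)"
    by (rule sum.swap)
  also have "\<dots> = (\<Sum>es \<in> ?A. card (good_maps ?D es ?b ?w))"
  proof (rule sum.cong[OF refl])
    fix es assume "es \<in> ?A"
    then have "?F \<inter> {M. good_removal es (fst M) (snd M)} = good_maps ?D es ?b ?w"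
      by (auto simp: same_graph_corners_def good_maps_def permutations_of_set_def)
    then show "(\<Sum>M \<in> ?F. if good_removal es (fst M) (snd M) then 1 else 0) = card (good_maps ?D es ?b ?w)"
      using finF by (simp add: sum.If_cases)
  qed
  finally have "2 * (\<Sum>(P, Q) \<in> ?F. card {es \<in> ?A. good_removal es P Q}) =
      (\<Sum>es \<in> ?A. 2 * card (good_maps ?D es ?b ?w))" by (simp add: sum_distrib_left)
  also have "\<dots> = fact (card ?E) * card (oriented_maps ?D ?E ?b ?w)"
    using order cardA by simp
  finally have "2 * (\<Sum>(P, Q) \<in> ?F. card {es \<in> ?A. good_removal es P Q}) =
      fact (card ?E) * card (oriented_maps ?D ?E ?b ?w)" .
  then have 1: "2 * (\<Sum>(P, Q) \<in> ?F. real (card {es \<in> ?A. good_removal es P Q})) =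
      fact (card ?E) * real (card (oriented_maps ?D ?E ?b ?w))"
  proof -
    assume "2 * (\<Sum>(P, Q) \<in> ?F. card {es \<in> ?A. good_removal es P Q}) =
      fact (card ?E) * card (oriented_maps ?D ?E ?b ?w)"
    from arg_cong[OF this, of real] show ?thesis
      unfolding of_nat_mult of_nat_sum of_nat_fact of_nat_numeral case_prod_unfold .
  qed
  have "(\<Sum>(P, Q) \<in> ?F. mon_top (?M P Q)) =
      (\<Sum>(P, Q) \<in> ?F. card {es \<in> ?A. good_removal es P Q} / fact (card ?E))"
    by (rule sum.cong[OF refl]) (use mon in auto)
  also have "\<dots> = (\<Sum>(P, Q) \<in> ?F. real (card {es \<in> ?A. good_removal es P Q})) / fact (card ?E)"
    by (simp add: sum_divide_distrib case_prod_unfold)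
  finally have "2 * (\<Sum>(P, Q) \<in> ?F. mon_top (?M P Q)) =
      2 * (\<Sum>(P, Q) \<in> ?F. real (card {es \<in> ?A. good_removal es P Q})) / fact (card ?E)"
    by simp
  then have 2: "2 * (\<Sum>(P, Q) \<in> ?F. mon_top (?M P Q)) = card (oriented_maps ?D ?E ?b ?w)"
    unfolding 1 by simp
  let ?O = "\<lambda>(P, Q). {B. orientation (?M P Q) B}"
  have "(\<Sum>M \<in> ?F. card (?O M)) = card (Sigma ?F ?O)"
    using finF pp(1) by (intro card_SigmaI[symmetric])
      (auto intro: finite_subset[of _ "Pow ?D"] simp: orientation_def)
  also have "\<dots> = card (oriented_maps ?D ?E ?b ?w)"
  proof (rule bij_betw_same_card)
    show "bij_betw (\<lambda>((P, Q), B). (P, Q, B)) (Sigma ?F ?O) (oriented_maps ?D ?E ?b ?w)"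
      by (rule bij_betw_byWitness[where f' = "\<lambda>(P, Q, B). ((P, Q), B)"])
        (auto simp: oriented_maps_def same_graph_corners_def orientation_iff)
  qed
  finally show ?thesis using 2 by (simp add: case_prod_unfold flip: of_nat_sum)
qed

section \<open>Relabeling\<close>

lemma glued_image_iff:
  assumes inj: "inj_on \<phi> D" and P: "P \<subseteq> Pow D" and st: "s \<in> D" "t \<in> D"
  shows "(\<phi> s, \<phi> t) \<in> glued ((`) \<phi> ` P) \<longleftrightarrow> (s, t) \<in> glued P"
proof -
  have "(\<phi> s, \<phi> t) \<in> glued ((`) \<phi> ` P) \<longleftrightarrow> \<phi> t \<in> \<phi> ` (glued P `` {s})"
    using glued_image[OF inj P st(1)] by blast
  also have "\<dots> \<longleftrightarrow> t \<in> glued P `` {s}"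
    by (rule inj_on_image_mem_iff[OF inj st(2) glued_subset[OF P st(1)]])
  finally show ?thesis by simp
qed

lemma merge_corners_subset: "P \<subseteq> Pow D \<Longrightarrow> merge_corners e P \<subseteq> Pow D"
  by (auto simp: merge_corners_def)

lemma merge_corners_image:
  assumes inj: "inj_on \<phi> D" and e: "e \<subseteq> D" and P: "P \<subseteq> Pow D"
  shows "merge_corners (\<phi> ` e) ((`) \<phi> ` P) = (`) \<phi> ` merge_corners e P"
proof -
  have disj: "\<phi> ` p \<inter> \<phi> ` e = {} \<longleftrightarrow> p \<inter> e = {}" if "p \<in> P" for p
  proof -
    have "p \<subseteq> D" using that P by auto
    then have "\<phi> ` p \<inter> \<phi> ` e = \<phi> ` (p \<inter> e)" using inj_on_image_Int[OF inj _ e] by simp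
    then show ?thesis by simp
  qed
  let ?U = "\<Union>{p \<in> P. p \<inter> e \<noteq> {}}"
  have "{q \<in> (`) \<phi> ` P. q \<inter> \<phi> ` e = {}} = (`) \<phi> ` {p \<in> P. p \<inter> e = {}}"
    using disj by auto
  moreover have "{q \<in> (`) \<phi> ` P. q \<inter> \<phi> ` e \<noteq> {}} = (`) \<phi> ` {p \<in> P. p \<inter> e \<noteq> {}}"
    using disj by auto
  then have "\<Union>{q \<in> (`) \<phi> ` P. q \<inter> \<phi> ` e \<noteq> {}} = \<phi> ` ?U" by (simp add: image_Union)
  moreover have "\<phi> ` ?U - \<phi> ` e = \<phi> ` (?U - e)"
    by (rule inj_on_image_set_diff[OF inj, symmetric]) (use P e in auto)
  moreover have "{\<phi> ` (?U - e)} - {{}} = (`) \<phi> ` ({?U - e} - {{}})" by (cases "?U - e = {}") simp_all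
  ultimately show ?thesis unfolding merge_corners_def image_Un by simp
qed

lemma good_removal_image:
  assumes inj: "inj_on \<phi> D" and "set es \<subseteq> Pow D" "P \<subseteq> Pow D" "Q \<subseteq> Pow D"
  shows "good_removal (map ((`) \<phi>) es) ((`) \<phi> ` P) ((`) \<phi> ` Q) \<longleftrightarrow> good_removal es P Q"
  using assms(2-4)
proof (induction es arbitrary: P Q)
  case (Cons e es)
  have PQ: "P \<union> Q \<subseteq> Pow D" using Cons.prems by auto
  have pair: "\<phi> ` p \<times> \<phi> ` p \<subseteq> glued ((`) \<phi> ` (P \<union> Q)) \<longleftrightarrow> p \<times> p \<subseteq> glued (P \<union> Q)"
    if p: "p \<in> insert e (set es)" for p
  proof -
    have "p \<subseteq> D" using p Cons.prems(1) by auto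
    then have "(\<phi> s, \<phi> t) \<in> glued ((`) \<phi> ` (P \<union> Q)) \<longleftrightarrow> (s, t) \<in> glued (P \<union> Q)"
      if "s \<in> p" "t \<in> p" for s t
      using glued_image_iff[OF inj PQ] that by blast
    then show ?thesis by (auto simp: subset_iff)
  qed
  have e: "e \<subseteq> D" "set es \<subseteq> Pow D" using Cons.prems(1) by auto
  have "good_removal (map ((`) \<phi>) (e # es)) ((`) \<phi> ` P) ((`) \<phi> ` Q) \<longleftrightarrow>
      (\<forall>p \<in> insert e (set es). \<phi> ` p \<times> \<phi> ` p \<subseteq> glued ((`) \<phi> ` (P \<union> Q))) \<and>
      good_removal (map ((`) \<phi>) es) ((`) \<phi> ` merge_corners e P) ((`) \<phi> ` merge_corners e Q)"
    using merge_corners_image[OF inj e(1)] Cons.prems by (simp add: image_Un)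
  also have "\<dots> \<longleftrightarrow> good_removal (e # es) P Q"
    using pair Cons.IH[OF e(2) merge_corners_subset[OF Cons.prems(2)]
        merge_corners_subset[OF Cons.prems(3)], of e e] by simp
  finally show ?case .
qed simp

lemma bicolored_map_sub:
  assumes "bicolored_map M"
  shows "edges M \<subseteq> Pow (sides M)" "black_corners M \<subseteq> Pow (sides M)" "white_corners M \<subseteq> Pow (sides M)"
  using assms by (auto simp: bicolored_map_def dest!: pair_partition_Pow)

lemma bimap_iso_imp_image_map:
  assumes "bimap_iso \<phi> M N"
  shows "N = image_map \<phi> M" "inj_on \<phi> (sides M)"
  using assms by (cases N; auto simp: bimap_iso_def image_map_def bij_betw_def)+

lemma mon_top_iso:
  assumes M: "bicolored_map M" and iso: "bimap_iso \<phi> M N"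
  shows "mon_top N = mon_top M"
proof -
  note N = bimap_iso_imp_image_map(1)[OF iso] and inj = bimap_iso_imp_image_map(2)[OF iso]
  note sub = bicolored_map_sub[OF M]
  note t = image_map_transfer[OF M inj]
  have injE: "inj_on ((`) \<phi>) (edges M)"
    using inj_on_subset[OF inj_on_image_Pow[OF inj] sub(1)] .
  let ?A = "{es \<in> permutations_of_set (edges M). good_removal es (black_corners M) (white_corners M)}"
  have good: "good_removal (map ((`) \<phi>) es) ((`) \<phi> ` black_corners M) ((`) \<phi> ` white_corners M) \<longleftrightarrow>
      good_removal es (black_corners M) (white_corners M)" if "es \<in> permutations_of_set (edges M)" for es
    using that sub by (intro good_removal_image[OF inj]) (auto simp: permutations_of_set_def)
  have "{es \<in> permutations_of_set ((`) \<phi> ` edges M).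
        good_removal es ((`) \<phi> ` black_corners M) ((`) \<phi> ` white_corners M)} = map ((`) \<phi>) ` ?A"
    unfolding permutations_of_set_image_inj[OF injE] using good by blast
  moreover have "inj_on (map ((`) \<phi>)) ?A"
  proof (rule inj_onI)
    fix xs ys assume "xs \<in> ?A" "ys \<in> ?A" "map ((`) \<phi>) xs = map ((`) \<phi>) ys"
    then show "xs = ys"
      using injE by (intro map_inj_on[of "(`) \<phi>" xs ys]) (auto simp: permutations_of_set_def)
  qed
  ultimately show ?thesis
    unfolding mon_top_eq[OF M] N mon_top_eq[OF t(2)] t(3)
    by (simp add: image_map_def card_image)
qed

section \<open>Isomorphisms of underlying graphs\<close>

lemma bigraph_iso_trans:
  assumes "bigraph_iso G H" "bigraph_iso H K"
  shows "bigraph_iso G K"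
proof -
  obtain f g h where 1: "bij_betw f (black_verts G) (black_verts H)" "bij_betw g (white_verts G) (white_verts H)"
    "bij_betw h (graph_edges G) (graph_edges H)"
    "\<forall>e \<in> graph_edges G. black_end H (h e) = f (black_end G e) \<and> white_end H (h e) = g (white_end G e)"
    using assms(1) unfolding bigraph_iso_def by blast
  obtain f' g' h' where 2: "bij_betw f' (black_verts H) (black_verts K)" "bij_betw g' (white_verts H) (white_verts K)"
    "bij_betw h' (graph_edges H) (graph_edges K)"
    "\<forall>e \<in> graph_edges H. black_end K (h' e) = f' (black_end H e) \<and> white_end K (h' e) = g' (white_end H e)"
    using assms(2) unfolding bigraph_iso_def by blast
  have "h e \<in> graph_edges H" if "e \<in> graph_edges G" for e
    using 1(3) that by (auto simp: bij_betw_def)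
  then have "\<forall>e \<in> graph_edges G. black_end K ((h' \<circ> h) e) = (f' \<circ> f) (black_end G e) \<and>
      white_end K ((h' \<circ> h) e) = (g' \<circ> g) (white_end G e)"
    using 1(4) 2(4) by simp
  then show ?thesis
    unfolding bigraph_iso_def
    using bij_betw_trans[OF 1(1) 2(1)] bij_betw_trans[OF 1(2) 2(2)] bij_betw_trans[OF 1(3) 2(3)] by blast
qed

lemma underlying_graph_iso:
  assumes M: "bicolored_map M" and iso: "bimap_iso \<phi> M N"
  shows "bigraph_iso (underlying_graph M) (underlying_graph N)"
proof -
  note N = bimap_iso_imp_image_map(1)[OF iso] and inj = bimap_iso_imp_image_map(2)[OF iso]
  note sub = bicolored_map_sub[OF M]
  have verts: "bij_betw ((`) \<phi>) (sides M // glued P) ((\<phi> ` sides M) // glued ((`) \<phi> ` P))"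
    if P: "P \<subseteq> Pow (sides M)" for P
  proof -
    have "(\<phi> ` sides M) // glued ((`) \<phi> ` P) = (`) \<phi> ` (sides M // glued P)"
      using glued_image[OF inj P] by (auto simp: quotient_def)
    moreover have "sides M // glued P \<subseteq> Pow (sides M)"
      using glued_subset[OF P] by (auto simp: quotient_def)
    then have "inj_on ((`) \<phi>) (sides M // glued P)"
      using inj by (meson inj_on_image_Pow inj_on_subset)
    ultimately show ?thesis by (simp add: bij_betw_def)
  qed
  have ends: "glued ((`) \<phi> ` P) `` (\<phi> ` e) = \<phi> ` (glued P `` e)"
    if P: "P \<subseteq> Pow (sides M)" and e: "e \<in> edges M" for P e
  proof -
    have "glued ((`) \<phi> ` P) `` (\<phi> ` e) = (\<Union>s \<in> e. glued ((`) \<phi> ` P) `` {\<phi> s})" by auto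
    also have "\<dots> = (\<Union>s \<in> e. \<phi> ` (glued P `` {s}))"
      by (rule SUP_cong[OF refl], rule glued_image[OF inj P]) (use e sub in auto)
    also have "\<dots> = \<phi> ` (glued P `` e)" by auto
    finally show ?thesis .
  qed
  have bw: "edges M \<union> black_corners M \<subseteq> Pow (sides M)" "edges M \<union> white_corners M \<subseteq> Pow (sides M)"
    using sub by auto
  have "bij_betw ((`) \<phi>) (edges M) ((`) \<phi> ` edges M)"
    using inj_on_subset[OF inj_on_image_Pow[OF inj] sub(1)] by (simp add: bij_betw_def)
  then show ?thesis
    unfolding bigraph_iso_def N
    using verts[OF bw(1)] verts[OF bw(2)] ends[OF bw(1)] ends[OF bw(2)]
    \<comment> \<open>Vertices and edges are all sets of edge-sides, so taking images under
      \<open>\<phi>\<close> serves as all three bijections.\<close>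
    by (intro exI[of _ "(`) \<phi>"])
      (simp add: underlying_graph_def image_map_def black_vertices_def white_vertices_def image_Un)
qed

text \<open>The classes index the formal sums, so they have to be equal as sets; this takes the
  graph isomorphism in both directions.\<close>

lemma bigraph_class_iso:
  assumes M: "bicolored_map M" and iso: "bimap_iso \<phi> M N"
  shows "bigraph_class (underlying_graph N) = bigraph_class (underlying_graph M)"
proof -
  have N: "bicolored_map N"
    using image_map_transfer(2)[OF M bimap_iso_imp_image_map(2)[OF iso]]
    unfolding bimap_iso_imp_image_map(1)[OF iso] .
  show ?thesis
    using underlying_graph_iso[OF M iso] underlying_graph_iso[OF N bimap_iso_sym[OF M iso]]
    by (auto simp: bigraph_class_def intro: bigraph_iso_trans)
qed

text \<open>Rigidity: an isomorphism of connected maps is determined by the image of one edge-side.\<close>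

lemma bimap_agree:
  assumes M: "bicolored_map M" and inj: "inj_on \<phi> (sides M)" and eq: "image_map \<phi> M = image_map \<psi> M"
    and a: "\<phi> a = \<psi> a" and s: "(a, s) \<in> glued (edges M \<union> black_corners M \<union> white_corners M)"
  shows "\<phi> s = \<psi> s"
proof -
  have "s \<in> {s. \<phi> s = \<psi> s}"
    using s
  proof (rule glued_closed)
    fix p i j assume p: "p \<in> edges M \<union> black_corners M \<union> white_corners M" "i \<in> p" "j \<in> p"
      and i: "i \<in> {s. \<phi> s = \<psi> s}"
    then obtain P where P: "pair_partition (sides M) P" "p \<in> P" "(`) \<phi> ` P = (`) \<psi> ` P"
      using M eq by (auto simp: bicolored_map_def image_map_def)
    have "\<psi> ` p \<in> (`) \<phi> ` P" using P(2,3) by simp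
    then have "\<phi> ` p = \<psi> ` p"
      using pair_partition_unique[OF pair_partition_image[OF inj P(1)], of "\<phi> ` p" "\<psi> ` p" "\<phi> i"]
        P(2) p(2) i by auto
    moreover obtain k where k: "p = {i, k}" using pair_partition_pairE[OF P(1,2) p(2)] by metis
    ultimately have "{\<phi> i, \<phi> k} = {\<psi> i, \<psi> k}" by simp
    then have "\<phi> k = \<psi> k" using i by (auto simp: doubleton_eq_iff)
    then show "j \<in> {s. \<phi> s = \<psi> s}" using k p(3) i by auto
  qed (use a in simp)
  then show ?thesis by simp
qed

lemma image_map_cong:
  assumes M: "bicolored_map M" and eq: "\<And>s. s \<in> sides M \<Longrightarrow> \<phi> s = \<psi> s"
  shows "image_map \<phi> M = image_map \<psi> M"
proof -
  have "(`) \<phi> ` P = (`) \<psi> ` P" if "P \<subseteq> Pow (sides M)" for P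
  proof (rule image_cong[OF refl])
    fix p assume "p \<in> P"
    then show "\<phi> ` p = \<psi> ` p" using that eq by (intro image_cong[OF refl]) auto
  qed
  then show ?thesis
    using bicolored_map_sub[OF M] eq by (simp add: image_map_def)
qed

section \<open>From isomorphism classes to labeled maps\<close>

text \<open>In the applications \<open>F\<close> consists of the objects with standard labels. It
  meets every class in exactly \<open>m\<close> members, so a sum over \<open>F\<close> counts each
  class \<open>m\<close> times.\<close>

lemma sum_over_classes:
  fixes g :: "'a set \<Rightarrow> real"
  assumes eq: "equiv A R" and F: "finite F" "F \<subseteq> A" "\<And>x. x \<in> A \<Longrightarrow> \<exists>y \<in> F. (x, y) \<in> R"
    and card: "\<And>y. y \<in> F \<Longrightarrow> card {z \<in> F. (y, z) \<in> R} = m"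
  shows "(\<Sum>C \<in> A // R. g C) * m = (\<Sum>y \<in> F. g (R `` {y}))"
proof -
  have "finite (A // R)" using finite_quotient_of_reps[OF eq F(1)] F(3) by blast
  moreover have "(\<lambda>y. R `` {y}) ` F \<subseteq> A // R" using F(2) by (auto intro: quotientI)
  ultimately have "(\<Sum>y \<in> F. g (R `` {y})) = (\<Sum>C \<in> A // R. \<Sum>y \<in> {y \<in> F. R `` {y} = C}. g (R `` {y}))"
    using sum.group[OF F(1), of "A // R" "\<lambda>y. R `` {y}" "\<lambda>y. g (R `` {y})"] by simp
  also have "\<dots> = (\<Sum>C \<in> A // R. g C * m)"
  proof (rule sum.cong[OF refl])
    fix C assume "C \<in> A // R"
    then obtain x where x: "x \<in> A" "C = R `` {x}" by (auto elim: quotientE)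
    then obtain y where y: "y \<in> F" "(x, y) \<in> R" using F(3) by blast
    then have C: "C = R `` {y}" using x equiv_class_eq[OF eq] by blast
    have "{z \<in> F. R `` {z} = C} = {z \<in> F. (y, z) \<in> R}"
      using C F(2) y(1) equiv_class_eq_iff[OF eq, of y] by blast
    then have "card {z \<in> F. R `` {z} = C} = m" using card[OF y(1)] by simp
    then show "(\<Sum>y \<in> {y \<in> F. R `` {y} = C}. g (R `` {y})) = g C * m" by simp
  qed
  also have "\<dots> = (\<Sum>C \<in> A // R. g C) * m" by (simp add: sum_distrib_right)
  finally show ?thesis by simp
qed

text \<open>Off \<open>D\<close> an isomorphism is arbitrary; replacing it by the identity there
  gives a unique permutation to count.\<close>

lemma permutation_of_bij:
  assumes "bij_betw \<phi> D D"
  shows "(\<lambda>z. if z \<in> D then \<phi> z else z) permutes D"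
proof (rule bij_imp_permutes)
  show "bij_betw (\<lambda>z. if z \<in> D then \<phi> z else z) D D"
    using assms by (subst bij_betw_cong[where g = \<phi>]) auto
qed simp

context
  fixes n :: nat
begin

private abbreviation "D \<equiv> {..<2 * n}"

definition "labelled_oriented = {(M, B, e) \<in> oriented_rooted_connected n. sides M = D}"
definition "labelled_nonoriented = {(M, r) \<in> nonoriented_rooted_one_face n. sides M = D}"

lemma oriented_image:
  assumes x: "(M, B, e) \<in> oriented_rooted_connected n" and inj: "inj_on \<phi> (sides M)"
  shows "((M, B, e), (image_map \<phi> M, \<phi> ` B, \<phi> ` e)) \<in> oriented_iso n"
proof -
  have M: "bicolored_map M" and o: "orientation M B" using x by (auto simp: oriented_rooted_connected_def)
  note t = image_map_transfer[OF M inj]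
  have "\<phi> ` e \<in> edges (image_map \<phi> M)"
    using x by (auto simp: oriented_rooted_connected_def image_map_def)
  then have "(image_map \<phi> M, \<phi> ` B, \<phi> ` e) \<in> oriented_rooted_connected n"
    using x t(2-4) t(6)[OF o] by (simp add: oriented_rooted_connected_def)
  then show ?thesis using x t(1) by (auto simp: oriented_iso_def)
qed

lemma nonoriented_image:
  assumes x: "(M, r) \<in> nonoriented_rooted_one_face n" and inj: "inj_on \<phi> (sides M)"
  shows "((M, r), (image_map \<phi> M, \<phi> r)) \<in> nonoriented_iso n"
proof -
  have M: "bicolored_map M" using x by (auto simp: nonoriented_rooted_one_face_def)
  note t = image_map_transfer[OF M inj]
  have "\<phi> r \<in> sides (image_map \<phi> M)"
    using x by (auto simp: nonoriented_rooted_one_face_def image_map_def)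
  then have "(image_map \<phi> M, \<phi> r) \<in> nonoriented_rooted_one_face n"
    using x t(2,3,5) by (simp add: nonoriented_rooted_one_face_def)
  then show ?thesis using x t(1) by (auto simp: nonoriented_iso_def)
qed

lemma card_relabel_oriented:
  assumes x: "x \<in> labelled_oriented"
  shows "card {y \<in> labelled_oriented. (x, y) \<in> oriented_iso n} = fact (2 * n)"
proof -
  obtain M B e where xe: "x = (M, B, e)" by (metis surj_pair)
  have A: "(M, B, e) \<in> oriented_rooted_connected n" and D: "sides M = D"
    using x by (auto simp: labelled_oriented_def xe)
  have M: "bicolored_map M" and c: "card (components M) = 1" and o: "orientation M B" and e: "e \<in> edges M"
    using A by (auto simp: oriented_rooted_connected_def)
  have E: "pair_partition (sides M) (edges M)" using M by (simp add: bicolored_map_def)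
  have BD: "B \<subseteq> D" and eD: "e \<subseteq> D"
    using o e bicolored_map_sub(1)[OF M] D by (auto simp: orientation_def)
  have "card (e \<inter> B) = 1" using o e by (simp add: orientation_def)
  \<comment> \<open>The orientation turns the root edge into a root side: the one side of
    \<open>e\<close> in \<open>B\<close>. Relabelings with the same result agree on it, hence
    everywhere by rigidity.\<close>
  then obtain a where a: "e \<inter> B = {a}" by (auto simp: card_1_singleton_iff)
  have aD: "a \<in> sides M" using a BD D by auto
  let ?f = "\<lambda>p. (image_map p M, p ` B, p ` e)"
  have "bij_betw ?f {p. p permutes D} {y \<in> labelled_oriented. (x, y) \<in> oriented_iso n}"
    unfolding bij_betw_def
  proof (intro conjI equalityI subsetI inj_onI)
    fix p q assume p: "p \<in> {p. p permutes D}" and q: "q \<in> {p. p permutes D}" and eq: "?f p = ?f q"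
    have inj: "inj p" "inj q" using p q permutes_inj by auto
    have "p ` e \<inter> p ` B = {p a}" "q ` e \<inter> q ` B = {q a}"
      unfolding image_Int[OF inj(1), symmetric] image_Int[OF inj(2), symmetric] a by simp_all
    then have pa: "p a = q a" using eq by simp
    have "p s = q s" if "s \<in> D" for s
    proof (rule bimap_agree[where \<phi> = p and \<psi> = q, OF M _ _ pa])
      show "inj_on p (sides M)" using inj(1) by (rule inj_on_subset) simp
      show "image_map p M = image_map q M" using eq by simp
      show "(a, s) \<in> glued (edges M \<union> black_corners M \<union> white_corners M)"
        using glued_of_card_quotient_1[of "sides M" _ a s] c aD that D by (simp add: components_def)
    qed
    then show "p = q" using p q permutes_not_in by (metis ext mem_Collect_eq)
  next
    fix y assume "y \<in> ?f ` {p. p permutes D}"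
    then obtain p where p: "p permutes D" "y = ?f p" by auto
    have "inj_on p (sides M)" using permutes_inj_on[OF p(1)] .
    then have "(x, y) \<in> oriented_iso n" using oriented_image[OF A] p(2) xe by simp
    moreover have "sides (image_map p M) = D" using permutes_image[OF p(1)] D by (simp add: image_map_def)
    ultimately show "y \<in> {y \<in> labelled_oriented. (x, y) \<in> oriented_iso n}"
      using p(2) by (auto simp: labelled_oriented_def oriented_iso_def)
  next
    fix y assume y: "y \<in> {y \<in> labelled_oriented. (x, y) \<in> oriented_iso n}"
    obtain N B' e' where ye: "y = (N, B', e')" by (metis surj_pair)
    obtain \<phi> where \<phi>: "bimap_iso \<phi> M N" "\<phi> ` B = B'" "\<phi> ` e = e'"
      using y by (auto simp: oriented_iso_def xe ye)
    have "sides N = D" using y by (auto simp: labelled_oriented_def ye)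
    then have "bij_betw \<phi> D D" using \<phi>(1) D by (auto simp: bimap_iso_def)
    note p = permutation_of_bij[OF this]
    let ?p = "\<lambda>z. if z \<in> D then \<phi> z else z"
    have "image_map ?p M = N"
      unfolding bimap_iso_imp_image_map(1)[OF \<phi>(1)] by (rule image_map_cong[OF M]) (simp add: D)
    moreover have "?p ` B = B'" "?p ` e = e'"
      unfolding \<phi>(2,3)[symmetric] using BD eD by (auto intro!: image_cong)
    ultimately have "y = ?f ?p" by (simp add: ye)
    then show "y \<in> ?f ` {p. p permutes D}" using p by blast
  qed
  then have "card {y \<in> labelled_oriented. (x, y) \<in> oriented_iso n} = card {p. p permutes D}"
    by (simp add: bij_betw_same_card)
  also have "\<dots> = fact (2 * n)" by (rule card_permutations) auto
  finally show ?thesis .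
qed

lemma card_relabel_nonoriented:
  assumes x: "x \<in> labelled_nonoriented"
  shows "card {y \<in> labelled_nonoriented. (x, y) \<in> nonoriented_iso n} = fact (2 * n)"
proof -
  obtain M r where xe: "x = (M, r)" by (metis surj_pair)
  have A: "(M, r) \<in> nonoriented_rooted_one_face n" and D: "sides M = D"
    using x by (auto simp: labelled_nonoriented_def xe)
  have M: "bicolored_map M" and c: "card (faces M) = 1" and r: "r \<in> sides M"
    using A by (auto simp: nonoriented_rooted_one_face_def)
  let ?f = "\<lambda>p. (image_map p M, p r)"
  have "bij_betw ?f {p. p permutes D} {y \<in> labelled_nonoriented. (x, y) \<in> nonoriented_iso n}"
    unfolding bij_betw_def
  proof (intro conjI equalityI subsetI inj_onI)
    fix p q assume p: "p \<in> {p. p permutes D}" and q: "q \<in> {p. p permutes D}" and eq: "?f p = ?f q"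
    have inj: "inj p" using p permutes_inj by auto
    have pr: "p r = q r" using eq by simp
    have "p s = q s" if "s \<in> D" for s
    proof (rule bimap_agree[where \<phi> = p and \<psi> = q, OF M _ _ pr])
      show "inj_on p (sides M)" using inj by (rule inj_on_subset) simp
      show "image_map p M = image_map q M" using eq by simp
      \<comment> \<open>A single face already links all sides to the root, so rigidity applies
        without a separate assumption of connectedness.\<close>
      have "(r, s) \<in> glued (black_corners M \<union> white_corners M)"
        using glued_of_card_quotient_1[of "sides M" _ r s] c r that D by (simp add: faces_def)
      then show "(r, s) \<in> glued (edges M \<union> black_corners M \<union> white_corners M)"
        using glued_mono[of "black_corners M \<union> white_corners M" "edges M \<union> black_corners M \<union> white_corners M"]
        by blast
    qed
    then show "p = q" using p q permutes_not_in by (metis ext mem_Collect_eq)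
  next
    fix y assume "y \<in> ?f ` {p. p permutes D}"
    then obtain p where p: "p permutes D" "y = ?f p" by auto
    have "inj_on p (sides M)" using permutes_inj_on[OF p(1)] .
    then have "(x, y) \<in> nonoriented_iso n" using nonoriented_image[OF A] p(2) xe by simp
    moreover have "sides (image_map p M) = D" using permutes_image[OF p(1)] D by (simp add: image_map_def)
    ultimately show "y \<in> {y \<in> labelled_nonoriented. (x, y) \<in> nonoriented_iso n}"
      using p(2) by (auto simp: labelled_nonoriented_def nonoriented_iso_def)
  next
    fix y assume y: "y \<in> {y \<in> labelled_nonoriented. (x, y) \<in> nonoriented_iso n}"
    obtain N r' where ye: "y = (N, r')" by (metis surj_pair)
    obtain \<phi> where \<phi>: "bimap_iso \<phi> M N" "\<phi> r = r'"
      using y by (auto simp: nonoriented_iso_def xe ye)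
    have "sides N = D" using y by (auto simp: labelled_nonoriented_def ye)
    then have "bij_betw \<phi> D D" using \<phi>(1) D by (auto simp: bimap_iso_def)
    note p = permutation_of_bij[OF this]
    let ?p = "\<lambda>z. if z \<in> D then \<phi> z else z"
    have "image_map ?p M = N"
      unfolding bimap_iso_imp_image_map(1)[OF \<phi>(1)] by (rule image_map_cong[OF M]) (simp add: D)
    moreover have "?p r = r'" using \<phi>(2) r D by simp
    ultimately have "y = ?f ?p" by (simp add: ye)
    then show "y \<in> ?f ` {p. p permutes D}" using p by blast
  qed
  then have "card {y \<in> labelled_nonoriented. (x, y) \<in> nonoriented_iso n} = card {p. p permutes D}"
    by (simp add: bij_betw_same_card)
  also have "\<dots> = fact (2 * n)" by (rule card_permutations) auto
  finally show ?thesis .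
qed

lemma repr_map_oriented:
  assumes y: "y \<in> labelled_oriented"
  obtains \<phi> where "bimap_iso \<phi> (fst y) (repr_map (oriented_iso n `` {y}))"
proof -
  let ?C = "oriented_iso n `` {y}"
  have "y \<in> oriented_rooted_connected n" using y by (auto simp: labelled_oriented_def)
  then have "y \<in> ?C" using equiv_class_self[OF equiv_oriented_iso] by blast
  then have "(SOME X. X \<in> ?C) \<in> ?C" by (rule someI)
  then have "(y, SOME X. X \<in> ?C) \<in> oriented_iso n" by simp
  then show thesis using that unfolding repr_map_def oriented_iso_def by (auto simp: case_prod_unfold)
qed

lemma repr_map_nonoriented:
  assumes y: "y \<in> labelled_nonoriented"
  obtains \<phi> where "bimap_iso \<phi> (fst y) (repr_map (nonoriented_iso n `` {y}))"
proof -
  let ?C = "nonoriented_iso n `` {y}"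
  have "y \<in> nonoriented_rooted_one_face n" using y by (auto simp: labelled_nonoriented_def)
  then have "y \<in> ?C" using equiv_class_self[OF equiv_nonoriented_iso] by blast
  then have "(SOME X. X \<in> ?C) \<in> ?C" by (rule someI)
  then have "(y, SOME X. X \<in> ?C) \<in> nonoriented_iso n" by simp
  then show thesis using that unfolding repr_map_def nonoriented_iso_def by (auto simp: case_prod_unfold)
qed

lemma labelled_oriented_rep:
  assumes x: "x \<in> oriented_rooted_connected n"
  shows "\<exists>y \<in> labelled_oriented. (x, y) \<in> oriented_iso n"
proof -
  obtain M B e where xe: "x = (M, B, e)" by (metis surj_pair)
  have "bicolored_map M" "card (edges M) = n" using x by (auto simp: oriented_rooted_connected_def xe)
  then obtain \<phi> where \<phi>: "inj_on \<phi> (sides M)" "\<phi> ` sides M = D" using obtain_standard_labels by blast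
  have iso: "(x, (image_map \<phi> M, \<phi> ` B, \<phi> ` e)) \<in> oriented_iso n"
    using oriented_image[OF _ \<phi>(1)] x by (simp add: xe)
  moreover have "sides (image_map \<phi> M) = D" using \<phi>(2) by (simp add: image_map_def)
  ultimately have "(image_map \<phi> M, \<phi> ` B, \<phi> ` e) \<in> labelled_oriented" by (auto simp: labelled_oriented_def oriented_iso_def)
  then show ?thesis using iso by blast
qed

lemma labelled_nonoriented_rep:
  assumes x: "x \<in> nonoriented_rooted_one_face n"
  shows "\<exists>y \<in> labelled_nonoriented. (x, y) \<in> nonoriented_iso n"
proof -
  obtain M r where xe: "x = (M, r)" by (metis surj_pair)
  have "bicolored_map M" "card (edges M) = n" using x by (auto simp: nonoriented_rooted_one_face_def xe)
  then obtain \<phi> where \<phi>: "inj_on \<phi> (sides M)" "\<phi> ` sides M = D" using obtain_standard_labels by blast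
  have iso: "(x, (image_map \<phi> M, \<phi> r)) \<in> nonoriented_iso n"
    using nonoriented_image[OF _ \<phi>(1)] x by (simp add: xe)
  moreover have "sides (image_map \<phi> M) = D" using \<phi>(2) by (simp add: image_map_def)
  ultimately have "(image_map \<phi> M, \<phi> r) \<in> labelled_nonoriented" by (auto simp: labelled_nonoriented_def nonoriented_iso_def)
  then show ?thesis using iso by blast
qed

end

section \<open>Summation over labeled maps\<close>

lemma glued_Un_sub:
  assumes "glued (E \<union> P) = glued (E \<union> P')" "glued (E \<union> Q) = glued (E \<union> Q')"
  shows "glued (E \<union> P \<union> Q) \<subseteq> glued (E \<union> P' \<union> Q')"
proof (rule glued_subI)
  fix p a b assume p: "p \<in> E \<union> P \<union> Q" "a \<in> p" "b \<in> p"
  then have "(a, b) \<in> glued (E \<union> P) \<or> (a, b) \<in> glued (E \<union> Q)"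
    using glued_pair[of p "E \<union> P" a b] glued_pair[of p "E \<union> Q" a b] by auto
  moreover have "glued (E \<union> P') \<subseteq> glued (E \<union> P' \<union> Q')" "glued (E \<union> Q') \<subseteq> glued (E \<union> P' \<union> Q')"
    by (rule glued_mono; blast)+
  ultimately show "(a, b) \<in> glued (E \<union> P' \<union> Q')" using assms by blast
qed

lemma glued_Un_eq:
  assumes "glued (E \<union> P) = glued (E \<union> P')" "glued (E \<union> Q) = glued (E \<union> Q')"
  shows "glued (E \<union> P \<union> Q) = glued (E \<union> P' \<union> Q')"
  using glued_Un_sub[OF assms] glued_Un_sub[OF assms[symmetric]] by (rule equalityI)

definition connected_maps :: "'d set \<Rightarrow> 'd bimap set" where
  "connected_maps D = {M. bicolored_map M \<and> sides M = D \<and> card (components M) = 1}"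

lemma finite_connected_maps: "finite D \<Longrightarrow> finite (connected_maps D)"
  by (rule finite_subset[OF _ finite_maps_on[of D]]) (auto simp: connected_maps_def)

text \<open>The labeled underlying graph. For maps on the same edge-sides, equality here means
  identical edges and vertices, which is finer than isomorphism of graphs.\<close>

definition incidence :: "'d bimap \<Rightarrow> 'd set set \<times> ('d \<times> 'd) set \<times> ('d \<times> 'd) set" where
  "incidence M = (edges M, glued (edges M \<union> black_corners M), glued (edges M \<union> white_corners M))"

text \<open>Connectedness depends only on the graph, so exchanging corners without changing vertices
  stays within the connected maps. The groups with equal \<open>incidence\<close> are thus exactly
  those summed in \<open>sum_same_graph\<close>.\<close>

lemma incidence_fibre:
  assumes M: "M \<in> connected_maps D"
  shows "bij_betw (\<lambda>(P, Q). M\<lparr>black_corners := P, white_corners := Q\<rparr>) (same_graph_corners M)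
    {N \<in> connected_maps D. incidence N = incidence M}"
    (is "bij_betw ?f _ ?N")
proof -
  have bM: "bicolored_map M" and D: "sides M = D" and c: "card (components M) = 1"
    using M by (auto simp: connected_maps_def)
  show ?thesis
  proof (rule bij_betw_byWitness[where f' = "\<lambda>N. (black_corners N, white_corners N)"])
    show "\<forall>x \<in> same_graph_corners M. (black_corners (?f x), white_corners (?f x)) = x" by auto
    have "N = M\<lparr>black_corners := black_corners N, white_corners := white_corners N\<rparr>"
      if "N \<in> ?N" for N
      using that D by (cases N; cases M) (simp add: connected_maps_def incidence_def)
    then show "\<forall>N \<in> ?N. ?f (black_corners N, white_corners N) = N" by simp
    show "?f ` same_graph_corners M \<subseteq> ?N"
    proof (rule image_subsetI)
      fix x assume x: "x \<in> same_graph_corners M"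
      obtain P Q where xe: "x = (P, Q)" by (cases x)
      note PQ = same_graph_corners_iff[OF bM, THEN iffD1, OF x[unfolded xe]]
      have "glued (edges M \<union> P \<union> Q) = glued (edges M \<union> black_corners M \<union> white_corners M)"
        by (rule glued_Un_eq) (use PQ in auto)
      then have "components (?f x) = components M" by (simp add: components_def xe)
      then show "?f x \<in> ?N"
        using PQ bM D c by (simp add: connected_maps_def incidence_def bicolored_map_def xe)
    qed
    show "(\<lambda>N. (black_corners N, white_corners N)) ` ?N \<subseteq> same_graph_corners M"
      using same_graph_corners_iff[OF bM] D
      by (auto simp: connected_maps_def incidence_def bicolored_map_def)
  qed
qed

lemma underlying_graph_incidence:
  assumes "sides N = sides M" "incidence N = incidence M"
  shows "underlying_graph N = underlying_graph M"
proof -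
  have "edges N = edges M" using assms(2) by (simp add: incidence_def)
  moreover from this have "glued (edges M \<union> black_corners N) = glued (edges M \<union> black_corners M)"
    "glued (edges M \<union> white_corners N) = glued (edges M \<union> white_corners M)"
    using assms(2) by (simp_all add: incidence_def)
  ultimately show ?thesis
    using assms(1) by (simp add: underlying_graph_def black_vertices_def white_vertices_def)
qed

text \<open>The weight \<open>c\<close> is constant on each group of maps with one labeled graph,
  where the factor 2 is already established. Leaving \<open>c\<close> arbitrary allows it to select
  an isomorphism class.\<close>

theorem sum_connected_maps:
  fixes c :: "('d set, 'd set, 'd set) bigraph \<Rightarrow> real"
  assumes D: "finite D"
  shows "(\<Sum>M \<in> connected_maps D. c (underlying_graph M) * card {B. orientation M B}) =
    2 * (\<Sum>M \<in> connected_maps D. c (underlying_graph M) * mon_top M)"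
proof -
  let ?X = "connected_maps D"
  have fin: "finite ?X" "finite (incidence ` ?X)" using finite_connected_maps[OF D] by auto
  note group = sum.group[OF fin order.refl, symmetric]
  have fibre: "(\<Sum>M | M \<in> ?X \<and> incidence M = k. c (underlying_graph M) * card {B. orientation M B}) =
      2 * (\<Sum>M | M \<in> ?X \<and> incidence M = k. c (underlying_graph M) * mon_top M)"
    if k: "k \<in> incidence ` ?X" for k
  proof -
    obtain M where M: "M \<in> ?X" "k = incidence M" using k by blast
    let ?f = "\<lambda>(P, Q). M\<lparr>black_corners := P, white_corners := Q\<rparr>"
    let ?N = "{N \<in> ?X. incidence N = k}"
    have G: "underlying_graph N = underlying_graph M" if "N \<in> ?N" for N
      by (rule underlying_graph_incidence) (use that M in \<open>auto simp: connected_maps_def\<close>)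
    have re: "sum h ?N = (\<Sum>x \<in> same_graph_corners M. h (?f x))" for h :: "'d bimap \<Rightarrow> real"
      unfolding M(2) by (rule sum.reindex_bij_betw[OF incidence_fibre[OF M(1)], symmetric])
    have "(\<Sum>N \<in> ?N. c (underlying_graph N) * card {B. orientation N B}) =
        c (underlying_graph M) * (\<Sum>N \<in> ?N. real (card {B. orientation N B}))"
      using G by (simp add: sum_distrib_left)
    also have "\<dots> = c (underlying_graph M) * (2 * (\<Sum>N \<in> ?N. mon_top N))"
      using sum_same_graph[of M] M(1) unfolding re by (simp add: connected_maps_def case_prod_unfold)
    also have "\<dots> = 2 * (\<Sum>N \<in> ?N. c (underlying_graph N) * mon_top N)"
      using G by (simp add: sum_distrib_left mult.left_commute)
    finally show ?thesis .
  qed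
  show ?thesis
    unfolding group[of "\<lambda>M. c (underlying_graph M) * card {B. orientation M B}"]
      group[of "\<lambda>M. c (underlying_graph M) * mon_top M"]
    using fibre by (simp add: sum_distrib_left)
qed

theorem theorem0p3:
  fixes n :: nat
  assumes "n \<ge> 1"
  shows "(\<Sum>C \<in> unlabeled_oriented_rooted_connected n.
            Poly_Mapping.single (bigraph_class (underlying_graph (repr_map C))) (1 :: real)) =
         (\<Sum>C \<in> unlabeled_nonoriented_rooted_one_face n.
            Poly_Mapping.single (bigraph_class (underlying_graph (repr_map C)))
              (mon_top (repr_map C)))" (is "?L = ?R")
proof (rule poly_mapping_eqI)
  fix k
  define D where "D = {..<2 * n}"
  have D: "finite D" "card D = 2 * n" by (auto simp: D_def)
  have n_edges: "card (edges M) = n" if "bicolored_map M" "sides M = D" for M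
    using card_sides[OF that(1)] that(2) D by simp
  \<comment> \<open>The indicator of the graphs whose class is \<open>k\<close>; it extracts one
    coefficient from each formal sum.\<close>
  define c where "c G = (if bigraph_class G = k then 1 else 0 :: real)" for G :: "(nat set, nat set, nat set) bigraph"
  let ?X = "connected_maps D"
  have lo: "labelled_oriented n = (SIGMA M:?X. {B. orientation M B} \<times> edges M)"
    using n_edges by (auto simp: labelled_oriented_def oriented_rooted_connected_def connected_maps_def D_def)
  define Y where "Y = {M \<in> ?X. card (faces M) = 1}"
  \<comment> \<open>Gluing along edges only coarsens the face relation, so one face gives one
    component.\<close>
  have conn: "card (components M) = 1" if M: "bicolored_map M" "card (faces M) = 1" for M :: "nat bimap"
  proof -
    let ?R = "edges M \<union> black_corners M \<union> white_corners M"
    obtain a where a: "a \<in> sides M" using M(2) by (fastforce simp: faces_def)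
    have "(s, t) \<in> glued ?R" if "s \<in> sides M" "t \<in> sides M" for s t
    proof -
      have "(s, t) \<in> glued (black_corners M \<union> white_corners M)"
        using glued_of_card_quotient_1[of "sides M" _ s t] M(2) that by (simp add: faces_def)
      then show ?thesis
        using glued_mono[of "black_corners M \<union> white_corners M" ?R] by blast
    qed
    then have "glued ?R `` {s} = glued ?R `` {a}" if "s \<in> sides M" for s
      using glued_class_eq a that by metis
    then have "components M = (\<Union>s \<in> sides M. {glued ?R `` {a}})"
      unfolding components_def quotient_def by (intro SUP_cong) simp_all
    also have "\<dots> = {glued ?R `` {a}}" using a by blast
    finally have "components M = {glued ?R `` {a}}" .
    then show ?thesis by simp
  qed
  have ln: "labelled_nonoriented n = Y \<times> D"
    using n_edges conn
    by (auto simp: labelled_nonoriented_def nonoriented_rooted_one_face_def connected_maps_def Y_def D_def)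
  have finX: "finite ?X" by (rule finite_connected_maps[OF D(1)])
  have finO: "finite ({B. orientation M B} \<times> edges M)" if "M \<in> ?X" for M
  proof -
    have "finite {B. orientation M B}"
      by (rule finite_subset[of _ "Pow D"]) (use that D(1) in \<open>auto simp: orientation_def connected_maps_def\<close>)
    then show ?thesis using finite_edges[of M] that by (simp add: connected_maps_def)
  qed
  have "Poly_Mapping.lookup ?L k = (\<Sum>C \<in> oriented_rooted_connected n // oriented_iso n.
      c (underlying_graph (repr_map C)))"
    unfolding Poly_Mapping.lookup_sum unlabeled_oriented_rooted_connected_def
    by (intro sum.cong) (auto simp: Poly_Mapping.lookup_single c_def when_def)
  then have "Poly_Mapping.lookup ?L k * fact (2 * n) =
      (\<Sum>C \<in> oriented_rooted_connected n // oriented_iso n. c (underlying_graph (repr_map C))) * real (fact (2 * n))"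
    by simp
  also have "\<dots> = (\<Sum>y \<in> labelled_oriented n. c (underlying_graph (repr_map (oriented_iso n `` {y}))))"
  proof (rule sum_over_classes[OF equiv_oriented_iso])
    show "finite (labelled_oriented n)" unfolding lo using finX finO by (rule finite_SigmaI)
    show "labelled_oriented n \<subseteq> oriented_rooted_connected n" by (auto simp: labelled_oriented_def)
  qed (fact labelled_oriented_rep, fact card_relabel_oriented)
  also have "\<dots> = (\<Sum>y \<in> labelled_oriented n. c (underlying_graph (fst y)))"
  proof (rule sum.cong[OF refl])
    fix y assume y: "y \<in> labelled_oriented n"
    then have M: "bicolored_map (fst y)" by (auto simp: lo connected_maps_def)
    obtain \<phi> where iso: "bimap_iso \<phi> (fst y) (repr_map (oriented_iso n `` {y}))"
      using repr_map_oriented[OF y] .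
    show "c (underlying_graph (repr_map (oriented_iso n `` {y}))) = c (underlying_graph (fst y))"
      using bigraph_class_iso[OF M iso] by (simp add: c_def)
  qed
  also have "\<dots> = (\<Sum>M \<in> ?X. \<Sum>(B, e) \<in> {B. orientation M B} \<times> edges M. c (underlying_graph M))"
    using sum.Sigma[OF finX ballI[OF finO], where g = "\<lambda>M _. c (underlying_graph M)"]
    unfolding lo case_prod_unfold by simp
  also have "\<dots> = (\<Sum>M \<in> ?X. n * (c (underlying_graph M) * card {B. orientation M B}))"
    by (intro sum.cong[OF refl]) (auto simp: card_cartesian_product n_edges connected_maps_def)
  also have "\<dots> = n * (\<Sum>M \<in> ?X. c (underlying_graph M) * card {B. orientation M B})"
    by (simp add: sum_distrib_left)
  also have "\<dots> = 2 * n * (\<Sum>M \<in> ?X. c (underlying_graph M) * mon_top M)"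
    unfolding sum_connected_maps[OF D(1)] by simp
  finally have left: "Poly_Mapping.lookup ?L k * fact (2 * n) = 2 * n * (\<Sum>M \<in> ?X. c (underlying_graph M) * mon_top M)" .
  have "Poly_Mapping.lookup ?R k = (\<Sum>C \<in> nonoriented_rooted_one_face n // nonoriented_iso n.
      c (underlying_graph (repr_map C)) * mon_top (repr_map C))"
    unfolding Poly_Mapping.lookup_sum unlabeled_nonoriented_rooted_one_face_def
    by (intro sum.cong) (auto simp: Poly_Mapping.lookup_single c_def when_def)
  then have "Poly_Mapping.lookup ?R k * fact (2 * n) =
      (\<Sum>C \<in> nonoriented_rooted_one_face n // nonoriented_iso n.
        c (underlying_graph (repr_map C)) * mon_top (repr_map C)) * real (fact (2 * n))"
    by simp
  also have "\<dots> = (\<Sum>y \<in> labelled_nonoriented n. c (underlying_graph (repr_map (nonoriented_iso n `` {y}))) *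
      mon_top (repr_map (nonoriented_iso n `` {y})))"
  proof (rule sum_over_classes[OF equiv_nonoriented_iso])
    show "finite (labelled_nonoriented n)" unfolding ln Y_def using finX D(1) by simp
    show "labelled_nonoriented n \<subseteq> nonoriented_rooted_one_face n" by (auto simp: labelled_nonoriented_def)
  qed (fact labelled_nonoriented_rep, fact card_relabel_nonoriented)
  also have "\<dots> = (\<Sum>y \<in> labelled_nonoriented n. c (underlying_graph (fst y)) * mon_top (fst y))"
  proof (rule sum.cong[OF refl])
    fix y assume y: "y \<in> labelled_nonoriented n"
    then have M: "bicolored_map (fst y)" by (auto simp: ln Y_def connected_maps_def)
    obtain \<phi> where iso: "bimap_iso \<phi> (fst y) (repr_map (nonoriented_iso n `` {y}))"
      using repr_map_nonoriented[OF y] .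
    show "c (underlying_graph (repr_map (nonoriented_iso n `` {y}))) *
        mon_top (repr_map (nonoriented_iso n `` {y})) = c (underlying_graph (fst y)) * mon_top (fst y)"
      using bigraph_class_iso[OF M iso] mon_top_iso[OF M iso] by (simp add: c_def)
  qed
  also have "\<dots> = (\<Sum>M \<in> Y. \<Sum>r \<in> D. c (underlying_graph M) * mon_top M)"
    unfolding ln sum.cartesian_product case_prod_unfold ..
  also have "\<dots> = 2 * n * (\<Sum>M \<in> Y. c (underlying_graph M) * mon_top M)"
    using D(2) by (simp add: sum_distrib_left)
  \<comment> \<open>A connected map with several faces fails at the initial stage and has weight
    zero. The sum over one-face maps therefore extends to all connected maps, where the comparison
    graph by graph applies.\<close>
  also have "(\<Sum>M \<in> Y. c (underlying_graph M) * mon_top M) = (\<Sum>M \<in> ?X. c (underlying_graph M) * mon_top M)"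
  proof (rule sum.mono_neutral_left[OF finX])
    show "\<forall>M \<in> ?X - Y. c (underlying_graph M) * mon_top M = 0"
    proof
      fix M assume "M \<in> ?X - Y"
      then have "mon_top M = 0" by (intro mon_top_zero) (auto simp: Y_def connected_maps_def)
      then show "c (underlying_graph M) * mon_top M = 0" by simp
    qed
  qed (auto simp: Y_def)
  finally have "Poly_Mapping.lookup ?R k * fact (2 * n) = 2 * n * (\<Sum>M \<in> ?X. c (underlying_graph M) * mon_top M)" .
  with left have "Poly_Mapping.lookup ?L k * fact (2 * n) = Poly_Mapping.lookup ?R k * fact (2 * n)" by simp
  then show "Poly_Mapping.lookup ?L k = Poly_Mapping.lookup ?R k" by simp
qed

end
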